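(* Let $k$ be a finite field with algebraic closure $\bar{k}$, and let $\Lambda \in \mathrm{End}_k \mathbf{G}_a$ be an endomorphism of the additive group $\mathbf{G}_a$ over $k$ with nontrivial kernel over $\bar{k}$, i.e. $\{x \in \bar{k} : \Lambda(x) = 0\} \neq \{0\}$. Let $$\mathbf{G}_a(\bar{k})[\Lambda^\infty] = \{x \in \mathbf{G}_a(\bar{k}) : \Lambda^n(x) = 0 \text{ for some integer } n \geq 1\}.$$ Then there do not exist an automorphism $\sigma \in \mathrm{Gal}(\bar{k}/k)$ and a modular group defined by a difference equation involving $\sigma$ which contains $\mathbf{G}_a(\bar{k})[\Lambda^\infty]$. That is, there are no $\sigma \in \mathrm{Gal}(\bar{k}/k)$ and $\Psi \in \mathrm{End}_\sigma(\mathbf{G}_a)$ such that $\ker \Psi$ is of modular type and $\mathbf{G}_a(\bar{k})[\Lambda^\infty] \subseteq \ker \Psi(\bar{k}, \sigma)$.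
   Context: Let $p$ be the characteristic of $k$. The ring $\mathrm{End}_k \mathbf{G}_a$ is the ring of twisted polynomials $k\{F\} = \{\sum_{i=0}^n a_i F^i : a_i \in k, n \in \mathbf{N}\}$ with the commutation rule $Fa = a^pF$, where $F$ acts as $x \mapsto x^p$; similarly $\mathrm{End}_{\bar{k}} \mathbf{G}_a = \bar{k}\{F\}$. A difference field is a field together with an endomorphism. For $\sigma \in \mathrm{Gal}(\bar{k}/k)$, regard $(\bar{k}, \sigma)$ as a difference field. $\mathrm{End}_\sigma(\mathbf{G}_a)$ is the subring of the endomorphism ring of the group $\mathbf{G}_a(\bar{k})$ generated by $\sigma$ and $\mathrm{End}_{\bar{k}}(\mathbf{G}_a)$. Its elements are given by difference operators $\Psi = \sum_{i,j} a_{ij} \sigma^i F^j$ (finite sums, $i,j \geq 0$, $a_{ij} \in \bar{k}$), and such an operator acts on $\mathbf{G}_a(U) = U$ for every difference field $(U, \sigma)$ extending $(\bar{k}, \sigma)$. Write $\ker \Psi(U, \sigma) = \{x \in U : \sum_{i,j} a_{ij} \sigma^i(x^{p^j}) = 0\}$. These kernels are the groups defined by difference equations involving $\sigma$ that are considered here. Modular type. Let $(U, \sigma)$ be a sufficiently saturated existentially closed difference field extending $(\bar{k}, \sigma)$ (the notion below does not depend on the choice of $U$). For $B \subseteq U$ let $\mathrm{acl}(B)$ be the field-theoretic algebraic closure in $U$ of the smallest subfield of $U$ containing $B$ and closed under $\sigma$ and $\sigma^{-1}$. The group $\ker \Psi$ is of modular type (modular) if $\Gamma = \ker \Psi(U,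 \sigma)$ satisfies: for every small $E = \mathrm{acl}(E) \subseteq U$ containing $\bar{k}$, every finite tuple $a$ of elements of $\Gamma$ and every finite tuple $b$ of elements of $U$, the fields $\mathrm{acl}(E a)$ and $\mathrm{acl}(E b)$ are algebraically independent (free) over $\mathrm{acl}(E a) \cap \mathrm{acl}(E b)$. *)

theory Defs
  imports "HOL-Algebra.Algebraic_Closure_Type" "HOL-Library.Poly_Mapping"
begin

unbundle cardinal_syntax

text \<open>
  \<open>Ga_End S\<close> are the twisted polynomials $\sum_{i \le n} a_i F^i$ with coefficients in the
  subfield \<open>S\<close>, represented by the maps they induce on the points of the field \<open>'a\<close>, with
  composition as product.  The representation is faithful when \<open>'a\<close> is infinite; it is used only
  for algebraic closures.
\<close>

definition Ga_End :: "'a::field set \<Rightarrow> ('a \<Rightarrow> 'a) set" where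
  "Ga_End S = {(\<lambda>x. \<Sum>i\<le>n. a i * x ^ (CHAR('a) ^ i)) | (a :: nat \<Rightarrow> 'a) n. \<forall>i\<le>n. a i \<in> S}"

definition torsion :: "('a::zero \<Rightarrow> 'a) \<Rightarrow> 'a set" where
  "torsion \<Lambda> = {x. \<exists>n\<ge>1. (\<Lambda> ^^ n) x = 0}"

definition Gal :: "('k::field alg_closure \<Rightarrow> 'k alg_closure) set" where
  "Gal = {\<sigma> \<in> ring_iso ring_of_type_algebra ring_of_type_algebra. \<forall>c. \<sigma> (to_ac c) = to_ac c}"

inductive_set End_sigma :: "('a::field \<Rightarrow> 'a) \<Rightarrow> ('a \<Rightarrow> 'a) set" for \<sigma> :: "'a \<Rightarrow> 'a" where
  Ga_End: "f \<in> Ga_End UNIV \<Longrightarrow> f \<in> End_sigma \<sigma>"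
| sigma: "\<sigma> \<in> End_sigma \<sigma>"
| add: "f \<in> End_sigma \<sigma> \<Longrightarrow> g \<in> End_sigma \<sigma> \<Longrightarrow> (\<lambda>x. f x + g x) \<in> End_sigma \<sigma>"
| minus: "f \<in> End_sigma \<sigma> \<Longrightarrow> (\<lambda>x. - f x) \<in> End_sigma \<sigma>"
| comp: "f \<in> End_sigma \<sigma> \<Longrightarrow> g \<in> End_sigma \<sigma> \<Longrightarrow> f \<circ> g \<in> End_sigma \<sigma>"

text \<open>
  A difference operator is the formal sum of the $a_{ij} \sigma^i F^j$; the coefficient $a_{ij}$
  is stored at the key \<open>(i, j)\<close>.  It acts on every difference field \<open>('u, \<tau>)\<close> into which
  the coefficients are embedded by \<open>\<iota>\<close>.  Different operators may induce the same map on
  the coefficient field itself and still have different kernels in an extension.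
\<close>

type_synonym 'a diff_op = "(nat \<times> nat) \<Rightarrow>\<^sub>0 'a"

definition diff_op_apply ::
    "('a::field \<Rightarrow> 'u::field) \<Rightarrow> ('u \<Rightarrow> 'u) \<Rightarrow> 'a diff_op \<Rightarrow> 'u \<Rightarrow> 'u" where
  "diff_op_apply \<iota> \<tau> P x =
     (\<Sum>(i, j)\<in>Poly_Mapping.keys P.
        \<iota> (Poly_Mapping.lookup P (i, j)) * (\<tau> ^^ i) (x ^ (CHAR('a) ^ j)))"

definition diff_op_ker ::
    "('a::field \<Rightarrow> 'u::field) \<Rightarrow> ('u \<Rightarrow> 'u) \<Rightarrow> 'a diff_op \<Rightarrow> 'u set" where
  "diff_op_ker \<iota> \<tau> P = {x. diff_op_apply \<iota> \<tau> P x = 0}"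

datatype (params_tm: 'p) dterm =
    TVar nat
  | TParam 'p
  | TZero
  | TOne
  | TPlus "'p dterm" "'p dterm"
  | TTimes "'p dterm" "'p dterm"
  | TNeg "'p dterm"
  | TSig "'p dterm"

datatype (params: 'p) dform =
    FEqual "'p dterm" "'p dterm"
  | FNot "'p dform"
  | FAnd "'p dform" "'p dform"
  | FEx nat "'p dform"

primrec fv_tm :: "'p dterm \<Rightarrow> nat set" where
  "fv_tm (TVar n) = {n}"
| "fv_tm (TParam c) = {}"
| "fv_tm TZero = {}"
| "fv_tm TOne = {}"
| "fv_tm (TPlus s t) = fv_tm s \<union> fv_tm t"
| "fv_tm (TTimes s t) = fv_tm s \<union> fv_tm t"
| "fv_tm (TNeg t) = fv_tm t"
| "fv_tm (TSig t) = fv_tm t"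

primrec fv :: "'p dform \<Rightarrow> nat set" where
  "fv (FEqual s t) = fv_tm s \<union> fv_tm t"
| "fv (FNot \<phi>) = fv \<phi>"
| "fv (FAnd \<phi> \<psi>) = fv \<phi> \<union> fv \<psi>"
| "fv (FEx n \<phi>) = fv \<phi> - {n}"

primrec qfree :: "'p dform \<Rightarrow> bool" where
  "qfree (FEqual s t) \<longleftrightarrow> True"
| "qfree (FNot \<phi>) \<longleftrightarrow> qfree \<phi>"
| "qfree (FAnd \<phi> \<psi>) \<longleftrightarrow> qfree \<phi> \<and> qfree \<psi>"
| "qfree (FEx n \<phi>) \<longleftrightarrow> False"

primrec eval_tm ::
    "('a, 'm) ring_scheme \<Rightarrow> ('a \<Rightarrow> 'a) \<Rightarrow> ('p \<Rightarrow> 'a) \<Rightarrow> (nat \<Rightarrow> 'a) \<Rightarrow> 'p dterm \<Rightarrow> 'a" where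
  "eval_tm R \<tau> j v (TVar n) = v n"
| "eval_tm R \<tau> j v (TParam c) = j c"
| "eval_tm R \<tau> j v TZero = \<zero>\<^bsub>R\<^esub>"
| "eval_tm R \<tau> j v TOne = \<one>\<^bsub>R\<^esub>"
| "eval_tm R \<tau> j v (TPlus s t) = eval_tm R \<tau> j v s \<oplus>\<^bsub>R\<^esub> eval_tm R \<tau> j v t"
| "eval_tm R \<tau> j v (TTimes s t) = eval_tm R \<tau> j v s \<otimes>\<^bsub>R\<^esub> eval_tm R \<tau> j v t"
| "eval_tm R \<tau> j v (TNeg t) = \<ominus>\<^bsub>R\<^esub> eval_tm R \<tau> j v t"
| "eval_tm R \<tau> j v (TSig t) = \<tau> (eval_tm R \<tau> j v t)"

primrec sat ::
    "('a, 'm) ring_scheme \<Rightarrow> ('a \<Rightarrow> 'a) \<Rightarrow> ('p \<Rightarrow> 'a) \<Rightarrow> 'p dform \<Rightarrow> (nat \<Rightarrow> 'a) \<Rightarrow> bool" where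
  "sat R \<tau> j (FEqual s t) = (\<lambda>v. eval_tm R \<tau> j v s = eval_tm R \<tau> j v t)"
| "sat R \<tau> j (FNot \<phi>) = (\<lambda>v. \<not> sat R \<tau> j \<phi> v)"
| "sat R \<tau> j (FAnd \<phi> \<psi>) = (\<lambda>v. sat R \<tau> j \<phi> v \<and> sat R \<tau> j \<psi> v)"
| "sat R \<tau> j (FEx n \<phi>) = (\<lambda>v. \<exists>x\<in>carrier R. sat R \<tau> j \<phi> (v(n := x)))"

definition difference_field :: "('a, 'm) ring_scheme \<Rightarrow> ('a \<Rightarrow> 'a) \<Rightarrow> bool" where
  "difference_field R \<tau> \<longleftrightarrow> Ring.field R \<and> \<tau> \<in> ring_hom R R"

definition difference_embedding ::
    "('a, 'm) ring_scheme \<Rightarrow> ('a \<Rightarrow> 'a) \<Rightarrow> ('b, 'n) ring_scheme \<Rightarrow> ('b \<Rightarrow> 'b) \<Rightarrow> ('a \<Rightarrow> 'b) \<Rightarrow> bool" where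
  "difference_embedding R \<tau> S \<tau>' j \<longleftrightarrow>
     difference_field R \<tau> \<and> difference_field S \<tau>' \<and>
     j \<in> ring_hom R S \<and> (\<forall>x\<in>carrier R. j (\<tau> x) = \<tau>' (j x))"

text \<open>
  Every finite system of difference equations and inequations over the field that has a solution
  in some extension already has one in the field.  HOL cannot quantify over the type of the
  extension \<open>S\<close>; for infinite \<open>'u\<close> extensions carried by subsets of \<open>'u\<close> are
  enough, because the difference field generated over the base by a finite solution has the
  cardinality of \<open>'u\<close>.
\<close>

definition existentially_closed :: "('u::field \<Rightarrow> 'u) \<Rightarrow> bool" where
  "existentially_closed \<tau> \<longleftrightarrow>
     difference_field (ring_of_type_algebra :: 'u ring) \<tau> \<and>
     (\<forall>(S :: 'u ring) \<tau>' j \<phi>.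
        difference_embedding ring_of_type_algebra \<tau> S \<tau>' j \<and> qfree \<phi> \<and>
        (\<exists>v. (\<forall>n. v n \<in> carrier S) \<and> sat S \<tau>' j \<phi> v) \<longrightarrow>
        (\<exists>v. sat ring_of_type_algebra \<tau> id \<phi> v))"

text \<open>
  \<open>\<kappa>\<close>-saturation: a set of formulas in the one free variable \<open>0\<close>, with fewer than
  \<open>\<kappa>\<close> parameters, is realised as soon as it is finitely satisfiable.
\<close>

definition saturated :: "'c rel \<Rightarrow> ('u::field \<Rightarrow> 'u) \<Rightarrow> bool" where
  "saturated \<kappa> \<tau> \<longleftrightarrow>
     (\<forall>(A :: 'u set) T.
        |A| <o \<kappa> \<and> (\<forall>\<phi>\<in>T. params \<phi> \<subseteq> A \<and> fv \<phi> \<subseteq> {0}) \<and>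
        (\<forall>T0\<subseteq>T. finite T0 \<longrightarrow> (\<exists>x. \<forall>\<phi>\<in>T0. sat ring_of_type_algebra \<tau> id \<phi> (\<lambda>_. x))) \<longrightarrow>
        (\<exists>x. \<forall>\<phi>\<in>T. sat ring_of_type_algebra \<tau> id \<phi> (\<lambda>_. x)))"

text \<open>
  A sufficiently saturated existentially closed extension \<open>('u, \<tau>)\<close> of \<open>('a, \<sigma>)\<close>:
  it is \<open>\<kappa>\<close>-saturated for a cardinal \<open>\<kappa>\<close> above that of \<open>'a\<close>, and the
  small sets are those of cardinality below \<open>\<kappa>\<close>.
\<close>

definition universal_domain ::
    "'c rel \<Rightarrow> ('a::field \<Rightarrow> 'a) \<Rightarrow> ('u::field \<Rightarrow> 'u) \<Rightarrow> ('a \<Rightarrow> 'u) \<Rightarrow> bool" where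
  "universal_domain \<kappa> \<sigma> \<tau> \<iota> \<longleftrightarrow>
     Card_order \<kappa> \<and> |UNIV :: 'a set| <o \<kappa> \<and>
     difference_embedding ring_of_type_algebra \<sigma> ring_of_type_algebra \<tau> \<iota> \<and>
     existentially_closed \<tau> \<and> saturated \<kappa> \<tau>"

text \<open>
  In the existentially closed fields considered here \<open>\<tau>\<close> is bijective, so
  \<open>inv_into UNIV \<tau>\<close> is its inverse.
\<close>

definition acl :: "('u::field \<Rightarrow> 'u) \<Rightarrow> 'u set \<Rightarrow> 'u set" where
  "acl \<tau> B = {x. ring.algebraic ring_of_type_algebra
     (\<Inter>{F. subfield F ring_of_type_algebra \<and> B \<subseteq> F \<and> \<tau> ` F \<subseteq> F \<and> inv_into UNIV \<tau> ` F \<subseteq> F}) x}"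

text \<open>
  Polynomials in variables indexed by field elements, evaluated by substituting for each variable
  the element that indexes it.
\<close>

definition mpoly_value :: "(('u \<Rightarrow>\<^sub>0 nat) \<Rightarrow>\<^sub>0 'u) \<Rightarrow> 'u::field" where
  "mpoly_value P =
     (\<Sum>m\<in>Poly_Mapping.keys P. Poly_Mapping.lookup P m * (\<Prod>s\<in>Poly_Mapping.keys m. s ^ Poly_Mapping.lookup m s))"

definition alg_indep :: "'u::field set \<Rightarrow> 'u set \<Rightarrow> bool" where
  "alg_indep C S \<longleftrightarrow>
     (\<forall>P. (\<forall>m. Poly_Mapping.lookup P m \<in> C) \<and> (\<forall>m\<in>Poly_Mapping.keys P. Poly_Mapping.keys m \<subseteq> S) \<and>
          mpoly_value P = 0 \<longrightarrow> P = 0)"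

definition free_over :: "'u::field set \<Rightarrow> 'u set \<Rightarrow> 'u set \<Rightarrow> bool" where
  "free_over C A B \<longleftrightarrow> (\<forall>S\<subseteq>A. finite S \<and> alg_indep C S \<longrightarrow> alg_indep B S)"

definition modular_in ::
    "'c rel \<Rightarrow> ('u::field \<Rightarrow> 'u) \<Rightarrow> ('a \<Rightarrow> 'u) \<Rightarrow> 'u set \<Rightarrow> bool" where
  "modular_in \<kappa> \<tau> \<iota> \<Gamma> \<longleftrightarrow>
     (\<forall>E. |E| <o \<kappa> \<and> E = acl \<tau> E \<and> range \<iota> \<subseteq> E \<longrightarrow>
        (\<forall>a b. set a \<subseteq> \<Gamma> \<longrightarrow>
           free_over (acl \<tau> (E \<union> set a) \<inter> acl \<tau> (E \<union> set b))
             (acl \<tau> (E \<union> set a)) (acl \<tau> (E \<union> set b))))"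

text \<open>
  Every element of the generated ring \<open>End_sigma \<sigma>\<close> is given by a difference operator, and
  every operator defines an element.
\<close>

lemma diff_op_apply_superset:
  assumes "finite A" "Poly_Mapping.keys P \<subseteq> A"
  shows "diff_op_apply id \<sigma> P x =
    (\<Sum>(i, j)\<in>A. Poly_Mapping.lookup P (i, j) * (\<sigma> ^^ i) ((x::'a::field) ^ (CHAR('a) ^ j)))"
  unfolding diff_op_apply_def id_apply
  by (rule sum.mono_neutral_left) (use assms in \<open>auto simp: in_keys_iff\<close>)

lemma diff_op_apply_add:
  "diff_op_apply id \<sigma> (P + Q) x = diff_op_apply id \<sigma> P x + diff_op_apply id \<sigma> Q (x::'a::field)"
proof -
  let ?A = "Poly_Mapping.keys P \<union> Poly_Mapping.keys Q"
  have "Poly_Mapping.keys (P + Q) \<subseteq> ?A"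
    by (rule Poly_Mapping.keys_add)
  then show ?thesis
    by (simp add: diff_op_apply_superset[of ?A] lookup_add sum.distrib[symmetric]
        case_prod_unfold ring_distribs)
qed

lemma diff_op_apply_uminus:
  "diff_op_apply id \<sigma> (- P) x = - diff_op_apply id \<sigma> P (x::'a::field)"
  by (simp add: diff_op_apply_def sum_negf[symmetric] case_prod_unfold)

lemma diff_op_apply_single:
  "diff_op_apply id \<sigma> (Poly_Mapping.single (i, j) c) x = c * (\<sigma> ^^ i) ((x::'a::field) ^ (CHAR('a) ^ j))"
  by (subst diff_op_apply_superset[of "{(i, j)}"]) auto

theorem End_sigma_eq_diff_ops:
  fixes \<sigma> :: "'a::field \<Rightarrow> 'a"
  assumes \<sigma>: "\<sigma> \<in> ring_hom ring_of_type_algebra ring_of_type_algebra" and p: "prime CHAR('a)"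
  shows "End_sigma \<sigma> = range (diff_op_apply id \<sigma>)"
proof
  let ?R = "range (diff_op_apply id \<sigma>)"
  have s_add: "\<sigma> (x + y) = \<sigma> x + \<sigma> y" and s_mult: "\<sigma> (x * y) = \<sigma> x * \<sigma> y" and s_1: "\<sigma> 1 = 1"
    for x y
    using \<sigma> by (auto simp: ring_hom_def ring_of_type_algebra_def)
  have s_0: "\<sigma> 0 = 0"
    using s_add[of 0 0] by (metis add_cancel_left_left add.right_neutral)
  have i_add: "(\<sigma> ^^ i) (x + y) = (\<sigma> ^^ i) x + (\<sigma> ^^ i) y"
    and i_mult: "(\<sigma> ^^ i) (x * y) = (\<sigma> ^^ i) x * (\<sigma> ^^ i) y"
    and i_0: "(\<sigma> ^^ i) 0 = 0" and i_1: "(\<sigma> ^^ i) 1 = 1" for i x y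
    by (induction i) (auto simp: s_add s_mult s_0 s_1)
  have i_pow: "(\<sigma> ^^ i) (x ^ n) = (\<sigma> ^^ i) x ^ n" for i x n
    by (induction n) (auto simp: i_mult i_1)
  have add: "(\<lambda>x. f x + g x) \<in> ?R" if "f \<in> ?R" "g \<in> ?R" for f g
  proof -
    from that obtain P Q where "f = diff_op_apply id \<sigma> P" "g = diff_op_apply id \<sigma> Q" by auto
    then have "(\<lambda>x. f x + g x) = diff_op_apply id \<sigma> (P + Q)"
      by (auto simp: diff_op_apply_add)
    then show ?thesis by blast
  qed
  have uminus: "(\<lambda>x. - f x) \<in> ?R" if "f \<in> ?R" for f
  proof -
    from that obtain P where "f = diff_op_apply id \<sigma> P" by auto
    then have "(\<lambda>x. - f x) = diff_op_apply id \<sigma> (- P)"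
      by (auto simp: diff_op_apply_uminus)
    then show ?thesis by blast
  qed
  have mono: "(\<lambda>x. c * (\<sigma> ^^ i) (x ^ (CHAR('a) ^ j))) \<in> ?R" for c i j
    by (rule range_eqI[of _ _ "Poly_Mapping.single (i, j) c"]) (auto simp: diff_op_apply_single)
  have zero: "(\<lambda>x. 0) \<in> ?R"
    by (rule range_eqI[of _ _ 0]) (auto simp: diff_op_apply_def)
  have sum: "(\<lambda>x. \<Sum>i\<in>A. f i x) \<in> ?R" if "\<And>i. i \<in> A \<Longrightarrow> f i \<in> ?R" for A and f :: "'i \<Rightarrow> 'a \<Rightarrow> 'a"
    using that by (induction A rule: infinite_finite_induct) (auto intro!: add zero simp del: image_iff)
  have mono_sum: "c * (\<sigma> ^^ i) ((\<Sum>l\<in>A. f l) ^ (CHAR('a) ^ j)) =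
      (\<Sum>l\<in>A. c * (\<sigma> ^^ i) (f l ^ (CHAR('a) ^ j)))" for c i j A and f :: "nat \<times> nat \<Rightarrow> 'a"
  proof -
    have "(\<sigma> ^^ i) (\<Sum>l\<in>A. g l) = (\<Sum>l\<in>A. (\<sigma> ^^ i) (g l))" for g :: "nat \<times> nat \<Rightarrow> 'a"
      by (induction A rule: infinite_finite_induct) (auto simp: i_add i_0)
    then show ?thesis
      by (simp add: freshmans_dream_sum'[OF p refl] sum_distrib_left)
  qed
  have comp: "f \<circ> g \<in> ?R" if "f \<in> ?R" "g \<in> ?R" for f g
  proof -
    from that obtain P Q where f: "f = diff_op_apply id \<sigma> P" and g: "g = diff_op_apply id \<sigma> Q"
      by auto
    have "(\<lambda>x. \<Sum>u\<in>Poly_Mapping.keys P. \<Sum>w\<in>Poly_Mapping.keys Q.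
        Poly_Mapping.lookup P u * (\<sigma> ^^ fst u)
          ((Poly_Mapping.lookup Q w * (\<sigma> ^^ fst w) (x ^ (CHAR('a) ^ snd w))) ^ (CHAR('a) ^ snd u))) \<in> ?R"
    proof (intro sum)
      fix u w
      have "(\<lambda>x. Poly_Mapping.lookup P u * (\<sigma> ^^ fst u)
          ((Poly_Mapping.lookup Q w * (\<sigma> ^^ fst w) (x ^ (CHAR('a) ^ snd w))) ^ (CHAR('a) ^ snd u))) =
        (\<lambda>x. (Poly_Mapping.lookup P u * (\<sigma> ^^ fst u) (Poly_Mapping.lookup Q w ^ (CHAR('a) ^ snd u)))
          * (\<sigma> ^^ (fst u + fst w)) (x ^ (CHAR('a) ^ (snd w + snd u))))"
        by (simp add: power_mult_distrib i_mult i_pow funpow_add power_add power_mult mult.assoc)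
      then show "(\<lambda>x. Poly_Mapping.lookup P u * (\<sigma> ^^ fst u)
          ((Poly_Mapping.lookup Q w * (\<sigma> ^^ fst w) (x ^ (CHAR('a) ^ snd w))) ^ (CHAR('a) ^ snd u))) \<in> ?R"
        by (simp only: mono)
    qed
    also have "(\<lambda>x. \<Sum>u\<in>Poly_Mapping.keys P. \<Sum>w\<in>Poly_Mapping.keys Q.
        Poly_Mapping.lookup P u * (\<sigma> ^^ fst u)
          ((Poly_Mapping.lookup Q w * (\<sigma> ^^ fst w) (x ^ (CHAR('a) ^ snd w))) ^ (CHAR('a) ^ snd u))) = f \<circ> g"
      unfolding f g diff_op_apply_def comp_def id_apply case_prod_unfold prod.collapse mono_sum ..
    finally show ?thesis .
  qed
  show "End_sigma \<sigma> \<subseteq> ?R"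
  proof
    fix f assume "f \<in> End_sigma \<sigma>"
    then show "f \<in> ?R"
    proof induction
      case (Ga_End f)
      then obtain a :: "nat \<Rightarrow> 'a" and n where f: "f = (\<lambda>x. \<Sum>i\<le>n. a i * x ^ (CHAR('a) ^ i))"
        unfolding Ga_End_def by auto
      show ?case
        unfolding f by (intro sum) (use mono[of _ 0] in simp)
    next
      case sigma
      have "\<sigma> = (\<lambda>x. 1 * (\<sigma> ^^ 1) (x ^ (CHAR('a) ^ 0)))" by simp
      then show ?case using mono[of 1 1 0] by (simp only:)
    qed (rule add uminus comp, assumption+)+
  qed
  have E_mono: "(\<lambda>x. c * (\<sigma> ^^ i) (x ^ (CHAR('a) ^ j))) \<in> End_sigma \<sigma>" for c i j
  proof -
    have "(\<lambda>x. c * x) \<in> Ga_End UNIV" for c :: 'a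
      unfolding Ga_End_def by (auto intro!: exI[of _ "\<lambda>_. c"] exI[of _ 0])
    then have c: "(\<lambda>x. c * x) \<in> End_sigma \<sigma>" for c
      by (rule End_sigma.Ga_End)
    have "(\<lambda>x::'a. x ^ (CHAR('a) ^ j)) = (\<lambda>x. \<Sum>i\<le>j. (if i = j then 1 else 0) * x ^ (CHAR('a) ^ i))"
      by (simp add: if_distrib[of "\<lambda>c. c * _"] cong: if_cong)
    then have "(\<lambda>x::'a. x ^ (CHAR('a) ^ j)) \<in> Ga_End UNIV"
      unfolding Ga_End_def mem_Collect_eq
      by (intro exI[of _ "\<lambda>i. if i = j then 1 else 0"] exI[of _ j]) simp
    then have "(\<lambda>x. x ^ (CHAR('a) ^ j)) \<in> End_sigma \<sigma>"
      by (rule End_sigma.Ga_End)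
    moreover have "\<sigma> ^^ i \<in> End_sigma \<sigma>"
    proof (induction i)
      case 0
      show ?case using c[of 1] by (simp add: id_def)
    next
      case (Suc i)
      then show ?case unfolding funpow.simps by (intro End_sigma.comp End_sigma.sigma)
    qed
    ultimately have "(\<lambda>x. c * x) \<circ> ((\<sigma> ^^ i) \<circ> (\<lambda>x. x ^ (CHAR('a) ^ j))) \<in> End_sigma \<sigma>"
      by (intro End_sigma.comp c)
    then show ?thesis by (simp add: comp_def)
  qed
  show "?R \<subseteq> End_sigma \<sigma>"
  proof safe
    fix P :: "'a diff_op"
    have "(\<lambda>x. \<Sum>u\<in>A. Poly_Mapping.lookup P u * (\<sigma> ^^ fst u) (x ^ (CHAR('a) ^ snd u))) \<in> End_sigma \<sigma>" for A
      by (induction A rule: infinite_finite_induct)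
        (use E_mono[of 0 0 0] in \<open>auto intro!: End_sigma.add E_mono\<close>)
    then show "diff_op_apply id \<sigma> P \<in> End_sigma \<sigma>"
      unfolding diff_op_apply_def[abs_def] id_apply case_prod_unfold prod.collapse .
  qed
qed

end

theory Submission
  imports Defs
begin

text \<open>
  Choose a finite field \<open>Fq\<close> with \<open>q\<close> elements that contains \<open>ker \<Lambda>\<close> and the coefficients of
  \<open>\<Lambda>\<close> and of \<open>\<Psi>\<close>, and put \<open>t x = x^q - x\<close>.  The torsion of \<open>\<Lambda>\<close> is an infinite subset of the
  \<open>t\<close>-torsion \<open>V\<close>, which is a union of finite fields.  On \<open>V\<close> the kernels of the powers of \<open>t\<close> form a
  filtration with quotients of dimension one over \<open>Fq\<close>, so a \<open>Fq\<close>-linear operator commuting with \<open>t\<close>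
  either vanishes or has a finite kernel.

  If \<open>\<Psi> \<noteq> 0\<close> kills the torsion, a power of \<open>\<sigma>\<close> is algebraic over the \<open>q\<close>-Frobenius on \<open>V\<close>, and
  therefore so is every operator.  The minimal equation of \<open>\<Psi>\<close> has no constant term and yields a
  nonzero operator \<open>e\<close> with \<open>\<Psi> e = 0\<close> on \<open>V\<close>.  By independence of characters a combination of the
  \<open>v \<mapsto> e (c v)\<close> with \<open>c \<in> Fq\<close> is semilinear, hence divides a nonzero polynomial in the Frobenius: a
  point \<open>v\<close> is algebraic over the elements \<open>e (c v)\<close> of \<open>ker \<Psi>\<close>.

  Counting in the finite fields that exhaust \<open>V\<close>, saturation gives \<open>x\<close>, \<open>\<mu>\<close>, \<open>c\<close> in \<open>U\<close> such
  that \<open>x\<close> and \<open>y = \<mu> x + c\<close> satisfy the same equations, \<open>x\<close> is not algebraic over \<open>\<mu>\<close>, \<open>c\<close>, and \<open>\<mu>\<close>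
  is not algebraic over \<open>x\<close>, \<open>y\<close>.  Were \<open>ker \<Psi>\<close> modular, \<open>x\<close> and \<open>y\<close> would be dependent over the
  field \<open>C\<close> of elements algebraic over both pairs, and the top coefficient of such a dependence in
  \<open>\<mu> x + c\<close> makes \<open>\<mu>\<close> algebraic over \<open>C\<close>, hence over \<open>x\<close>, \<open>y\<close>.
\<close>


section \<open>Frobenius operators on a union of finite fields\<close>

text \<open>Modularity speaks of tuples in \<open>ker \<Psi>\<close>, which is merely a group,
  whereas the configuration that refutes it, a line \<open>y = \<mu> x + c\<close>, needs
  multiplication. The torsion lies in \<open>V\<close>, which is at the same time a field, and
  \<open>e\<close> transports points of \<open>V\<close> into the kernel; this is why
  \<open>e\<close> has to be constructed. As a module over the power series ring in \<open>t\<close>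
  with coefficients in \<open>Fq\<close>, \<open>V\<close> is divisible and uniserial, and the
  \<open>Fq\<close>-linear operators commuting with \<open>t\<close> are themselves power series in
  \<open>t\<close>, without zero divisors. Operators in general are twisted by automorphisms of
  \<open>Fq\<close> and behave like matrices over that ring: zero divisors do occur there, which
  makes \<open>e\<close> possible, but \<open>e\<close> itself may then have an infinite kernel on
  \<open>V\<close>. Multiplying the argument by scalars of \<open>Fq\<close> separates the twists
  and leads back to power series. The case \<open>\<Psi> = 0\<close> yields no algebraic relation
  and is treated apart, with the identity as \<open>e\<close>.\<close>

definition opf :: "('a::field \<Rightarrow> 'u::field) \<Rightarrow> ('u \<Rightarrow> 'u) \<Rightarrow> ('a \<times> nat \<times> nat) list \<Rightarrow> 'u \<Rightarrow> 'u" where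
  "opf \<iota> \<tau> xs u = (\<Sum>(c, i, j)\<leftarrow>xs. \<iota> c * (\<tau> ^^ i) (u ^ (CHAR('a) ^ j)))"

lemma opf_Nil [simp]: "opf \<iota> \<tau> [] u = 0"
  by (simp add: opf_def)

lemma opf_Cons [simp]:
  "opf \<iota> \<tau> ((c, i, j) # xs) u = \<iota> c * (\<tau> ^^ i) (u ^ (CHAR('a) ^ j)) + opf \<iota> \<tau> xs u"
  for c :: "'a::field"
  by (simp add: opf_def)

lemma opf_append [simp]: "opf \<iota> \<tau> (xs @ ys) u = opf \<iota> \<tau> xs u + opf \<iota> \<tau> ys u"
  by (simp add: opf_def)

lemma finite_power_eq_self:
  assumes "n > 1"
  shows "finite {x::'a::field. x ^ n = x}"
proof -
  let ?f = "monom (1::'a) n - monom 1 1"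
  have "coeff ?f n = 1" using assms by simp
  then have "?f \<noteq> 0" by (metis coeff_0 zero_neq_one)
  then have "finite {x. poly ?f x = 0}" by (rule poly_roots_finite)
  then show ?thesis by (simp add: poly_monom)
qed

text \<open>\<open>u n\<close> is an \<open>n\<close>-fold preimage of the one given nonzero kernel
  point. For \<open>i < j\<close> the map \<open>f ^^ j\<close> kills \<open>u i\<close> but sends
  \<open>u j\<close> to \<open>x\<close>, so they all differ. Used for \<open>t\<close>, to bound
  the finite fields in \<open>V\<close> from below, and for \<open>\<Lambda>\<close>, to make its
  torsion infinite.\<close>

lemma iterated_preimages:
  fixes f :: "'a::zero \<Rightarrow> 'a"
  assumes "surj f" "f 0 = 0" "f x = 0" "x \<noteq> 0"
  obtains u :: "nat \<Rightarrow> 'a" where "inj u" "\<And>n k. n < k \<Longrightarrow> (f ^^ k) (u n) = 0"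
proof -
  have "\<exists>u. (f ^^ n) u = x" for n using surj_fn[OF assms(1), of n] by (metis surjD)
  then obtain u where u: "\<And>n. (f ^^ n) (u n) = x" by metis
  have zero: "(f ^^ k) 0 = 0" for k using assms(2) by (induction k) auto
  have u0: "(f ^^ k) (u n) = 0" if "n < k" for n k
  proof -
    have "(f ^^ ((k - Suc n) + Suc n)) (u n) = 0" unfolding funpow_add by (simp add: u assms zero)
    then show ?thesis using that by simp
  qed
  have "inj u"
  proof (rule linorder_injI)
    fix i j :: nat assume "i < j"
    then show "u i \<noteq> u j" using u[of j] u0[of i j] assms(4) by auto
  qed
  then show ?thesis using u0 by (rule that)
qed

text \<open>\<open>m\<close> is the degree over the prime field of the finite field
  \<open>Fq\<close> to be fixed, and \<open>M\<close> is a period of \<open>\<sigma>\<close> on it.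
  So \<open>\<sigma> ^^ M\<close> and the \<open>q\<close>-Frobenius are \<open>Fq\<close>-linear,
  while \<open>\<sigma>\<close> and the \<open>p\<close>-Frobenius are in general only
  semilinear.\<close>

locale difference_frobenius =
  fixes \<sigma> :: "'a::alg_closed_field \<Rightarrow> 'a" and m M :: nat
  assumes prime_char: "prime CHAR('a)"
    and \<sigma>_add: "\<sigma> (x + y) = \<sigma> x + \<sigma> y"
    and \<sigma>_mult: "\<sigma> (x * y) = \<sigma> x * \<sigma> y"
    and \<sigma>_1: "\<sigma> 1 = 1"
    and m_pos: "m > 0" and M_pos: "M > 0"
    and \<sigma>_M: "x ^ (CHAR('a) ^ m) = x \<Longrightarrow> (\<sigma> ^^ M) x = x"
begin

text \<open>
  The polynomials in \<open>S\<close> have coefficients fixed by \<open>\<sigma>\<close> and the Frobenius, so \<open>act d\<close>, the value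
  of \<open>d\<close> at the \<open>q\<close>-Frobenius, commutes with all operators in \<open>R\<close>.
\<close>

definition q :: nat where "q = CHAR('a) ^ m"
definition Fq :: "'a set" where "Fq = {x. x ^ q = x}"
definition k2 :: "'a set" where "k2 = {x. x ^ CHAR('a) = x \<and> \<sigma> x = x}"
definition t :: "'a \<Rightarrow> 'a" where "t x = x ^ q - x"
text \<open>\<open>lev r\<close> is the field with \<open>q ^ (p ^ r)\<close> elements,
  \<open>p\<close> being the characteristic. As \<open>t ^^ (p ^ r)\<close> is a power of the
  \<open>q\<close>-Frobenius minus the identity, these fields are cofinal among the kernels of the
  powers of \<open>t\<close>, and \<open>V\<close> is their union.\<close>

definition lev :: "nat \<Rightarrow> 'a set" where "lev r = {x. x ^ (q ^ (CHAR('a) ^ r)) = x}"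
definition V :: "'a set" where "V = {v. \<exists>n. (t ^^ n) v = 0}"
definition act :: "'a poly \<Rightarrow> 'a \<Rightarrow> 'a" where
  "act d v = (\<Sum>j\<le>degree d. coeff d j * v ^ (q ^ j))"
definition S :: "'a poly set" where "S = {d. \<forall>j. coeff d j \<in> k2}"
definition opr :: "('a \<times> nat \<times> nat) list \<Rightarrow> 'a \<Rightarrow> 'a" where "opr = opf id \<sigma>"
definition R :: "('a \<Rightarrow> 'a) set" where "R = {opr xs |xs. \<forall>(c, i, j)\<in>set xs. c \<in> Fq}"

lemma p_gt_1: "CHAR('a) > 1"
  by (rule prime_gt_1_nat[OF prime_char])

lemma q_gt_1: "q > 1"
  unfolding q_def using p_gt_1 m_pos by (metis one_less_power)

lemma pow_p_add: "(x + y :: 'a) ^ (CHAR('a) ^ j) = x ^ (CHAR('a) ^ j) + y ^ (CHAR('a) ^ j)"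
  by (rule freshmans_dream'[OF prime_char refl])

lemma q_pow: "q ^ j = CHAR('a) ^ (m * j)"
  by (simp add: q_def power_mult)

lemma pow_q_add: "(x + y :: 'a) ^ (q ^ j) = x ^ (q ^ j) + y ^ (q ^ j)"
  unfolding q_pow by (rule pow_p_add)

lemma pow_p_uminus: "(- x :: 'a) ^ (CHAR('a) ^ j) = - (x ^ (CHAR('a) ^ j))"
proof -
  have "(x + - x) ^ (CHAR('a) ^ j) = x ^ (CHAR('a) ^ j) + (- x) ^ (CHAR('a) ^ j)"
    by (rule pow_p_add)
  moreover have "CHAR('a) ^ j \<noteq> 0" using p_gt_1 by simp
  ultimately have "x ^ (CHAR('a) ^ j) + (- x) ^ (CHAR('a) ^ j) = 0" by (metis add.right_inverse power_0_left)
  then show ?thesis by (metis add_eq_0_iff)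
qed

lemma pow_q_uminus: "(- x :: 'a) ^ (q ^ j) = - (x ^ (q ^ j))"
  unfolding q_pow by (rule pow_p_uminus)

lemma pow_q_diff: "(x - y :: 'a) ^ (q ^ j) = x ^ (q ^ j) - y ^ (q ^ j)"
  using pow_q_add[of x "- y" j] by (simp add: pow_q_uminus)

lemma \<sigma>_0: "\<sigma> 0 = 0"
  using \<sigma>_add[of 0 0] by (metis add_cancel_left_left add.right_neutral)

lemma \<sigma>_i_add: "(\<sigma> ^^ i) (x + y) = (\<sigma> ^^ i) x + (\<sigma> ^^ i) y"
  and \<sigma>_i_mult: "(\<sigma> ^^ i) (x * y) = (\<sigma> ^^ i) x * (\<sigma> ^^ i) y"
  and \<sigma>_i_0 [simp]: "(\<sigma> ^^ i) 0 = 0" and \<sigma>_i_1 [simp]: "(\<sigma> ^^ i) 1 = 1"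
  by (induction i) (auto simp: \<sigma>_add \<sigma>_mult \<sigma>_0 \<sigma>_1)

lemma \<sigma>_i_pow: "(\<sigma> ^^ i) (x ^ n) = (\<sigma> ^^ i) x ^ n"
  by (induction n) (auto simp: \<sigma>_i_mult)

lemma \<sigma>_i_uminus: "(\<sigma> ^^ i) (- x) = - (\<sigma> ^^ i) x"
  using \<sigma>_i_add[of i x "- x"] by (simp add: eq_neg_iff_add_eq_0 add.commute)

lemma \<sigma>_i_eq_0: "(\<sigma> ^^ i) x = 0 \<longleftrightarrow> x = 0"
proof
  assume *: "(\<sigma> ^^ i) x = 0"
  show "x = 0"
  proof (rule ccontr)
    assume "x \<noteq> 0"
    then have "(\<sigma> ^^ i) x * (\<sigma> ^^ i) (inverse x) = 1"
      by (simp flip: \<sigma>_i_mult)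
    then show False using * by simp
  qed
qed simp

lemma \<sigma>_i_sum: "(\<sigma> ^^ i) (\<Sum>l\<in>A. f l) = (\<Sum>l\<in>A. (\<sigma> ^^ i) (f l))"
  by (induction A rule: infinite_finite_induct) (auto simp: \<sigma>_i_add)

lemma Fq_add: "x \<in> Fq \<Longrightarrow> y \<in> Fq \<Longrightarrow> x + y \<in> Fq"
  using pow_q_add[of x y 1] by (simp add: Fq_def)

lemma Fq_uminus: "x \<in> Fq \<Longrightarrow> - x \<in> Fq"
  using pow_q_uminus[of x 1] by (simp add: Fq_def)

lemma Fq_diff: "x \<in> Fq \<Longrightarrow> y \<in> Fq \<Longrightarrow> x - y \<in> Fq"
  using pow_q_diff[of x y 1] by (simp add: Fq_def)

lemma Fq_mult: "x \<in> Fq \<Longrightarrow> y \<in> Fq \<Longrightarrow> x * y \<in> Fq"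
  by (simp add: Fq_def power_mult_distrib)

lemma Fq_divide: "x \<in> Fq \<Longrightarrow> y \<in> Fq \<Longrightarrow> x / y \<in> Fq"
  by (simp add: Fq_def power_divide)

lemma Fq_0 [simp]: "0 \<in> Fq" and Fq_1 [simp]: "1 \<in> Fq"
  using q_gt_1 by (auto simp: Fq_def power_0_left)

lemma Fq_power: "x \<in> Fq \<Longrightarrow> x ^ n \<in> Fq"
  by (induction n) (auto intro: Fq_mult)

lemma Fq_\<sigma>: "x \<in> Fq \<Longrightarrow> (\<sigma> ^^ i) x \<in> Fq"
  by (simp add: Fq_def flip: \<sigma>_i_pow)

lemma Fq_pow_q: "c \<in> Fq \<Longrightarrow> c ^ (q ^ n) = c"
  by (induction n) (auto simp: Fq_def power_mult)

lemma Fq_sigma_M: "c \<in> Fq \<Longrightarrow> (\<sigma> ^^ (M * n)) c = c"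
  by (induction n) (auto simp: funpow_add Fq_def q_def \<sigma>_M)

lemma finite_Fq: "finite Fq"
  unfolding Fq_def by (rule finite_power_eq_self[OF q_gt_1])

lemma finite_lev: "finite (lev r)"
  unfolding lev_def using q_gt_1 p_gt_1 by (intro finite_power_eq_self one_less_power) auto

lemma k2_subset_Fq: "k2 \<subseteq> Fq"
proof
  fix x assume x: "x \<in> k2"
  have "x ^ (CHAR('a) ^ n) = x" for n
    using x by (induction n) (auto simp: k2_def power_mult)
  then show "x \<in> Fq" by (auto simp: Fq_def q_def)
qed

lemma k2_\<sigma>: "x \<in> k2 \<Longrightarrow> (\<sigma> ^^ i) x = x"
  by (induction i) (auto simp: k2_def)

lemma k2_pow: "x \<in> k2 \<Longrightarrow> x ^ (CHAR('a) ^ j) = x"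
  by (induction j) (auto simp: k2_def power_mult)

lemma k2_add: "x \<in> k2 \<Longrightarrow> y \<in> k2 \<Longrightarrow> x + y \<in> k2"
  and k2_mult: "x \<in> k2 \<Longrightarrow> y \<in> k2 \<Longrightarrow> x * y \<in> k2"
  and k2_uminus: "x \<in> k2 \<Longrightarrow> - x \<in> k2"
  and k2_0 [simp]: "0 \<in> k2" and k2_1 [simp]: "1 \<in> k2"
  using pow_p_add[of x y 1] pow_p_uminus[of x 1] \<sigma>_i_uminus[of 1] p_gt_1
  by (auto simp: k2_def \<sigma>_add \<sigma>_mult power_mult_distrib \<sigma>_0 \<sigma>_1 power_0_left)

lemma k2_sum: "(\<And>i. i \<in> A \<Longrightarrow> f i \<in> k2) \<Longrightarrow> sum f A \<in> k2"
  by (induction A rule: infinite_finite_induct) (auto intro: k2_add)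

lemma S_add: "x \<in> S \<Longrightarrow> y \<in> S \<Longrightarrow> x + y \<in> S"
  and S_mult: "x \<in> S \<Longrightarrow> y \<in> S \<Longrightarrow> x * y \<in> S"
  and S_uminus: "x \<in> S \<Longrightarrow> - x \<in> S"
  and S_0 [simp]: "0 \<in> S" and S_1 [simp]: "1 \<in> S"
  by (auto simp: S_def coeff_mult k2_add k2_uminus coeff_1 intro!: k2_sum k2_mult)

lemma S_power: "x \<in> S \<Longrightarrow> x ^ n \<in> S"
  by (induction n) (auto intro: S_mult)

lemma S_sum: "(\<And>i. i \<in> A \<Longrightarrow> f i \<in> S) \<Longrightarrow> sum f A \<in> S"
  by (induction A rule: infinite_finite_induct) (auto intro: S_add)

lemma S_monom: "monom 1 n \<in> S"
  by (auto simp: S_def)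

lemma S_coeff_Fq: "d \<in> S \<Longrightarrow> coeff d j \<in> Fq"
  using k2_subset_Fq by (auto simp: S_def)

section \<open>The action of polynomials in the q-Frobenius\<close>

lemma act_eq_sum: "degree d \<le> n \<Longrightarrow> act d v = (\<Sum>j\<le>n. coeff d j * v ^ (q ^ j))"
  unfolding act_def by (rule sum.mono_neutral_left) (auto simp: coeff_eq_0)

lemma act_0 [simp]: "act 0 v = 0"
  by (simp add: act_def)

lemma act_1 [simp]: "act 1 v = v"
  by (simp add: act_def)

lemma act_pCons [simp]: "act (pCons c d) v = c * v + act d (v ^ q)"
proof -
  have "act (pCons c d) v = (\<Sum>j\<le>Suc (degree d). coeff (pCons c d) j * v ^ (q ^ j))"
    by (rule act_eq_sum) (simp add: degree_pCons_le)
  also have "\<dots> = c * v + act d (v ^ q)"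
    by (subst sum.atMost_Suc_shift) (simp add: act_def flip: power_mult)
  finally show ?thesis .
qed

lemma act_add: "act (d + e) v = act d v + act e v"
proof -
  let ?n = "max (degree d) (degree e)"
  have "act (d + e) v = (\<Sum>j\<le>?n. coeff (d + e) j * v ^ (q ^ j))"
    by (rule act_eq_sum) (rule degree_add_le_max)
  also have "\<dots> = act d v + act e v"
    by (simp add: act_eq_sum[of d ?n] act_eq_sum[of e ?n] ring_distribs sum.distrib)
  finally show ?thesis .
qed

lemma act_uminus: "act (- d) v = - act d v"
  by (simp add: act_def sum_negf)

lemma act_diff: "act (d - e) v = act d v - act e v"
  using act_add[of d "- e" v] by (simp add: act_uminus)

lemma act_smult: "act (smult c d) v = c * act d v"
proof (induction d arbitrary: v)
  case (pCons a d)
  then show ?case by (simp add: ring_distribs)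
qed simp

lemma act_sum: "act (\<Sum>i\<in>A. f i) v = (\<Sum>i\<in>A. act (f i) v)"
  by (induction A rule: infinite_finite_induct) (auto simp: act_add)

lemma act_arg_add: "act d (v + w) = act d v + act d w"
  by (simp add: act_def pow_q_add ring_distribs sum.distrib)

lemma act_arg_diff: "act d (v - w) = act d v - act d w"
  by (simp add: act_def pow_q_diff ring_distribs sum_subtractf)

lemma act_arg_0 [simp]: "act d 0 = 0"
  using act_arg_diff[of d 0 0] by simp

lemma act_arg_sum: "act d (\<Sum>i\<in>A. f i) = (\<Sum>i\<in>A. act d (f i))"
  by (induction A rule: infinite_finite_induct) (auto simp: act_arg_add)

lemma act_arg_Fq: "c \<in> Fq \<Longrightarrow> act d (c * v) = c * act d v"
  by (simp add: act_def power_mult_distrib Fq_pow_q sum_distrib_left mult.left_commute)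

lemma act_pow_q: "(\<And>j. coeff d j \<in> Fq) \<Longrightarrow> act d (v ^ q) = (act d v) ^ q"
proof (induction d arbitrary: v)
  case 0
  then show ?case using q_gt_1 by (simp add: power_0_left)
next
  case (pCons a d)
  have a: "a \<in> Fq" using pCons.prems[of 0] by simp
  have "coeff d j \<in> Fq" for j using pCons.prems[of "Suc j"] by simp
  then have "act d ((v ^ q) ^ q) = (act d (v ^ q)) ^ q" by (rule pCons.IH)
  then show ?case
    using pow_q_add[of "a * v" "act d (v ^ q)" 1] a
    by (simp add: power_mult_distrib Fq_def)
qed

text \<open>In a twisted product the variable raises the coefficients it passes to the
  \<open>q\<close>-th power. Those of \<open>e\<close> are fixed by this, so composition is given by
  the ordinary, commutative product of polynomials.\<close>

lemma act_mult: "(\<And>j. coeff e j \<in> Fq) \<Longrightarrow> act (d * e) v = act d (act e v)"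
proof (induction d arbitrary: v)
  case (pCons a d)
  then show ?case by (simp add: act_add act_smult act_pow_q)
qed simp

lemma act_mult_S: "e \<in> S \<Longrightarrow> act (d * e) v = act d (act e v)"
  by (rule act_mult) (rule S_coeff_Fq)

lemma act_\<sigma>: "d \<in> S \<Longrightarrow> act d ((\<sigma> ^^ i) v) = (\<sigma> ^^ i) (act d v)"
  by (auto simp: act_def \<sigma>_i_sum \<sigma>_i_mult \<sigma>_i_pow S_def k2_\<sigma>)

lemma act_pow_p: "d \<in> S \<Longrightarrow> act d (v ^ (CHAR('a) ^ j)) = act d v ^ (CHAR('a) ^ j)"
  unfolding act_def freshmans_dream_sum'[OF prime_char refl]
  by (rule sum.cong[OF refl])
    (auto simp: power_mult_distrib S_def k2_pow simp flip: power_mult, simp add: mult.commute)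

text \<open>The exponents \<open>q ^ j\<close> are pairwise distinct, so no coefficient of
  \<open>d\<close> is lost in the additive polynomial that \<open>act d\<close> evaluates.\<close>

lemma finite_act_kernel:
  assumes "d \<noteq> 0"
  shows "finite {v. act d v = 0}"
proof -
  let ?f = "\<Sum>j\<le>degree d. monom (coeff d j) (q ^ j)"
  have "coeff ?f (q ^ degree d) = (\<Sum>j\<le>degree d. if j = degree d then coeff d j else 0)"
    unfolding coeff_sum coeff_monom
    by (rule sum.cong) (use q_gt_1 in auto)
  then have "coeff ?f (q ^ degree d) = lead_coeff d" by simp
  then have "?f \<noteq> 0" using assms by (metis coeff_0 leading_coeff_0_iff)
  then have "finite {x. poly ?f x = 0}" by (rule poly_roots_finite)
  then show ?thesis by (simp add: poly_sum poly_monom act_def)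
qed

definition Xm1 :: "'a poly" where "Xm1 = [:-1, 1:]"

lemma Xm1_S: "Xm1 \<in> S"
  by (auto simp: S_def Xm1_def coeff_pCons k2_uminus split: nat.split)

lemma act_Xm1: "act Xm1 v = t v"
  by (simp add: Xm1_def t_def)

lemma t_funpow: "(t ^^ n) v = act (Xm1 ^ n) v"
proof (induction n arbitrary: v)
  case (Suc n)
  have "act (Xm1 ^ Suc n) v = act Xm1 (act (Xm1 ^ n) v)"
    unfolding power_Suc by (rule act_mult_S) (intro S_power Xm1_S)
  then show ?case by (simp add: Suc act_Xm1)
qed simp

lemma Xm1_pow: "Xm1 ^ (CHAR('a) ^ r) = monom 1 (CHAR('a) ^ r) - 1"
proof -
  have p: "prime CHAR('a poly)" using prime_char by simp
  have "Xm1 = monom 1 1 + (- 1)"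
    by (rule poly_eqI) (auto simp: Xm1_def coeff_pCons split: nat.split)
  then have "Xm1 ^ (CHAR('a) ^ r) = monom 1 1 ^ (CHAR('a) ^ r) + (- 1) ^ (CHAR('a) ^ r)"
    using freshmans_dream'[OF p, of _ r "monom 1 1" "- 1"] by simp
  moreover have "(1 + (- 1)) ^ (CHAR('a) ^ r) = 1 ^ (CHAR('a) ^ r) + (- 1 :: 'a poly) ^ (CHAR('a) ^ r)"
    by (rule freshmans_dream'[OF p]) simp
  then have "(- 1 :: 'a poly) ^ (CHAR('a) ^ r) = - 1"
    using p_gt_1 by (simp add: power_0_left eq_neg_iff_add_eq_0 add.commute)
  ultimately show ?thesis by (simp add: monom_power)
qed

lemma act_monom: "act (monom c n) v = c * v ^ (q ^ n)"
proof (cases "c = 0")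
  case False
  have "act (monom c n) v = (\<Sum>j\<le>n. if j = n then c * v ^ (q ^ j) else 0)"
    unfolding act_def degree_monom_eq[OF False] by (rule sum.cong) auto
  then show ?thesis by simp
qed simp

lemma t_pow: "(t ^^ (CHAR('a) ^ r)) v = v ^ (q ^ (CHAR('a) ^ r)) - v"
  by (simp add: t_funpow Xm1_pow act_diff act_monom)

section \<open>The filtration of V by the kernels of the powers of t\<close>

lemma lev_iff: "v \<in> lev r \<longleftrightarrow> (t ^^ (CHAR('a) ^ r)) v = 0"
  by (auto simp: lev_def t_pow)

lemma t_i_0 [simp]: "(t ^^ i) 0 = 0"
  by (simp add: t_funpow)

lemma t_mono: "(t ^^ n) v = 0 \<Longrightarrow> n \<le> n' \<Longrightarrow> (t ^^ n') v = 0"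
proof -
  assume "(t ^^ n) v = 0" "n \<le> n'"
  then have "(t ^^ (n' - n + n)) v = 0" unfolding funpow_add by simp
  then show ?thesis using \<open>n \<le> n'\<close> by simp
qed

lemma V_lev: "v \<in> V \<longleftrightarrow> (\<exists>r. v \<in> lev r)"
proof
  assume "v \<in> V"
  then obtain n where "(t ^^ n) v = 0" by (auto simp: V_def)
  moreover have "n \<le> CHAR('a) ^ n" using p_gt_1 by (simp add: less_imp_le_nat)
  ultimately have "v \<in> lev n" by (auto simp: lev_iff intro: t_mono)
  then show "\<exists>r. v \<in> lev r" ..
qed (auto simp: V_def lev_iff)

lemma lev_add: "x \<in> lev r \<Longrightarrow> y \<in> lev r \<Longrightarrow> x + y \<in> lev r"
  and lev_mult: "x \<in> lev r \<Longrightarrow> y \<in> lev r \<Longrightarrow> x * y \<in> lev r"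
  by (auto simp: lev_def pow_q_add power_mult_distrib)

lemma lev_mono: "r \<le> r' \<Longrightarrow> lev r \<subseteq> lev r'"
  using p_gt_1 by (auto simp: lev_iff intro!: t_mono[of "CHAR('a) ^ r" _ "CHAR('a) ^ r'"] power_increasing)

lemma V_common: "v \<in> V \<Longrightarrow> w \<in> V \<Longrightarrow> \<exists>r. v \<in> lev r \<and> w \<in> lev r"
  using lev_mono by (metis V_lev max.cobounded1 max.cobounded2 subsetD)

lemma V_add: "x \<in> V \<Longrightarrow> y \<in> V \<Longrightarrow> x + y \<in> V"
  and V_mult: "x \<in> V \<Longrightarrow> y \<in> V \<Longrightarrow> x * y \<in> V"
  using V_common[of x y] lev_add lev_mult V_lev by blast+

lemma Fq_subset_V: "Fq \<subseteq> V"
  by (auto simp: V_lev lev_def Fq_pow_q)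

lemma V_0 [simp]: "0 \<in> V"
  using Fq_subset_V by auto

lemma V_sum: "(\<And>i. i \<in> A \<Longrightarrow> f i \<in> V) \<Longrightarrow> sum f A \<in> V"
  by (induction A rule: infinite_finite_induct) (auto intro: V_add)

lemma V_power: "x \<in> V \<Longrightarrow> x ^ n \<in> V"
  using Fq_subset_V by (induction n) (auto intro: V_mult)

lemma V_\<sigma>: "x \<in> V \<Longrightarrow> (\<sigma> ^^ i) x \<in> V"
  unfolding V_lev lev_def mem_Collect_eq \<sigma>_i_pow[symmetric] by metis

lemma V_act: "d \<in> S \<Longrightarrow> v \<in> V \<Longrightarrow> act d v \<in> V"
  using Fq_subset_V S_coeff_Fq unfolding act_def by (intro V_sum V_mult V_power) auto

lemma t_surj: "\<exists>x. t x = y"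
proof -
  let ?f = "monom 1 q - monom 1 1 - [:y:]"
  have y: "coeff [:y:] q = 0" using q_gt_1 by (intro coeff_eq_0) simp
  have "coeff ?f q = 1" unfolding coeff_diff coeff_monom y using q_gt_1 by simp
  then have "q \<le> degree ?f" by (metis le_degree zero_neq_one)
  then have "degree ?f > 0" using q_gt_1 by simp
  then obtain x where "poly ?f x = 0" using alg_closed_imp_poly_has_root by blast
  then show ?thesis by (auto simp: t_def poly_monom)
qed

lemma V_tD: "t x \<in> V \<Longrightarrow> x \<in> V"
proof -
  assume "t x \<in> V"
  then obtain n where "(t ^^ n) (t x) = 0" by (auto simp: V_def)
  then have "(t ^^ Suc n) x = 0" by (simp add: funpow_swap1)
  then show ?thesis unfolding V_def by blast
qed

text \<open>Divisibility of \<open>V\<close>: the equation \<open>z ^ q - z = y\<close> is solvable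
  in an algebraically closed field, and a \<open>t\<close>-preimage of a point of \<open>V\<close>
  is again in \<open>V\<close>.\<close>

lemma V_t_surj: "y \<in> V \<Longrightarrow> \<exists>x\<in>V. (t ^^ n) x = y"
proof (induction n arbitrary: y)
  case (Suc n)
  obtain z where z: "t z = y" using t_surj by blast
  then have "z \<in> V" using Suc.prems V_tD by blast
  then show ?case using Suc.IH z by auto
qed auto

text \<open>Each step of the filtration contributes one of the points \<open>u n\<close>, which
  already makes the cardinality unbounded in \<open>r\<close>.\<close>

lemma card_lev: "CHAR('a) ^ r \<le> card (lev r)"
proof -
  have "surj t" unfolding surj_def using t_surj by metis
  moreover have "t 0 = 0" using t_i_0[of 1] by simp
  moreover have "t 1 = 0" by (simp add: t_def)
  ultimately obtain u where u: "inj u" "\<And>n k. n < k \<Longrightarrow> (t ^^ k) (u n) = 0"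
    using iterated_preimages[of t 1] zero_neq_one by metis
  have "u ` {..<CHAR('a) ^ r} \<subseteq> lev r" using u(2) by (auto simp: lev_iff)
  then have "card {..<CHAR('a) ^ r} \<le> card (lev r)"
    using u(1) by (intro card_inj_on_le[of u]) (auto intro: finite_lev inj_on_subset)
  then show ?thesis by simp
qed

lemma infinite_V: "infinite V"
proof
  assume fin: "finite V"
  have "lev r \<subseteq> V" for r using V_lev by auto
  then have "CHAR('a) ^ r \<le> card V" for r
    using card_lev[of r] card_mono[OF fin] by (meson order.trans)
  moreover have "card V < CHAR('a) ^ card V" using p_gt_1 by (intro power_gt_expt) simp
  ultimately show False using leD by blast
qed

text \<open>The kernel of \<open>t ^^ n\<close> lies in the finite field \<open>lev n\<close>, so an
  infinite subset of \<open>V\<close> cannot stay inside it.\<close>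

lemma infinite_subset_order:
  assumes "infinite T" "T \<subseteq> V"
  shows "\<exists>w\<in>T. (t ^^ n) w \<noteq> 0"
proof (rule ccontr)
  assume "\<not> ?thesis"
  moreover have "n \<le> CHAR('a) ^ n" using p_gt_1 by (simp add: less_imp_le_nat)
  ultimately have "T \<subseteq> lev n" unfolding lev_iff subset_iff using t_mono by blast
  then show False using assms finite_lev finite_subset by blast
qed

text \<open>
  The quotients of the filtration of \<open>V\<close> by the kernels of the powers of \<open>t\<close>
  are one-dimensional over \<open>Fq\<close>.
\<close>
lemma uniserial:
  assumes add: "\<And>v w. v \<in> V \<Longrightarrow> w \<in> V \<Longrightarrow> y (v + w) = y v + y w"
    and lin: "\<And>c v. c \<in> Fq \<Longrightarrow> v \<in> V \<Longrightarrow> y (c * v) = c * y v"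
    and comm: "\<And>v. v \<in> V \<Longrightarrow> y (t v) = t (y v)"
    and w: "w \<in> V" "y w = 0" "(t ^^ n) w \<noteq> 0"
    and v: "(t ^^ Suc n) v = 0"
  shows "y v = 0"
proof -
  have t_V: "(t ^^ i) x \<in> V" if "x \<in> V" for i x
    using that by (simp add: t_funpow V_act S_power Xm1_S)
  have y_0: "y 0 = 0" using lin[of 0 0] by simp
  have yt: "y ((t ^^ i) w) = 0" for i
  proof (induction i)
    case (Suc i)
    have "t 0 = 0" using t_i_0[of 1] by simp
    then show ?case using comm[OF t_V[OF w(1)], of i] Suc by simp
  qed (use w in simp)
  \<comment> \<open>Exactly \<open>N + 1\<close> applications of \<open>t\<close> are needed to kill
    \<open>w\<close>, and \<open>N \<ge> n\<close>, so \<open>w\<close> has at least the order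
    allowed for \<open>v\<close>.\<close>
  define N where "N = (LEAST N. (t ^^ Suc N) w = 0)"
  obtain N0 where N0: "(t ^^ N0) w = 0" using w(1) by (auto simp: V_def)
  have N: "(t ^^ Suc N) w = 0"
    unfolding N_def by (rule LeastI[of _ N0]) (rule t_mono[OF N0], simp)
  have Nn: "n \<le> N"
    using t_mono[OF N, of n] w(3) not_less_eq_eq by blast
  have Nnz: "(t ^^ N) w \<noteq> 0"
  proof (cases N)
    case 0
    then show ?thesis using w Nn by auto
  next
    case (Suc N')
    then have "N' < (LEAST N. (t ^^ Suc N) w = 0)" by (simp add: N_def)
    from not_less_Least[OF this] show ?thesis using Suc by simp
  qed
  have t_lin: "(t ^^ i) (c * x) = c * (t ^^ i) x" if "c \<in> Fq" for c x i
    using that by (simp add: t_funpow act_arg_Fq)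
  have t_diff: "(t ^^ i) (x - z) = (t ^^ i) x - (t ^^ i) z" for x z i
    by (simp add: t_funpow act_arg_diff)
  have "j \<le> Suc n \<Longrightarrow> (t ^^ j) v = 0 \<Longrightarrow> y v = 0" for j v
  proof (induction j arbitrary: v)
    case 0
    then show ?case by (simp add: y_0)
  next
    case (Suc j)
    \<comment> \<open>\<open>u\<close> has order exactly \<open>j + 1\<close>:
      \<open>(t ^^ j) u\<close> is the nonzero value \<open>(t ^^ N) w\<close>. This value and
      \<open>(t ^^ j) v\<close> are both killed by \<open>t\<close>, hence lie in \<open>Fq\<close>;
      subtracting their quotient times \<open>u\<close> lowers the order of \<open>v\<close>, and
      \<open>y\<close> kills \<open>u\<close>.\<close>
    define u where "u = (t ^^ (N - j)) w"
    have u_V: "u \<in> V" unfolding u_def by (rule t_V[OF w(1)])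
    have yu: "y u = 0" by (simp add: u_def yt)
    have tu: "(t ^^ j) u = (t ^^ N) w"
      using Suc.prems Nn unfolding u_def
      by (subst comp_apply[of "t ^^ j", symmetric], subst funpow_add[symmetric]) simp
    have k1I: "x \<in> Fq" if "t x = 0" for x using that by (simp add: Fq_def t_def)
    have "(t ^^ j) v \<in> Fq" "(t ^^ N) w \<in> Fq"
      using N Suc.prems by (auto intro!: k1I)
    then have c: "(t ^^ j) v / (t ^^ N) w \<in> Fq" (is "?c \<in> _") by (rule Fq_divide)
    have "(t ^^ j) (v - ?c * u) = 0"
      unfolding t_diff t_lin[OF c] tu using Nnz by simp
    then have "y (v - ?c * u) = 0" using Suc by auto
    moreover have "v - ?c * u \<in> V"
      using \<open>(t ^^ j) (v - ?c * u) = 0\<close> unfolding V_def by blast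
    moreover have "?c * u \<in> V" using V_mult[OF _ u_V] c Fq_subset_V by blast
    ultimately show ?case
      using add[of "v - ?c * u" "?c * u"] lin[OF c u_V] yu by simp
  qed
  from this[OF order.refl v] show ?thesis .
qed

end

section \<open>Algebraic relations between operators\<close>

text \<open>Gaussian elimination without division: with more vectors \<open>r i\<close> than
  coordinates, the coefficients of a dependence can be kept in the subring, because rows are
  multiplied by the pivot instead of being divided by it.\<close>

lemma linear_dependence_subring:
  fixes r :: "'i \<Rightarrow> 'b \<Rightarrow> 'r::idom"
  assumes S: "1 \<in> S" "\<And>x y. x \<in> S \<Longrightarrow> y \<in> S \<Longrightarrow> x - y \<in> S"
      "\<And>x y. x \<in> S \<Longrightarrow> y \<in> S \<Longrightarrow> x * y \<in> S"
    and "finite B" "finite I" "card B < card I" "\<And>i b. i \<in> I \<Longrightarrow> b \<in> B \<Longrightarrow> r i b \<in> S"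
  shows "\<exists>c. (\<forall>i\<in>I. c i \<in> S) \<and> (\<exists>i\<in>I. c i \<noteq> 0) \<and> (\<forall>b\<in>B. (\<Sum>i\<in>I. c i * r i b) = 0)"
  using assms(4-)
proof (induction B arbitrary: I r rule: finite_induct)
  case empty
  then have "I \<noteq> {}" by auto
  then show ?case using S by (intro exI[of _ "\<lambda>_. 1"]) auto
next
  case (insert b B)
  have S_0: "0 \<in> S" using S(2)[of 1 1] S(1) by simp
  have S_uminus: "- x \<in> S" if "x \<in> S" for x using S(2)[OF S_0 that] by simp
  have S_add: "x + y \<in> S" if "x \<in> S" "y \<in> S" for x y
    using S(2)[OF that(1) S_uminus[OF that(2)]] by simp
  have S_sum: "sum f A \<in> S" if "\<And>i. i \<in> A \<Longrightarrow> f i \<in> S" for f :: "'i \<Rightarrow> 'r" and A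
    using that by (induction A rule: infinite_finite_induct) (simp_all add: S_0 S_add)
  show ?case
  proof (cases "\<forall>i\<in>I. r i b = 0")
    case True
    have "\<exists>c. (\<forall>i\<in>I. c i \<in> S) \<and> (\<exists>i\<in>I. c i \<noteq> 0) \<and> (\<forall>b\<in>B. (\<Sum>i\<in>I. c i * r i b) = 0)"
      by (rule insert.IH) (use insert.hyps insert.prems in auto)
    then obtain c where "\<forall>i\<in>I. c i \<in> S" "\<exists>i\<in>I. c i \<noteq> 0" "\<forall>b\<in>B. (\<Sum>i\<in>I. c i * r i b) = 0"
      by blast
    then show ?thesis using True by (intro exI[of _ c]) simp
  next
    case False
    then obtain i0 where i0: "i0 \<in> I" "r i0 b \<noteq> 0" by blast
    define r' where "r' i b' = r i0 b * r i b' - r i b * r i0 b'" for i b'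
    have "\<exists>c. (\<forall>i\<in>I - {i0}. c i \<in> S) \<and> (\<exists>i\<in>I - {i0}. c i \<noteq> 0) \<and>
        (\<forall>b\<in>B. (\<Sum>i\<in>I - {i0}. c i * r' i b) = 0)"
      by (rule insert.IH) (use insert.hyps insert.prems i0 S in \<open>auto simp: r'_def\<close>)
    then obtain c i1 where c: "\<And>i. i \<in> I - {i0} \<Longrightarrow> c i \<in> S" "i1 \<in> I - {i0}" "c i1 \<noteq> 0"
      "\<And>b. b \<in> B \<Longrightarrow> (\<Sum>i\<in>I - {i0}. c i * r' i b) = 0"
      by blast
    \<comment> \<open>The coefficients found for the reduced rows are scaled by the pivot. The one
      of the pivot row is chosen so that the two combinations agree in every coordinate; the
      \<open>b\<close>-coordinate of each \<open>r' i\<close> is zero.\<close>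
    define c' where "c' i = (if i = i0 then - (\<Sum>i\<in>I - {i0}. c i * r i b) else r i0 b * c i)" for i
    have eq: "(\<Sum>i\<in>I. c' i * r i b') = (\<Sum>i\<in>I - {i0}. c i * r' i b')" for b'
    proof -
      have "(\<Sum>i\<in>I. c' i * r i b') = c' i0 * r i0 b' + (\<Sum>i\<in>I - {i0}. c' i * r i b')"
        using insert.prems i0 by (simp add: sum.remove)
      also have "(\<Sum>i\<in>I - {i0}. c' i * r i b') = (\<Sum>i\<in>I - {i0}. r i0 b * c i * r i b')"
        by (rule sum.cong) (auto simp: c'_def)
      finally show ?thesis
        by (simp add: c'_def r'_def algebra_simps sum_subtractf sum_distrib_left sum_distrib_right)
    qed
    have "(\<Sum>i\<in>I. c' i * r i b') = 0" if "b' \<in> insert b B" for b'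
      using that c(4) unfolding eq by (auto simp: r'_def mult.commute)
    moreover have "c' i \<in> S" if "i \<in> I" for i
    proof (cases "i = i0")
      case True
      have "c i * r i b \<in> S" if "i \<in> I - {i0}" for i
        using S(3)[OF c(1)] insert.prems(3) that by simp
      then show ?thesis using True by (auto simp: c'_def intro!: S_uminus S_sum)
    next
      case False
      then show ?thesis using that c(1) insert.prems(3) i0 S(3) by (simp add: c'_def)
    qed
    moreover have "c' i1 \<noteq> 0" "i1 \<in> I" using c i0 by (auto simp: c'_def)
    ultimately show ?thesis by blast
  qed
qed

lemma pigeonhole_difference:
  assumes "finite Z" "finite Y" "card Y < card Z" "f ` Z \<subseteq> Y"
  obtains x x' where "x \<in> Z" "x' \<in> Z" "x \<noteq> x'" "f x = f x'"
proof -
  have "\<not> inj_on f Z"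
    using assms card_inj_on_le[of f Z Y] by auto
  then show ?thesis using that by (auto simp: inj_on_def)
qed

text \<open>\<open>Q\<close> and \<open>\<kappa>\<close> will be the sizes of \<open>Fq\<close> and
  \<open>k2\<close>, and \<open>d\<close> a bound for the exponents of the given operator. Passing
  from degree \<open>L * s\<close> to \<open>L * s + d\<close> adds
  \<open>d * (2 * L * s + 2 + d)\<close> coefficients to be matched, linear in \<open>L\<close>,
  whereas the central operators supply \<open>L * L * s\<close> free ones, quadratic in
  \<open>L\<close>. The value \<open>L = Q * d * (4 + d) + 1\<close> suffices even after
  \<open>Q\<close> is estimated by \<open>2 ^ Q\<close> and \<open>\<kappa>\<close> by
  \<open>2\<close>.\<close>

lemma pigeonhole_exponents:
  assumes "s > 0" "Q > (1::nat)" "\<kappa> \<ge> (2::nat)"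
  shows "\<exists>L. Q ^ ((L * s + d + 1)^2) < Q ^ ((L * s + 1)^2) * \<kappa> ^ (L * L * s)"
proof -
  define L where "L = Q * d * (4 + d) + 1"
  define D where "D = L * s"
  have D: "D \<ge> 1" using assms by (simp add: D_def L_def)
  have "2 * D + 2 + d \<le> (4 + d) * D"
  proof -
    have "d \<le> d * D" using D by simp
    moreover have "(4 + d) * D = 4 * D + d * D" by (simp add: distrib_right)
    ultimately show ?thesis using D by linarith
  qed
  then have "Q * (d * (2 * D + 2 + d)) \<le> Q * (d * ((4 + d) * D))" by (intro mult_left_mono) auto
  also have "\<dots> = (Q * d * (4 + d)) * D" by simp
  also have "\<dots> \<le> L * D" by (simp add: L_def)
  finally have *: "Q * (d * (2 * D + 2 + d)) \<le> L * L * s" by (simp add: D_def mult.assoc)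
  have Q: "Q ^ n \<le> 2 ^ (Q * n)" for n
  proof -
    have "Q ^ n \<le> (2 ^ Q) ^ n" by (intro power_mono) (auto simp: less_imp_le_nat)
    then show ?thesis by (simp add: power_mult)
  qed
  show ?thesis
  proof (intro exI[of _ L])
    have "Q ^ ((L * s + d + 1)^2) = Q ^ ((L * s + 1)^2) * Q ^ (d * (2 * D + 2 + d))"
    proof -
      have "(L * s + d + 1)^2 = (L * s + 1)^2 + d * (2 * D + 2 + d)"
        unfolding D_def power2_eq_square by (simp only: ring_distribs mult_1_left mult_1_right mult_2 mult_2_right ac_simps)
      then show ?thesis by (simp only: power_add)
    qed
    moreover have "Q ^ (d * (2 * D + 2 + d)) < \<kappa> ^ (L * L * s)"
    proof (cases "d = 0")
      case True
      have "L * L * s > 0" using assms by (simp add: L_def)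
      then have "1 < \<kappa> ^ (L * L * s)" using assms by (intro one_less_power) auto
      then show ?thesis using True by simp
    next
      case False
      have "Q ^ (d * (2 * D + 2 + d)) < (2 ^ Q) ^ (d * (2 * D + 2 + d))"
        using False by (intro power_strict_mono) auto
      also have "\<dots> = 2 ^ (Q * (d * (2 * D + 2 + d)))" by (simp add: power_mult)
      also have "\<dots> \<le> 2 ^ (L * L * s)" using * by (intro power_increasing) auto
      also have "\<dots> \<le> \<kappa> ^ (L * L * s)" using assms by (intro power_mono) auto
      finally show ?thesis .
    qed
    ultimately show "Q ^ ((L * s + d + 1)^2) < Q ^ ((L * s + 1)^2) * \<kappa> ^ (L * L * s)"
      using assms by simp
  qed
qed

section \<open>The ring of operators with coefficients in Fq\<close>

context difference_frobenius
begin

lemma opr_Cons [simp]: "opr ((c, i, j) # xs) v = c * (\<sigma> ^^ i) (v ^ (CHAR('a) ^ j)) + opr xs v"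
  by (simp add: opr_def)

lemma opr_Nil [simp]: "opr [] v = 0"
  by (simp add: opr_def)

lemma opr_append [simp]: "opr (xs @ ys) v = opr xs v + opr ys v"
  by (simp add: opr_def)

lemma opr_add: "opr xs (v + w) = opr xs v + opr xs w"
  by (induction xs) (auto simp: pow_p_add \<sigma>_i_add ring_distribs)

lemma R_mono: "c \<in> Fq \<Longrightarrow> (\<lambda>v. c * (\<sigma> ^^ i) (v ^ (CHAR('a) ^ j))) \<in> R"
  unfolding R_def by (rule CollectI, rule exI[of _ "[(c, i, j)]"]) auto

lemma R_0: "(\<lambda>v. 0) \<in> R"
  unfolding R_def by (rule CollectI, rule exI[of _ "[]"]) auto

lemma R_add: "f \<in> R \<Longrightarrow> g \<in> R \<Longrightarrow> (\<lambda>v. f v + g v) \<in> R"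
proof -
  assume "f \<in> R" "g \<in> R"
  then obtain xs ys where "f = opr xs" "g = opr ys"
    "\<forall>(c, i, j)\<in>set xs. c \<in> Fq" "\<forall>(c, i, j)\<in>set ys. c \<in> Fq"
    by (auto simp: R_def)
  then show ?thesis unfolding R_def by (intro CollectI exI[of _ "xs @ ys"]) auto
qed

lemma R_induct [consumes 1, case_names zero add]:
  assumes "f \<in> R" and "P (\<lambda>v. 0)"
    and "\<And>c i j f. c \<in> Fq \<Longrightarrow> f \<in> R \<Longrightarrow> P f \<Longrightarrow> P (\<lambda>v. c * (\<sigma> ^^ i) (v ^ (CHAR('a) ^ j)) + f v)"
  shows "P f"
proof -
  obtain xs where xs: "f = opr xs" "\<forall>(c, i, j)\<in>set xs. c \<in> Fq"
    using assms by (auto simp: R_def)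
  have "opr xs \<in> R \<and> P (opr xs)" using xs(2)
  proof (induction xs)
    case Nil
    have "opr [] = (\<lambda>v. 0)" by auto
    then show ?case using assms(2) R_0 by simp
  next
    case (Cons x xs)
    obtain c i j where x: "x = (c, i, j)" by (cases x)
    have "opr (x # xs) = (\<lambda>v. c * (\<sigma> ^^ i) (v ^ (CHAR('a) ^ j)) + opr xs v)" by (auto simp: x)
    then show ?case using Cons x assms(3)[of c "opr xs" i j] R_add[OF R_mono, of c "opr xs" i j] by auto
  qed
  then show ?thesis by (simp add: xs(1))
qed

lemma R_sum: "(\<And>i. i \<in> A \<Longrightarrow> f i \<in> R) \<Longrightarrow> (\<lambda>v. \<Sum>i\<in>A. f i v) \<in> R"
  by (induction A rule: infinite_finite_induct) (auto intro: R_0 R_add)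

lemma R_arg_add: "f \<in> R \<Longrightarrow> f (v + w) = f v + f w"
  by (auto simp: R_def opr_add)

lemma R_arg_0: "f \<in> R \<Longrightarrow> f 0 = 0"
  using R_arg_add[of f 0 0] by (metis add_cancel_left_left add.right_neutral)

lemma R_arg_sum: "f \<in> R \<Longrightarrow> f (\<Sum>i\<in>A. g i) = (\<Sum>i\<in>A. f (g i))"
  by (induction A rule: infinite_finite_induct) (auto simp: R_arg_add R_arg_0)

lemma R_act: "f \<in> R \<Longrightarrow> d \<in> S \<Longrightarrow> f (act d v) = act d (f v)"
proof (induction rule: R_induct)
  case (add c i j f)
  then show ?case
    by (simp add: act_arg_add act_arg_Fq act_\<sigma> act_pow_p)
qed simp

lemma R_V: "f \<in> R \<Longrightarrow> v \<in> V \<Longrightarrow> f v \<in> V"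
proof (induction rule: R_induct)
  case (add c i j f)
  then show ?case using Fq_subset_V by (intro V_add V_mult V_\<sigma> V_power) auto
qed simp

lemma R_smult: "f \<in> R \<Longrightarrow> c \<in> Fq \<Longrightarrow> (\<lambda>v. c * f v) \<in> R"
proof (induction rule: R_induct)
  case (add c' i j f)
  then show ?case
    using R_add[OF R_mono[OF Fq_mult[of c c']]] by (auto simp: ring_distribs mult.assoc)
qed (simp add: R_0)

text \<open>Moving the monomial past a coefficient \<open>c'\<close> applies
  \<open>\<sigma> ^^ i\<close> and the \<open>p ^ j\<close>-th power to it. \<open>Fq\<close> is
  stable under both, which is what makes \<open>R\<close> closed under composition.\<close>

lemma R_mono_comp: "f \<in> R \<Longrightarrow> c \<in> Fq \<Longrightarrow> (\<lambda>v. c * (\<sigma> ^^ i) (f v ^ (CHAR('a) ^ j))) \<in> R"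
proof (induction rule: R_induct)
  case zero
  have "CHAR('a) ^ j \<noteq> 0" using p_gt_1 by simp
  then have "(\<lambda>v::'a. c * (\<sigma> ^^ i) (0 ^ (CHAR('a) ^ j))) = (\<lambda>v. 0)"
    by (metis \<sigma>_i_0 mult_zero_right power_0_left)
  then show ?case using R_0 by simp
next
  case (add c' i' j' f)
  have "(\<lambda>v. (c * (\<sigma> ^^ i) (c' ^ (CHAR('a) ^ j))) * (\<sigma> ^^ (i + i')) (v ^ (CHAR('a) ^ (j' + j)))
      + c * (\<sigma> ^^ i) (f v ^ (CHAR('a) ^ j))) \<in> R"
    using add by (intro R_add R_mono Fq_mult Fq_\<sigma> Fq_power) auto
  also have "(\<lambda>v. (c * (\<sigma> ^^ i) (c' ^ (CHAR('a) ^ j))) * (\<sigma> ^^ (i + i')) (v ^ (CHAR('a) ^ (j' + j)))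
      + c * (\<sigma> ^^ i) (f v ^ (CHAR('a) ^ j))) =
    (\<lambda>v. c * (\<sigma> ^^ i) ((c' * (\<sigma> ^^ i') (v ^ (CHAR('a) ^ j')) + f v) ^ (CHAR('a) ^ j)))"
    by (simp add: pow_p_add power_mult_distrib \<sigma>_i_add \<sigma>_i_mult \<sigma>_i_pow funpow_add power_add
        power_mult ring_distribs mult.assoc)
  finally show ?case .
qed

lemma R_comp: "f \<in> R \<Longrightarrow> g \<in> R \<Longrightarrow> (\<lambda>v. f (g v)) \<in> R"
proof (induction rule: R_induct)
  case (add c i j f)
  then show ?case by (intro R_add R_mono_comp)
qed (simp add: R_0)

lemma R_id: "(\<lambda>v. v) \<in> R"
  using R_mono[of 1 0 0] by simp

lemma R_funpow: "f \<in> R \<Longrightarrow> f ^^ i \<in> R"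
proof (induction i)
  case 0
  then show ?case using R_id by (simp add: id_def)
next
  case (Suc i)
  then show ?case using R_comp[of f "f ^^ i"] by (simp add: comp_def)
qed

lemma R_act_in: "d \<in> S \<Longrightarrow> act d \<in> R"
proof -
  assume "d \<in> S"
  then have "(\<lambda>v. \<Sum>j\<le>degree d. coeff d j * (\<sigma> ^^ 0) (v ^ (CHAR('a) ^ (m * j)))) \<in> R"
    by (intro R_sum R_mono S_coeff_Fq)
  then show ?thesis by (simp add: act_def[abs_def] q_pow)
qed

text \<open>
  The twisted product of two nonzero formal operators is nonzero, so \<open>\<Theta> \<mapsto> \<Theta> \<psi>\<close> is injective, and
  counting the pairs \<open>(\<Theta>, b)\<close> produces a formal identity \<open>\<Theta> \<psi> + b = 0\<close> with central \<open>b \<noteq> 0\<close>.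
\<close>
lemma central_left_multiple:
  fixes \<psi> :: "nat \<times> nat \<Rightarrow> 'a"
  assumes K: "finite K" "K \<noteq> {}" "\<And>u. u \<in> K \<Longrightarrow> \<psi> u \<in> Fq \<and> \<psi> u \<noteq> 0"
    and T: "\<And>v. v \<in> T \<Longrightarrow> (\<Sum>(i, j)\<in>K. \<psi> (i, j) * (\<sigma> ^^ i) (v ^ (CHAR('a) ^ j))) = 0"
  shows "\<exists>L1 L2 b. (\<forall>i j. b (i, j) \<in> k2) \<and> (\<exists>i\<le>L1. \<exists>j\<le>L2. b (i, j) \<noteq> 0) \<and>
    (\<forall>v\<in>T. (\<Sum>i\<le>L1. \<Sum>j\<le>L2. b (i, j) * (\<sigma> ^^ (M * i)) (v ^ (q ^ j))) = 0)"
proof -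
  define d where "d = Max (fst ` K \<union> snd ` K)"
  have K_d: "K \<subseteq> {..d} \<times> {..d}"
    using K(1) by (force simp: d_def intro!: Max_ge)
  have k2_card: "card k2 \<ge> 2"
  proof -
    have "card {0, 1 :: 'a} \<le> card k2"
      using finite_subset[OF k2_subset_Fq finite_Fq] by (intro card_mono) auto
    then show ?thesis by simp
  qed
  have Fq_card: "card Fq > 1"
    using k2_card card_mono[OF finite_Fq k2_subset_Fq] by simp
  obtain L where L: "card Fq ^ ((L * (M * m) + d + 1)^2) <
      card Fq ^ ((L * (M * m) + 1)^2) * card k2 ^ (L * L * (M * m))"
    using pigeonhole_exponents[of "M * m" "card Fq" "card k2" d] Fq_card k2_card M_pos m_pos by auto
  \<comment> \<open>Both \<open>M * (L * m)\<close> and \<open>m * (L * M)\<close> equal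
    \<open>D\<close>, so the central monomials indexed by \<open>Q\<close>, in
    \<open>\<sigma> ^^ M\<close> and the \<open>q\<close>-Frobenius, have exponents at most
    \<open>D\<close> and fit into the table \<open>W\<close>.\<close>
  define D where "D = L * (M * m)"
  define A where "A = {..D} \<times> {..D}"
  define Q where "Q = {..L * m} \<times> {..L * M}"
  define W where "W = {..D + d} \<times> {..D + d}"
  define prd where "prd = (\<lambda>a b. (fst a + fst b, snd a + snd b) :: nat \<times> nat)"
  define cen where "cen = (\<lambda>e. (M * fst e, m * snd e) :: nat \<times> nat)"
  define Z where "Z w v = (\<sigma> ^^ fst w) (v ^ (CHAR('a) ^ snd w))" for w :: "nat \<times> nat" and v :: 'a
  \<comment> \<open>\<open>C1 \<theta>\<close> is the coefficient table of the twisted product of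
    the operator \<open>\<theta>\<close> with \<open>\<psi>\<close>, and \<open>C2 \<beta>\<close>
    that of the central operator with coefficients \<open>\<beta>\<close>. Both are additive, so two
    pairs with equal tables yield, by subtraction, a pair with table zero.\<close>
  define C1 where "C1 \<theta> w = (\<Sum>a\<in>A. \<Sum>b\<in>K. if prd a b = w
      then \<theta> a * (\<sigma> ^^ fst a) (\<psi> b ^ (CHAR('a) ^ snd a)) else 0)" for \<theta> and w
  define C2 where "C2 \<beta> w = (\<Sum>e\<in>Q. if cen e = w then \<beta> e else 0)" for \<beta> :: "nat \<times> nat \<Rightarrow> 'a" and w
  define C where "C = (\<lambda>(\<theta>, \<beta>). restrict (\<lambda>w. C1 \<theta> w + C2 \<beta> w) W)"
  have fin: "finite A" "finite Q" "finite W" by (auto simp: A_def Q_def W_def)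
  define Dom where "Dom = PiE A (\<lambda>_. Fq) \<times> PiE Q (\<lambda>_. k2)"
  have k2_fin: "finite k2" by (rule finite_subset[OF k2_subset_Fq finite_Fq])
  have Fq_sum: "sum f Z \<in> Fq" if "\<And>z. z \<in> Z \<Longrightarrow> f z \<in> Fq" for f :: "nat \<times> nat \<Rightarrow> 'a" and Z
    using that by (induction Z rule: infinite_finite_induct) (auto intro: Fq_add)
  have C1_Fq: "C1 \<theta> w \<in> Fq" if "\<And>a. a \<in> A \<Longrightarrow> \<theta> a \<in> Fq" for \<theta> w
    unfolding C1_def using that K(3) by (auto intro!: Fq_sum Fq_mult Fq_\<sigma> Fq_power)
  have C2_Fq: "C2 \<beta> w \<in> Fq" if "\<And>e. e \<in> Q \<Longrightarrow> \<beta> e \<in> k2" for \<beta> w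
    unfolding C2_def using that k2_subset_Fq by (auto intro!: Fq_sum)
  obtain x x' where x: "x \<in> Dom" "x' \<in> Dom" "x \<noteq> x'" "C x = C x'"
  proof (rule pigeonhole_difference[of Dom "PiE W (\<lambda>_. Fq)" C])
    show "finite Dom" "finite (PiE W (\<lambda>_. Fq))"
      using fin finite_Fq k2_fin by (auto simp: Dom_def intro!: finite_PiE finite_cartesian_product)
    have "card (PiE W (\<lambda>_. Fq)) = card Fq ^ ((D + d + 1)^2)"
      using fin by (simp add: card_PiE W_def card_cartesian_product power2_eq_square)
    also have "\<dots> < card Fq ^ ((D + 1)^2) * card k2 ^ (L * L * (M * m))"
      using L by (simp add: D_def)
    also have "\<dots> \<le> card Fq ^ ((D + 1)^2) * card k2 ^ (Suc (L * m) * Suc (L * M))"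
    proof (intro mult_left_mono power_increasing)
      show "L * L * (M * m) \<le> Suc (L * m) * Suc (L * M)" by (simp add: algebra_simps)
    qed (use k2_card in auto)
    also have "\<dots> = card Dom"
      using fin by (simp add: Dom_def card_PiE card_cartesian_product A_def Q_def power2_eq_square)
    finally show "card (PiE W (\<lambda>_. Fq)) < card Dom" .
    show "C ` Dom \<subseteq> PiE W (\<lambda>_. Fq)"
      unfolding Dom_def C_def by (auto intro!: Fq_add C1_Fq C2_Fq simp: PiE_mem)
  qed
  obtain \<theta>1 \<beta>1 \<theta>2 \<beta>2 where xx: "x = (\<theta>1, \<beta>1)" "x' = (\<theta>2, \<beta>2)" by (cases x, cases x')
  define \<theta> where "\<theta> a = (if a \<in> A then \<theta>1 a - \<theta>2 a else 0)" for a
  define \<beta> where "\<beta> e = (if e \<in> Q then \<beta>1 e - \<beta>2 e else 0)" for e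
  have k1D: "\<theta>1 a \<in> Fq" "\<theta>2 a \<in> Fq" if "a \<in> A" for a
    using x(1,2) that by (auto simp: Dom_def xx PiE_mem)
  have k2D: "\<beta>1 e \<in> k2" "\<beta>2 e \<in> k2" if "e \<in> Q" for e
    using x(1,2) that by (auto simp: Dom_def xx PiE_mem)
  have \<beta>_k2: "\<beta> e \<in> k2" for e
    using k2D[of e] k2_add[of "\<beta>1 e" "- \<beta>2 e"] k2_uminus by (auto simp: \<beta>_def)
  have C1_diff: "C1 \<theta> w = C1 \<theta>1 w - C1 \<theta>2 w" for w
    unfolding C1_def sum_subtractf[symmetric]
    by (intro sum.cong refl) (auto simp: \<theta>_def left_diff_distrib)
  have C2_diff: "C2 \<beta> w = C2 \<beta>1 w - C2 \<beta>2 w" for w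
    unfolding C2_def sum_subtractf[symmetric]
    by (intro sum.cong refl) (auto simp: \<beta>_def)
  have zero: "C1 \<theta> w + C2 \<beta> w = 0" if "w \<in> W" for w
  proof -
    have "C1 \<theta>1 w + C2 \<beta>1 w = C1 \<theta>2 w + C2 \<beta>2 w"
      using fun_cong[OF x(4), of w] that by (simp add: C_def xx)
    then show ?thesis by (simp add: C1_diff C2_diff algebra_simps)
  qed
  have prd_W: "prd a b \<in> W" if "a \<in> A" "b \<in> K" for a b
    using that K_d by (force simp: prd_def A_def W_def)
  have cen_W: "cen e \<in> W" if "e \<in> Q" for e
  proof -
    have "M * fst e \<le> M * (L * m)" "m * snd e \<le> m * (L * M)"
      using that by (auto simp: Q_def)
    moreover have "M * (L * m) = D" "m * (L * M) = D" by (simp_all add: D_def)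
    ultimately show ?thesis unfolding cen_def W_def by (auto intro: trans_le_add1)
  qed
  have \<beta>_nz: "\<exists>e\<in>Q. \<beta> e \<noteq> 0"
  proof (rule ccontr)
    assume "\<not> ?thesis"
    then have b0: "\<beta> e = 0" if "e \<in> Q" for e using that by blast
    then have C1_0: "C1 \<theta> w = 0" if "w \<in> W" for w
    proof -
      have "C2 \<beta> w = 0" unfolding C2_def by (rule sum.neutral) (simp add: b0)
      then show ?thesis using zero[OF that] by simp
    qed
    have mem: "\<theta>1 \<in> PiE A (\<lambda>_. Fq)" "\<theta>2 \<in> PiE A (\<lambda>_. Fq)" "\<beta>1 \<in> PiE Q (\<lambda>_. k2)" "\<beta>2 \<in> PiE Q (\<lambda>_. k2)"
      using x(1,2) by (simp_all add: Dom_def xx)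
    have "\<beta>1 e = \<beta>2 e" if "e \<in> Q" for e
      using b0[OF that] that by (simp add: \<beta>_def)
    then have "\<beta>1 = \<beta>2" by (rule PiE_ext[OF mem(3,4)])
    then have "\<theta>1 \<noteq> \<theta>2" using x(3) by (simp add: xx)
    moreover have "\<theta>1 = \<theta>2" if "\<And>a. a \<in> A \<Longrightarrow> \<theta>1 a = \<theta>2 a"
      using that by (rule PiE_ext[OF mem(1,2)])
    ultimately obtain a0 where a0: "a0 \<in> A" "\<theta> a0 \<noteq> 0" by (auto simp: \<theta>_def)
    \<comment> \<open>A monomial order: exponent pairs are read as two-digit numbers in base
      \<open>D + d + 1\<close>. As \<open>g\<close> is additive, the product of the leading
      monomials arises from no other pair of terms, and its coefficient is a product of nonzero
      factors.\<close>
    define g where "g u = fst u * Suc (D + d) + snd u" for u :: "nat \<times> nat"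
    have g_inj: "u = u'" if "g u = g u'" "snd u \<le> D + d" "snd u' \<le> D + d" for u u'
    proof -
      have "snd u = g u mod Suc (D + d)" "snd u' = g u' mod Suc (D + d)"
        "fst u = g u div Suc (D + d)" "fst u' = g u' div Suc (D + d)"
        using that(2,3) by (auto simp: g_def simp del: mult_Suc_right)
      then show ?thesis using that(1) by (simp add: prod_eq_iff)
    qed
    have g_prd: "g (prd a b) = g a + g b" for a b
      by (simp add: g_def prd_def algebra_simps)
    let ?supp = "{a \<in> A. \<theta> a \<noteq> 0}"
    have max_ex: "\<exists>u\<in>Z. \<forall>a\<in>Z. g a \<le> g u" if "finite Z" "Z \<noteq> {}" for Z
    proof -
      have "Max (g ` Z) \<in> g ` Z" using that by (intro Max_in) auto
      then obtain u where "u \<in> Z" "g u = Max (g ` Z)" by auto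
      then have "\<forall>a\<in>Z. g a \<le> g u" using that by simp
      then show ?thesis using \<open>u \<in> Z\<close> by blast
    qed
    obtain u where u: "u \<in> ?supp" "\<And>a. a \<in> ?supp \<Longrightarrow> g a \<le> g u"
    proof -
      have "finite ?supp" using fin by simp
      moreover have "?supp \<noteq> {}" using a0 by blast
      ultimately have "\<exists>u\<in>?supp. \<forall>a\<in>?supp. g a \<le> g u" by (rule max_ex)
      then show ?thesis using that by blast
    qed
    obtain w where w: "w \<in> K" "\<And>b. b \<in> K \<Longrightarrow> g b \<le> g w"
      using max_ex[of K] K(1,2) by blast
    have "C1 \<theta> (prd u w) = (\<Sum>a\<in>A. \<Sum>b\<in>K. if a = u \<and> b = w
        then \<theta> a * (\<sigma> ^^ fst a) (\<psi> b ^ (CHAR('a) ^ snd a)) else 0)"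
      unfolding C1_def
    proof (intro sum.cong refl)
      fix a b assume ab: "a \<in> A" "b \<in> K"
      have "a = u \<and> b = w" if "prd a b = prd u w" "\<theta> a \<noteq> 0"
      proof -
        have "g a + g b = g u + g w" using that(1) by (simp flip: g_prd)
        moreover have "g a \<le> g u" "g b \<le> g w" using u(2)[of a] w(2) ab that by auto
        ultimately have "g a = g u" "g b = g w" by auto
        then show ?thesis using g_inj[of a u] g_inj[of b w] ab u(1) w(1) K_d by (force simp: A_def)
      qed
      then show "(if prd a b = prd u w then \<theta> a * (\<sigma> ^^ fst a) (\<psi> b ^ (CHAR('a) ^ snd a)) else 0) =
          (if a = u \<and> b = w then \<theta> a * (\<sigma> ^^ fst a) (\<psi> b ^ (CHAR('a) ^ snd a)) else 0)"
        by auto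
    qed
    also have "\<dots> = (\<Sum>a\<in>A. if a = u then \<theta> a * (\<sigma> ^^ fst a) (\<psi> w ^ (CHAR('a) ^ snd a)) else 0)"
    proof (rule sum.cong[OF refl])
      fix a show "(\<Sum>b\<in>K. if a = u \<and> b = w then \<theta> a * (\<sigma> ^^ fst a) (\<psi> b ^ (CHAR('a) ^ snd a)) else 0) =
        (if a = u then \<theta> a * (\<sigma> ^^ fst a) (\<psi> w ^ (CHAR('a) ^ snd a)) else 0)"
        using K(1) w(1) by (cases "a = u") auto
    qed
    also have "\<dots> = \<theta> u * (\<sigma> ^^ fst u) (\<psi> w ^ (CHAR('a) ^ snd u))"
      using u(1) fin by simp
    finally have "C1 \<theta> (prd u w) = \<theta> u * (\<sigma> ^^ fst u) (\<psi> w ^ (CHAR('a) ^ snd u))" .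
    then show False
      using C1_0[OF prd_W, of u w] u(1) w(1) K(3)[of w] by (auto simp: \<sigma>_i_eq_0)
  qed
  \<comment> \<open>The formal identity is evaluated at \<open>v\<close>: the part from
    \<open>C1\<close> is the operator \<open>\<theta>\<close> applied to the value of
    \<open>\<psi>\<close> at \<open>v\<close>, which is zero, so the central part vanishes by
    itself.\<close>
  have sum0: "(\<Sum>e\<in>Q. \<beta> e * Z (cen e) v) = 0" if v: "v \<in> T" for v
  proof -
    have Z_mult: "(\<sigma> ^^ fst a) ((c * Z b v) ^ (CHAR('a) ^ snd a)) =
        (\<sigma> ^^ fst a) (c ^ (CHAR('a) ^ snd a)) * Z (prd a b) v" for a b c
      by (simp add: Z_def prd_def power_mult_distrib \<sigma>_i_mult \<sigma>_i_pow funpow_add add.commute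
          power_add power_mult[symmetric] mult.commute[of "CHAR('a) ^ snd b"])
    have \<psi>_0: "(\<Sum>b\<in>K. \<psi> b * Z b v) = 0"
      using T[OF v] by (simp add: case_prod_unfold Z_def)
    have "0 = (\<Sum>w\<in>W. (C1 \<theta> w + C2 \<beta> w) * Z w v)" using zero by simp
    also have "\<dots> = (\<Sum>w\<in>W. C1 \<theta> w * Z w v) + (\<Sum>w\<in>W. C2 \<beta> w * Z w v)"
      by (simp add: ring_distribs sum.distrib)
    also have "(\<Sum>w\<in>W. C2 \<beta> w * Z w v) = (\<Sum>e\<in>Q. \<Sum>w\<in>W. if cen e = w then \<beta> e * Z w v else 0)"
      unfolding C2_def sum_distrib_right
      by (subst sum.swap) (intro sum.cong refl, simp)
    also have "\<dots> = (\<Sum>e\<in>Q. \<beta> e * Z (cen e) v)"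
      using cen_W fin by (intro sum.cong refl) simp
    also have "(\<Sum>w\<in>W. C1 \<theta> w * Z w v) = (\<Sum>a\<in>A. \<Sum>w\<in>W. \<Sum>b\<in>K. if prd a b = w
        then \<theta> a * (\<sigma> ^^ fst a) (\<psi> b ^ (CHAR('a) ^ snd a)) * Z w v else 0)"
      unfolding C1_def sum_distrib_right
      by (subst sum.swap) (intro sum.cong refl, simp)
    also have "\<dots> = (\<Sum>a\<in>A. \<Sum>b\<in>K. \<Sum>w\<in>W. if prd a b = w
        then \<theta> a * (\<sigma> ^^ fst a) (\<psi> b ^ (CHAR('a) ^ snd a)) * Z w v else 0)"
      by (rule sum.cong[OF refl]) (rule sum.swap)
    also have "\<dots> = (\<Sum>a\<in>A. \<Sum>b\<in>K. \<theta> a * (\<sigma> ^^ fst a) (\<psi> b ^ (CHAR('a) ^ snd a)) * Z (prd a b) v)"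
      using prd_W fin by (intro sum.cong refl) simp
    also have "\<dots> = (\<Sum>a\<in>A. \<theta> a * (\<sigma> ^^ fst a) ((\<Sum>b\<in>K. \<psi> b * Z b v) ^ (CHAR('a) ^ snd a)))"
      unfolding freshmans_dream_sum'[OF prime_char refl] \<sigma>_i_sum Z_mult sum_distrib_left mult.assoc ..
    also have "\<dots> = 0" using p_gt_1 unfolding \<psi>_0 by (simp add: power_0_left)
    finally show ?thesis by simp
  qed
  show ?thesis
  proof (rule exI[of _ "L * m"], rule exI[of _ "L * M"], rule exI[of _ \<beta>], intro conjI)
    show "\<forall>i j. \<beta> (i, j) \<in> k2" using \<beta>_k2 by blast
    show "\<exists>i\<le>L * m. \<exists>j\<le>L * M. \<beta> (i, j) \<noteq> 0" using \<beta>_nz by (auto simp: Q_def)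
    show "\<forall>v\<in>T. (\<Sum>i\<le>L * m. \<Sum>j\<le>L * M. \<beta> (i, j) * (\<sigma> ^^ (M * i)) (v ^ (q ^ j))) = 0"
      using sum0 by (simp add: Q_def sum.cartesian_product Z_def cen_def q_pow case_prod_unfold)
  qed
qed

end

context difference_frobenius
begin

text \<open>The central multiple vanishes on the infinite set \<open>T\<close>. It is
  \<open>Fq\<close>-linear and commutes with \<open>t\<close>, so by \<open>uniserial\<close>
  vanishing at points of arbitrarily large order forces vanishing on \<open>V\<close>. Sorted by
  powers of \<open>\<sigma> ^^ M\<close>, it is an equation for \<open>\<sigma> ^^ M\<close> over
  the polynomials in the \<open>q\<close>-Frobenius.\<close>

lemma algebraic_relation:
  fixes \<psi> :: "nat \<times> nat \<Rightarrow> 'a"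
  assumes K: "finite K" "K \<noteq> {}" "\<And>u. u \<in> K \<Longrightarrow> \<psi> u \<in> Fq \<and> \<psi> u \<noteq> 0"
    and \<psi>: "\<And>v. v \<in> T \<Longrightarrow> (\<Sum>(i, j)\<in>K. \<psi> (i, j) * (\<sigma> ^^ i) (v ^ (CHAR('a) ^ j))) = 0"
    and T: "infinite T" "T \<subseteq> V"
  shows "\<exists>\<delta> a. (\<forall>i. a i \<in> S) \<and> a \<delta> \<noteq> 0 \<and> (\<forall>v\<in>V. (\<Sum>i\<le>\<delta>. act (a i) ((\<sigma> ^^ (M * i)) v)) = 0)"
proof -
  have "\<exists>L1 L2 b. (\<forall>i j. b (i, j) \<in> k2) \<and> (\<exists>i\<le>L1. \<exists>j\<le>L2. b (i, j) \<noteq> 0) \<and>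
    (\<forall>v\<in>T. (\<Sum>i\<le>L1. \<Sum>j\<le>L2. b (i, j) * (\<sigma> ^^ (M * i)) (v ^ (q ^ j))) = 0)"
    by (rule central_left_multiple[OF K \<psi>])
  then obtain L1 L2 and b :: "nat \<times> nat \<Rightarrow> 'a"
    where b': "(\<forall>i j. b (i, j) \<in> k2) \<and> (\<exists>i\<le>L1. \<exists>j\<le>L2. b (i, j) \<noteq> 0) \<and>
    (\<forall>v\<in>T. (\<Sum>i\<le>L1. \<Sum>j\<le>L2. b (i, j) * (\<sigma> ^^ (M * i)) (v ^ (q ^ j))) = 0)"
    by (elim exE)
  have b: "\<And>i j. b (i, j) \<in> k2" "\<exists>i\<le>L1. \<exists>j\<le>L2. b (i, j) \<noteq> 0"
    "\<And>v. v \<in> T \<Longrightarrow> (\<Sum>i\<le>L1. \<Sum>j\<le>L2. b (i, j) * (\<sigma> ^^ (M * i)) (v ^ (q ^ j))) = 0"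
    using b' by simp_all
  define a where "a i = (\<Sum>j\<le>L2. monom (b (i, j)) j)" for i
  have a_S: "a i \<in> S" for i
    unfolding a_def using b(1) by (intro S_sum) (auto simp: S_def)
  have act_a: "act (a i) v = (\<Sum>j\<le>L2. b (i, j) * v ^ (q ^ j))" for i v
    by (simp add: a_def act_sum act_monom)
  define y where "y v = (\<Sum>i\<le>L1. act (a i) ((\<sigma> ^^ (M * i)) v))" for v
  have y_T: "y v = 0" if "v \<in> T" for v
    using b(3)[OF that] by (simp add: y_def act_a \<sigma>_i_pow)
  have y_V: "y v = 0" if v: "v \<in> V" for v
  proof -
    obtain n where "(t ^^ n) v = 0" using v by (auto simp: V_def)
    then have n: "(t ^^ Suc n) v = 0" by (rule t_mono) simp
    obtain w where w: "w \<in> T" "(t ^^ n) w \<noteq> 0" using infinite_subset_order[OF T] by blast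
    show ?thesis
    proof (rule uniserial[of y, OF _ _ _ _ y_T[OF w(1)] w(2) n])
      fix c v :: 'a assume c: "c \<in> Fq"
      show "y (c * v) = c * y v"
        using Fq_sigma_M[OF c] c by (simp add: y_def \<sigma>_i_mult act_arg_Fq sum_distrib_left)
    next
      fix v :: 'a
      have "act (a i) (act Xm1 v) = act Xm1 (act (a i) v)" for i v
        using act_mult_S[OF Xm1_S, of "a i" v] act_mult_S[OF a_S, of Xm1 i v] by (simp add: mult.commute)
      then show "y (t v) = t (y v)"
        by (simp add: y_def flip: act_Xm1 act_arg_sum act_\<sigma>[OF Xm1_S])
    qed (use w T in \<open>auto simp: y_def \<sigma>_i_add act_arg_add sum.distrib\<close>)
  qed
  define \<delta> where "\<delta> = Max {i. i \<le> L1 \<and> a i \<noteq> 0}"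
  have "coeff (a i) j = b (i, j)" if "j \<le> L2" for i j
    using that by (simp add: a_def coeff_sum)
  then have "{i. i \<le> L1 \<and> a i \<noteq> 0} \<noteq> {}" using b(2) by (metis (mono_tags) coeff_0 empty_iff mem_Collect_eq)
  then have "\<delta> \<in> {i. i \<le> L1 \<and> a i \<noteq> 0}" unfolding \<delta>_def by (intro Max_in) auto
  moreover have "a i = 0" if "i \<le> L1" "i > \<delta>" for i
  proof (rule ccontr)
    assume "a i \<noteq> 0"
    then have "i \<le> \<delta>" unfolding \<delta>_def using that by (intro Max_ge) auto
    then show False using that by simp
  qed
  then have "y v = (\<Sum>i\<le>\<delta>. act (a i) ((\<sigma> ^^ (M * i)) v))" for v
    unfolding y_def using calculation by (intro sum.mono_neutral_right) (auto simp: not_le)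
  ultimately show ?thesis using y_V a_S by (intro exI[of _ \<delta>] exI[of _ a]) auto
qed

end

section \<open>Finite rank of the operators over the central polynomials\<close>

locale algebraic_difference_frobenius = difference_frobenius +
  fixes \<delta> :: nat and a :: "nat \<Rightarrow> 'a poly"
  assumes a_S: "a i \<in> S" and a_nz: "a \<delta> \<noteq> 0"
    and relation: "v \<in> V \<Longrightarrow> (\<Sum>i\<le>\<delta>. act (a i) ((\<sigma> ^^ (M * i)) v)) = 0"
begin

text \<open>The index set of the monomials below the relation for \<open>\<sigma> ^^ M\<close> in
  one exponent and below the \<open>q\<close>-Frobenius in the other. The scalars of
  \<open>Fq\<close> belong to the index because polynomials in \<open>S\<close> only have
  coefficients in the subfield \<open>k2\<close>.\<close>

definition Bs :: "('a \<times> nat \<times> nat) set" where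
  "Bs = Fq \<times> {..<M * \<delta>} \<times> {..<m}"
definition bas :: "'a \<times> nat \<times> nat \<Rightarrow> 'a \<Rightarrow> 'a" where
  "bas = (\<lambda>(c, i, j) v. c * (\<sigma> ^^ i) (v ^ (CHAR('a) ^ j)))"
text \<open>The leading coefficient \<open>a \<delta>\<close> need not be invertible, so reduction
  by the relation works up to a power of it: this is spanning after localisation at
  \<open>a \<delta>\<close>.\<close>

definition spn :: "('a \<Rightarrow> 'a) \<Rightarrow> bool" where
  "spn f \<longleftrightarrow> (\<exists>N z. (\<forall>b. z b \<in> S) \<and>
     (\<forall>v\<in>V. act (a \<delta> ^ N) (f v) = (\<Sum>b\<in>Bs. act (z b) (bas b v))))"

lemma finite_Bs: "finite Bs"
  using finite_Fq by (simp add: Bs_def)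

lemma spn_raise:
  assumes "z \<in> S" "\<And>b. zz b \<in> S" "act (a \<delta> ^ N) y = (\<Sum>b\<in>Bs. act (zz b) (bas b v))"
  shows "act (z * a \<delta> ^ N) y = (\<Sum>b\<in>Bs. act (z * zz b) (bas b v))"
  using assms a_S by (simp add: act_mult_S S_power act_arg_sum)

lemma spn_add:
  assumes "spn f" "spn g" shows "spn (\<lambda>v. f v + g v)"
proof -
  obtain N z N' z' where z: "\<And>b. z b \<in> S" "\<And>b. z' b \<in> S"
    "\<And>v. v \<in> V \<Longrightarrow> act (a \<delta> ^ N) (f v) = (\<Sum>b\<in>Bs. act (z b) (bas b v))"
    "\<And>v. v \<in> V \<Longrightarrow> act (a \<delta> ^ N') (g v) = (\<Sum>b\<in>Bs. act (z' b) (bas b v))"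
    using assms unfolding spn_def by blast
  show ?thesis unfolding spn_def
  proof (intro exI conjI allI ballI)
    show "a \<delta> ^ N' * z b + a \<delta> ^ N * z' b \<in> S" for b
      using z a_S by (intro S_add S_mult S_power) auto
    fix v assume v: "v \<in> V"
    have "act (a \<delta> ^ N' * a \<delta> ^ N) (f v) = (\<Sum>b\<in>Bs. act (a \<delta> ^ N' * z b) (bas b v))"
      by (rule spn_raise) (use z v a_S in \<open>auto intro: S_power\<close>)
    moreover have "act (a \<delta> ^ N * a \<delta> ^ N') (g v) = (\<Sum>b\<in>Bs. act (a \<delta> ^ N * z' b) (bas b v))"
      by (rule spn_raise) (use z v a_S in \<open>auto intro: S_power\<close>)
    ultimately show "act (a \<delta> ^ (N' + N)) (f v + g v) =
        (\<Sum>b\<in>Bs. act (a \<delta> ^ N' * z b + a \<delta> ^ N * z' b) (bas b v))"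
      by (simp add: act_arg_add act_add sum.distrib power_add mult.commute)
  qed
qed

lemma spn_0: "spn (\<lambda>v. 0)"
  unfolding spn_def by (intro exI[of _ 0] exI[of _ "\<lambda>_. 0"]) auto

lemma spn_sum: "(\<And>i. i \<in> A \<Longrightarrow> spn (f i)) \<Longrightarrow> spn (\<lambda>v. \<Sum>i\<in>A. f i v)"
  by (induction A rule: infinite_finite_induct) (auto intro: spn_0 spn_add)

lemma spn_act:
  assumes "spn f" "d \<in> S" shows "spn (\<lambda>v. act d (f v))"
proof -
  obtain N z where z: "\<And>b. z b \<in> S"
    "\<And>v. v \<in> V \<Longrightarrow> act (a \<delta> ^ N) (f v) = (\<Sum>b\<in>Bs. act (z b) (bas b v))"
    using assms unfolding spn_def by blast
  show ?thesis unfolding spn_def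
  proof (intro exI conjI allI ballI)
    show "d * z b \<in> S" for b using z assms by (intro S_mult)
    fix v assume v: "v \<in> V"
    have "act (d * a \<delta> ^ N) (f v) = (\<Sum>b\<in>Bs. act (d * z b) (bas b v))"
      by (rule spn_raise) (use z v assms in auto)
    then show "act (a \<delta> ^ N) (act d (f v)) = (\<Sum>b\<in>Bs. act (d * z b) (bas b v))"
      using act_mult_S[OF assms(2), of "a \<delta> ^ N" "f v"] by (simp add: mult.commute)
  qed
qed

lemma spn_cancel:
  assumes "spn (\<lambda>v. act (a \<delta>) (f v))" shows "spn f"
proof -
  obtain N z where z: "\<And>b. z b \<in> S"
    "\<And>v. v \<in> V \<Longrightarrow> act (a \<delta> ^ N) (act (a \<delta>) (f v)) = (\<Sum>b\<in>Bs. act (z b) (bas b v))"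
    using assms unfolding spn_def by blast
  have "act (a \<delta> ^ Suc N) (f v) = act (a \<delta> ^ N) (act (a \<delta>) (f v))" for v
    using act_mult_S[OF a_S[of \<delta>], of "a \<delta> ^ N" "f v"] by (simp add: mult.commute)
  then show ?thesis unfolding spn_def using z by (intro exI[of _ "Suc N"] exI[of _ z]) auto
qed

lemma spn_cong: "spn f \<Longrightarrow> (\<And>v. v \<in> V \<Longrightarrow> f v = g v) \<Longrightarrow> spn g"
  unfolding spn_def by auto

lemma spn_bas: "b \<in> Bs \<Longrightarrow> spn (bas b)"
  unfolding spn_def
proof (intro exI conjI allI ballI)
  assume b: "b \<in> Bs"
  show "(if b' = b then 1 else 0) \<in> S" for b' by simp
  show "act (a \<delta> ^ 0) (bas b v) = (\<Sum>b'\<in>Bs. act (if b' = b then 1 else 0) (bas b' v))" for v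
    using b finite_Bs by (simp add: if_distrib[of "\<lambda>d. act d _"] cong: if_cong)
qed

text \<open>Division with remainder in both exponents: a surplus in \<open>j\<close> is absorbed by
  a power of the \<open>q\<close>-Frobenius, which lies in \<open>S\<close>; for
  \<open>i \<ge> M * \<delta>\<close> the relation, applied to the point \<open>u v\<close>, lowers
  \<open>i\<close> at the price of one factor \<open>a \<delta>\<close>.\<close>

lemma spn_mono: "c \<in> Fq \<Longrightarrow> spn (\<lambda>v. c * (\<sigma> ^^ i) (v ^ (CHAR('a) ^ j)))"
proof (induction i rule: less_induct)
  case (less i)
  show ?case
  proof (cases "i < M * \<delta>")
    case True
    have "spn (\<lambda>v. act (monom 1 (j div m)) (bas (c, i, j mod m) v))"
      using True less.prems m_pos by (intro spn_act spn_bas S_monom) (auto simp: Bs_def)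
    moreover have "act (monom 1 (j div m)) (bas (c, i, j mod m) v) = c * (\<sigma> ^^ i) (v ^ (CHAR('a) ^ j))" for v
    proof -
      have "CHAR('a) ^ j = CHAR('a) ^ (j mod m) * q ^ (j div m)"
        by (simp add: q_pow flip: power_add)
      then show ?thesis
        by (simp add: act_monom bas_def power_mult_distrib Fq_pow_q less.prems \<sigma>_i_pow flip: power_mult)
    qed
    ultimately show ?thesis by simp
  next
    case False
    define i' where "i' = i - M * \<delta>"
    have i: "i = M * \<delta> + i'" using False by (simp add: i'_def)
    define u where "u v = (\<sigma> ^^ i') (v ^ (CHAR('a) ^ j))" for v
    have IH: "spn (\<lambda>v. c * (\<sigma> ^^ (M * l)) (u v))" if "l < \<delta>" for l
    proof -
      have "M * l + i' < i" using that M_pos by (simp add: i)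
      from less.IH[OF this less.prems] show ?thesis by (simp add: u_def funpow_add)
    qed
    have "spn (\<lambda>v. \<Sum>l<\<delta>. act (- a l) (c * (\<sigma> ^^ (M * l)) (u v)))"
      using IH a_S by (intro spn_sum spn_act S_uminus) auto
    moreover have "(\<Sum>l<\<delta>. act (- a l) (c * (\<sigma> ^^ (M * l)) (u v))) =
        act (a \<delta>) (c * (\<sigma> ^^ i) (v ^ (CHAR('a) ^ j)))" if "v \<in> V" for v
    proof -
      have "u v \<in> V" unfolding u_def by (intro V_\<sigma> V_power that)
      from relation[OF this]
      have "(\<Sum>l<\<delta>. act (a l) ((\<sigma> ^^ (M * l)) (u v))) + act (a \<delta>) ((\<sigma> ^^ (M * \<delta>)) (u v)) = 0"
        by (simp add: lessThan_Suc_atMost[symmetric])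
      then have "act (a \<delta>) ((\<sigma> ^^ (M * \<delta>)) (u v)) = - (\<Sum>l<\<delta>. act (a l) ((\<sigma> ^^ (M * l)) (u v)))"
        by (simp add: eq_neg_iff_add_eq_0 add.commute)
      moreover have "(\<sigma> ^^ i) (v ^ (CHAR('a) ^ j)) = (\<sigma> ^^ (M * \<delta>)) (u v)"
        by (simp add: i u_def funpow_add)
      ultimately show ?thesis
        using less.prems by (simp add: act_arg_Fq act_uminus sum_negf sum_distrib_left)
    qed
    ultimately have "spn (\<lambda>v. act (a \<delta>) (c * (\<sigma> ^^ i) (v ^ (CHAR('a) ^ j))))"
      by (rule spn_cong)
    then show ?thesis by (rule spn_cancel)
  qed
qed

lemma spn_R: "f \<in> R \<Longrightarrow> spn f"
  by (induction rule: R_induct) (auto intro: spn_0 spn_add spn_mono)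

text \<open>Once a common power of \<open>a \<delta>\<close> clears the denominators, the
  \<open>card Bs + 1\<close> powers of \<open>f\<close> up to exponent \<open>card Bs\<close> have
  coordinate vectors of length \<open>card Bs\<close>, so they are linearly dependent over
  \<open>S\<close>.\<close>

lemma R_relation:
  assumes f: "f \<in> R"
  shows "\<exists>n d. (\<forall>i. d i \<in> S) \<and> (\<exists>i\<le>n. d i \<noteq> 0) \<and> (\<forall>v\<in>V. (\<Sum>i\<le>n. act (d i) ((f ^^ i) v)) = 0)"
proof -
  have "\<exists>N z. (\<forall>b. z b \<in> S) \<and>
     (\<forall>v\<in>V. act (a \<delta> ^ N) ((f ^^ i) v) = (\<Sum>b\<in>Bs. act (z b) (bas b v)))" for i
    using spn_R[OF R_funpow[OF f, of i]] by (simp add: spn_def)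
  then obtain N z where z: "\<And>i b. z i b \<in> S"
    "\<And>i v. v \<in> V \<Longrightarrow> act (a \<delta> ^ N i) ((f ^^ i) v) = (\<Sum>b\<in>Bs. act (z i b) (bas b v))"
    by metis
  define n where "n = card Bs"
  define N' where "N' = Max (N ` {..n})"
  have N': "N i \<le> N'" if "i \<le> n" for i unfolding N'_def using that by (intro Max_ge) auto
  define r where "r i b = a \<delta> ^ (N' - N i) * z i b" for i b
  have r_S: "r i b \<in> S" for i b
    unfolding r_def using z a_S by (intro S_mult S_power)
  have r: "act (a \<delta> ^ N') ((f ^^ i) v) = (\<Sum>b\<in>Bs. act (r i b) (bas b v))" if "v \<in> V" "i \<le> n" for i v
  proof -
    have "act (a \<delta> ^ (N' - N i) * a \<delta> ^ N i) ((f ^^ i) v) = (\<Sum>b\<in>Bs. act (r i b) (bas b v))"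
      unfolding r_def by (rule spn_raise) (use z that a_S in \<open>auto intro: S_power\<close>)
    then show ?thesis using N'[OF that(2)] by (simp flip: power_add)
  qed
  have "\<exists>c. (\<forall>i\<in>{..n}. c i \<in> S) \<and> (\<exists>i\<in>{..n}. c i \<noteq> 0) \<and> (\<forall>b\<in>Bs. (\<Sum>i\<le>n. c i * r i b) = 0)"
  proof (rule linear_dependence_subring)
    show "x - y \<in> S" if "x \<in> S" "y \<in> S" for x y
      using S_add[OF that(1) S_uminus[OF that(2)]] by simp
  qed (auto simp: finite_Bs n_def r_S S_mult)
  then obtain c where c: "\<And>i. i \<le> n \<Longrightarrow> c i \<in> S" "\<exists>i\<le>n. c i \<noteq> 0"
    "\<And>b. b \<in> Bs \<Longrightarrow> (\<Sum>i\<le>n. c i * r i b) = 0" by auto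
  define d where "d i = (if i \<le> n then c i * a \<delta> ^ N' else 0)" for i
  show ?thesis
  proof (rule exI[of _ n], rule exI[of _ d], intro conjI allI ballI)
    show "d i \<in> S" for i using c(1) a_S by (auto simp: d_def intro!: S_mult S_power)
    show "\<exists>i\<le>n. d i \<noteq> 0" using c(2) a_nz by (auto simp: d_def)
    fix v assume v: "v \<in> V"
    have "(\<Sum>i\<le>n. act (d i) ((f ^^ i) v)) = (\<Sum>i\<le>n. act (c i) (act (a \<delta> ^ N') ((f ^^ i) v)))"
      by (intro sum.cong refl) (simp add: d_def act_mult_S S_power a_S)
    also have "\<dots> = (\<Sum>i\<le>n. \<Sum>b\<in>Bs. act (c i * r i b) (bas b v))"
      by (intro sum.cong refl) (simp add: r[OF v] act_arg_sum act_mult_S r_S)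
    also have "\<dots> = (\<Sum>b\<in>Bs. act (\<Sum>i\<le>n. c i * r i b) (bas b v))"
      by (subst sum.swap) (simp add: act_sum)
    also have "\<dots> = 0" using c(3) by simp
    finally show "(\<Sum>i\<le>n. act (d i) ((f ^^ i) v)) = 0" .
  qed
qed

lemma S_kills_V:
  assumes "\<And>v. v \<in> V \<Longrightarrow> act d v = 0" shows "d = 0"
  using assms finite_act_kernel[of d] infinite_V finite_subset[of V "{v. act d v = 0}"] by blast

text \<open>Both alternatives are read off a relation of minimal degree.\<close>
lemma regular_or_zero_divisor:
  assumes f: "f \<in> R"
  obtains (regular) f' d where "f' \<in> R" "d \<in> S" "d \<noteq> 0" "\<And>v. v \<in> V \<Longrightarrow> f' (f v) = act d v"
  | (zero_divisor) g where "g \<in> R" "\<exists>v\<in>V. g v \<noteq> 0" "\<And>v. v \<in> V \<Longrightarrow> f (g v) = 0"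
proof -
  define P where "P n \<longleftrightarrow> (\<exists>d. (\<forall>i. d i \<in> S) \<and> (\<exists>i\<le>n. d i \<noteq> 0) \<and>
    (\<forall>v\<in>V. (\<Sum>i\<le>n. act (d i) ((f ^^ i) v)) = 0))" for n
  have "\<exists>n. P n" using R_relation[OF f] by (simp add: P_def)
  then obtain n where n: "P n" "\<And>k. k < n \<Longrightarrow> \<not> P k" using exists_least_iff[of P] by blast
  from n(1) obtain d where d: "\<And>i. d i \<in> S" "\<exists>i\<le>n. d i \<noteq> 0"
    "\<And>v. v \<in> V \<Longrightarrow> (\<Sum>i\<le>n. act (d i) ((f ^^ i) v)) = 0" by (auto simp: P_def)
  have "n \<noteq> 0"
  proof
    assume "n = 0"
    then have "d 0 = 0" using d(3) by (intro S_kills_V) auto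
    then show False using d(2) \<open>n = 0\<close> by simp
  qed
  then obtain k where k: "n = Suc k" by (cases n) auto
  \<comment> \<open>The relation reads \<open>d 0 + g f = 0\<close>, with \<open>g\<close> a
    polynomial in \<open>f\<close> and therefore commuting with it. If \<open>d 0\<close> is
    nonzero, \<open>- g\<close> inverts \<open>f\<close> up to \<open>act (d 0)\<close>; if it is
    zero, \<open>f\<close> and \<open>g\<close> annihilate each other, and minimality of the degree
    makes \<open>g\<close> nonzero on \<open>V\<close>.\<close>
  define g where "g v = (\<Sum>i\<le>k. act (d (Suc i)) ((f ^^ i) v))" for v
  have g_R: "g \<in> R"
    unfolding g_def[abs_def] using d(1) f by (intro R_sum R_comp[OF R_act_in] R_funpow)
  have gf: "act (d 0) v + g (f v) = 0" if "v \<in> V" for v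
    using d(3)[OF that] unfolding k sum.atMost_Suc_shift by (simp add: g_def funpow_swap1)
  have fg: "f (g v) = g (f v)" for v
    unfolding g_def by (simp add: R_arg_sum[OF f] R_act[OF f d(1)] funpow_swap1)
  show ?thesis
  proof (cases "d 0 = 0")
    case False
    have "act (- 1) (g (f v)) = act (d 0) v" if "v \<in> V" for v
      using gf[OF that] by (simp add: act_uminus neg_eq_iff_add_eq_0 add.commute)
    moreover have "(\<lambda>v. act (- 1) (g v)) \<in> R" by (intro R_comp[OF R_act_in] g_R S_uminus) simp
    ultimately show ?thesis using regular False d(1) by blast
  next
    case True
    have "\<exists>v\<in>V. g v \<noteq> 0"
    proof (rule ccontr)
      assume "\<not> ?thesis"
      moreover obtain i where "i \<le> n" "d i \<noteq> 0" using d(2) by blast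
      then obtain i' where "i' \<le> k" "d (Suc i') \<noteq> 0" using True k by (cases i) auto
      ultimately have "P k" unfolding P_def g_def using d(1) by (intro exI[of _ "\<lambda>i. d (Suc i)"]) auto
      then show False using n(2)[of k] k by simp
    qed
    then show ?thesis using zero_divisor[OF g_R] gf True fg by simp
  qed
qed

end

section \<open>Independence of characters and recovery of points from the kernel\<close>

context difference_frobenius
begin

text \<open>The inner scalars \<open>c\<close> keep the values \<open>e (c * v)\<close> in the
  kernel of \<open>\<Psi>\<close> when \<open>\<Psi> e = 0\<close> on \<open>V\<close>; the outer
  scalars \<open>l\<close> are applied afterwards, to points of the kernel.\<close>

definition comb :: "('a \<times> 'a) list \<Rightarrow> ('a \<Rightarrow> 'a) \<Rightarrow> 'a \<Rightarrow> 'a" where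
  "comb ps e v = (\<Sum>(l, c)\<leftarrow>ps. l * e (c * v))"

lemma comb_Nil [simp]: "comb [] e v = 0"
  and comb_Cons [simp]: "comb ((l, c) # ps) e v = l * e (c * v) + comb ps e v"
  and comb_append [simp]: "comb (ps @ ps') e v = comb ps e v + comb ps' e v"
  by (simp_all add: comb_def)

lemma R_arg_smult: "f \<in> R \<Longrightarrow> c \<in> Fq \<Longrightarrow> (\<lambda>v. f (c * v)) \<in> R"
proof -
  assume f: "f \<in> R" and c: "c \<in> Fq"
  have "(\<lambda>v. c * v) \<in> R" using R_mono[OF c, of 0 0] by simp
  from R_comp[OF f this] show ?thesis .
qed

lemma comb_R: "e \<in> R \<Longrightarrow> set ps \<subseteq> Fq \<times> Fq \<Longrightarrow> comb ps e \<in> R"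
proof (induction ps)
  case Nil
  have "comb [] e = (\<lambda>v. 0)" by auto
  then show ?case using R_0 by simp
next
  case (Cons x ps)
  obtain l c where x: "x = (l, c)" by (cases x)
  have "(\<lambda>v. l * e (c * v) + comb ps e v) \<in> R"
    using Cons x by (intro R_add R_smult R_arg_smult) auto
  moreover have "comb (x # ps) e = (\<lambda>v. l * e (c * v) + comb ps e v)" by (auto simp: x)
  ultimately show ?case by simp
qed

text \<open>
  Artin's argument for the independence of characters: subtracting a multiple of \<open>y\<close> from
  \<open>v \<mapsto> y (c v)\<close> shortens an expression of \<open>y\<close> as long as \<open>y\<close> is not semilinear.
\<close>
lemma semilinear_combination:
  assumes "set ps \<subseteq> Fq \<times> Fq" "\<forall>(c, i, j)\<in>set xs. c \<in> Fq"
    and "\<forall>v\<in>V. comb ps e v = opr xs v" "\<exists>v\<in>V. comb ps e v \<noteq> 0"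
  shows "\<exists>ps' i j. set ps' \<subseteq> Fq \<times> Fq \<and> (\<exists>v\<in>V. comb ps' e v \<noteq> 0) \<and>
    (\<forall>c\<in>Fq. \<forall>v\<in>V. comb ps' e (c * v) = (\<sigma> ^^ i) (c ^ (CHAR('a) ^ j)) * comb ps' e v)"
  using assms
proof (induction "length xs" arbitrary: ps xs)
  case 0
  then show ?case by auto
next
  case (Suc n)
  then obtain a i j xs' where xs: "xs = (a, i, j) # xs'" by (cases xs) auto
  define \<chi> where "\<chi> i j c = (\<sigma> ^^ i) (c ^ (CHAR('a) ^ j))" for i j c
  have \<chi>_Fq: "\<chi> i j c \<in> Fq" if "c \<in> Fq" for i j c
    unfolding \<chi>_def using that by (intro Fq_\<sigma> Fq_power)
  show ?case
  proof (cases "\<forall>c\<in>Fq. \<forall>v\<in>V. comb ps e (c * v) = \<chi> i j c * comb ps e v")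
    case True
    then show ?thesis using Suc.prems unfolding \<chi>_def by blast
  next
    case False
    then obtain c v where cv: "c \<in> Fq" "v \<in> V" "comb ps e (c * v) \<noteq> \<chi> i j c * comb ps e v" by blast
    \<comment> \<open>The new list expresses
      \<open>v \<mapsto> y (c * v) - \<chi> i j c * y v\<close> for the combination
      \<open>y\<close>. The list doubles in length, but the operator that represents the combination
      loses its first monomial, and the induction is on the length of the latter.\<close>
    define ps' where "ps' = map (\<lambda>(l, c'). (l, c' * c)) ps @ map (\<lambda>(l, c'). (- \<chi> i j c * l, c')) ps"
    define xs'' where "xs'' = map (\<lambda>(a', i', j'). (a' * (\<chi> i' j' c - \<chi> i j c), i', j')) xs'"
    have ps': "comb ps' e v = comb ps e (c * v) - \<chi> i j c * comb ps e v" for v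
    proof -
      have "comb (map (\<lambda>(l, c'). (l, c' * c)) ps) e v = comb ps e (c * v)" for ps
        by (induction ps) (auto simp: mult.assoc)
      moreover have "comb (map (\<lambda>(l, c'). (- \<chi> i j c * l, c')) ps) e v = - \<chi> i j c * comb ps e v" for ps
        by (induction ps) (auto simp: algebra_simps)
      ultimately show ?thesis by (simp add: ps'_def)
    qed
    have xs'': "opr xs'' v = opr xs (c * v) - \<chi> i j c * opr xs v" for v
    proof -
      have "opr (map (\<lambda>(a', i', j'). (a' * (\<chi> i' j' c - \<chi> i j c), i', j')) xs') v =
          opr xs' (c * v) - \<chi> i j c * opr xs' v" for xs'
        by (induction xs') (auto simp: \<chi>_def power_mult_distrib \<sigma>_i_mult algebra_simps)
      then show ?thesis
        by (simp add: xs''_def xs \<chi>_def power_mult_distrib \<sigma>_i_mult algebra_simps)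
    qed
    show ?thesis
    proof (rule Suc.hyps(1)[of xs'' ps'])
      show "n = length xs''" using Suc.hyps(2) by (simp add: xs''_def xs)
      show "set ps' \<subseteq> Fq \<times> Fq"
        using Suc.prems(1) cv(1) \<chi>_Fq[OF cv(1), of i j] by (auto simp: ps'_def intro!: Fq_mult Fq_uminus)
      show "\<forall>(c, i, j)\<in>set xs''. c \<in> Fq"
        using Suc.prems(2) \<chi>_Fq[OF cv(1)] by (auto simp: xs xs''_def intro!: Fq_mult Fq_diff)
      have "c * v \<in> V" if "v \<in> V" for v using that cv(1) Fq_subset_V by (auto intro: V_mult)
      then show "\<forall>v\<in>V. comb ps' e v = opr xs'' v"
        using Suc.prems(3) by (simp add: ps' xs'')
      show "\<exists>v\<in>V. comb ps' e v \<noteq> 0" using cv by (auto simp: ps')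
    qed
  qed
qed

end

context algebraic_difference_frobenius
begin

text \<open>In the regular case some \<open>d \<noteq> 0\<close> would satisfy
  \<open>act d v = f' (\<Psi> v) = 0\<close> on the infinite set \<open>T\<close>, against the
  finiteness of its kernel.\<close>

lemma right_annihilator:
  assumes \<Psi>: "\<Psi> \<in> R" "\<And>v. v \<in> T \<Longrightarrow> \<Psi> v = 0" and T: "infinite T" "T \<subseteq> V"
  obtains e where "e \<in> R" "\<exists>v\<in>V. e v \<noteq> 0" "\<And>v. v \<in> V \<Longrightarrow> \<Psi> (e v) = 0"
  using \<Psi>(1)
proof (cases rule: regular_or_zero_divisor)
  case (regular f' d)
  have "act d v = 0" if "v \<in> T" for v
    using regular(4)[of v] \<Psi>(2)[OF that] that T R_arg_0[OF regular(1)] by auto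
  then have "T \<subseteq> {v. act d v = 0}" by blast
  then show ?thesis using finite_act_kernel[OF regular(3)] T(1) finite_subset by blast
next
  case (zero_divisor g)
  then show ?thesis using that by blast
qed

text \<open>In the zero divisor case, divisibility of \<open>V\<close> gives \<open>g\<close> values
  of arbitrarily large order: if \<open>(t ^^ n) v' = v\<close> then
  \<open>(t ^^ n) (g v') = g v\<close>, which is nonzero. As \<open>y\<close> kills these values,
  \<open>uniserial\<close> would make it zero on \<open>V\<close>.\<close>

lemma Fq_linear_regular:
  assumes y: "y \<in> R" "\<exists>v\<in>V. y v \<noteq> 0"
    and lin: "\<And>c v. c \<in> Fq \<Longrightarrow> v \<in> V \<Longrightarrow> y (c * v) = c * y v"
  obtains f' d where "f' \<in> R" "d \<in> S" "d \<noteq> 0" "\<And>v. v \<in> V \<Longrightarrow> f' (y v) = act d v"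
  using y(1)
proof (cases rule: regular_or_zero_divisor)
  case (regular f' d)
  then show ?thesis using that by blast
next
  case (zero_divisor g)
  then obtain v where v: "v \<in> V" "g v \<noteq> 0" by blast
  have "y u = 0" if u: "u \<in> V" for u
  proof -
    obtain n where "(t ^^ n) u = 0" using u by (auto simp: V_def)
    then have n: "(t ^^ Suc n) u = 0" by (rule t_mono) simp
    obtain v' where v': "v' \<in> V" "(t ^^ n) v' = v" using V_t_surj[OF v(1)] by blast
    have "(t ^^ n) (g v') = g v"
      unfolding v'(2)[symmetric] t_funpow by (rule R_act[symmetric, OF zero_divisor(1)]) (intro S_power Xm1_S)
    then have nz: "(t ^^ n) (g v') \<noteq> 0" using v(2) by simp
    show ?thesis
    proof (rule uniserial[of y, OF R_arg_add[OF y(1)] lin _ R_V[OF zero_divisor(1) v'(1)] zero_divisor(3)[OF v'(1)] nz n])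
      show "y (t v) = t (y v)" for v
        using R_act[OF y(1) Xm1_S, of v] by (simp add: act_Xm1)
    qed
  qed
  then show ?thesis using y(2) by blast
qed

lemma combination_to_polynomial:
  assumes \<Psi>: "\<Psi> \<in> R" "\<And>v. v \<in> T \<Longrightarrow> \<Psi> v = 0" and T: "infinite T" "T \<subseteq> V"
  shows "\<exists>e\<in>R. \<exists>\<alpha>\<in>R. \<exists>ps d. set ps \<subseteq> Fq \<times> Fq \<and> d \<noteq> 0 \<and>
    (\<forall>v\<in>V. \<Psi> (e v) = 0 \<and> act d v = \<alpha> (comb ps e v))"
proof -
  obtain e where e: "e \<in> R" "\<exists>v\<in>V. e v \<noteq> 0" "\<And>v. v \<in> V \<Longrightarrow> \<Psi> (e v) = 0"
    using right_annihilator[OF assms] by blast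
  obtain xs where xs: "e = opr xs" "\<forall>(c, i, j)\<in>set xs. c \<in> Fq" using e(1) by (auto simp: R_def)
  have "\<exists>ps' i j. set ps' \<subseteq> Fq \<times> Fq \<and> (\<exists>v\<in>V. comb ps' e v \<noteq> 0) \<and>
    (\<forall>c\<in>Fq. \<forall>v\<in>V. comb ps' e (c * v) = (\<sigma> ^^ i) (c ^ (CHAR('a) ^ j)) * comb ps' e v)"
    by (rule semilinear_combination[of "[(1, 1)]" xs]) (use e xs in auto)
  then obtain ps i j where ps: "set ps \<subseteq> Fq \<times> Fq" "\<exists>v\<in>V. comb ps e v \<noteq> 0"
    "\<And>c v. c \<in> Fq \<Longrightarrow> v \<in> V \<Longrightarrow> comb ps e (c * v) = (\<sigma> ^^ i) (c ^ (CHAR('a) ^ j)) * comb ps e v"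
    by blast
  \<comment> \<open>A further \<open>\<sigma> ^^ i1\<close> and \<open>p ^ j1\<close>-th power
    complete the twist to \<open>\<sigma> ^^ (M * i)\<close> and the \<open>q ^ j\<close>-th power,
    which are trivial on \<open>Fq\<close>; the semilinear combination becomes
    \<open>Fq\<close>-linear.\<close>
  define i1 where "i1 = (M - 1) * i"
  define j1 where "j1 = (m - 1) * j"
  have i1: "i1 + i = M * i" and j1: "j + j1 = m * j"
    using M_pos m_pos by (auto simp: i1_def j1_def algebra_simps)
  define y where "y v = (\<sigma> ^^ i1) (comb ps e v ^ (CHAR('a) ^ j1))" for v
  have y_R: "y \<in> R"
    using R_mono_comp[OF comb_R[OF e(1) ps(1)] Fq_1, of i1 j1] by (simp add: y_def[abs_def])
  have y_nz: "\<exists>v\<in>V. y v \<noteq> 0"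
    using ps(2) by (auto simp: y_def \<sigma>_i_eq_0)
  have "y (c * v) = c * y v" if "c \<in> Fq" "v \<in> V" for c v
  proof -
    have "(\<sigma> ^^ i1) ((\<sigma> ^^ i) (c ^ (CHAR('a) ^ j)) ^ (CHAR('a) ^ j1)) =
        (\<sigma> ^^ (i1 + i)) (c ^ (CHAR('a) ^ (j + j1)))"
      by (simp add: funpow_add power_add power_mult \<sigma>_i_pow)
    also have "\<dots> = c"
      unfolding i1 j1 q_pow[symmetric] using that by (simp add: Fq_pow_q Fq_sigma_M)
    finally show ?thesis
      using ps(3)[OF that] by (simp add: y_def power_mult_distrib \<sigma>_i_mult)
  qed
  then obtain f' d where f': "f' \<in> R" "d \<noteq> 0" "\<And>v. v \<in> V \<Longrightarrow> f' (y v) = act d v"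
    using Fq_linear_regular[OF y_R y_nz] by blast
  define \<alpha> where "\<alpha> v = f' ((\<sigma> ^^ i1) (v ^ (CHAR('a) ^ j1)))" for v
  have "\<alpha> \<in> R"
    using R_comp[OF f'(1) R_mono[OF Fq_1, of i1 j1]] by (simp add: \<alpha>_def[abs_def])
  then show ?thesis using e(1,3) ps(1) f'(2,3)
    by (intro bexI[of _ e] bexI[of _ \<alpha>] exI[of _ ps] exI[of _ d]) (auto simp: \<alpha>_def y_def)
qed

end

context difference_frobenius
begin

text \<open>The outcome is stated in data that make sense in every extension: lists of monomials and
  an ordinary polynomial \<open>D\<close>. A point \<open>v\<close> is recovered, up to finitely
  many choices, from the points given by \<open>es\<close> at the arguments \<open>c * v\<close>: it
  is a root of \<open>D\<close> minus a value computed from them.\<close>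

lemma kernel_coordinates:
  fixes \<psi> :: "nat \<times> nat \<Rightarrow> 'a"
  defines "\<Psi> \<equiv> \<lambda>K v. \<Sum>(i, j)\<in>K. \<psi> (i, j) * (\<sigma> ^^ i) (v ^ (CHAR('a) ^ j))"
  assumes K: "finite K" "\<And>u. u \<in> K \<Longrightarrow> \<psi> u \<in> Fq \<and> \<psi> u \<noteq> 0"
    and \<psi>: "\<And>v. v \<in> T \<Longrightarrow> \<Psi> K v = 0"
    and T: "infinite T" "T \<subseteq> V"
  shows "\<exists>es \<alpha>s ps D. D \<noteq> 0 \<and> poly D 0 = 0 \<and> (\<forall>v\<in>V. (\<forall>(l, c)\<in>set ps. \<Psi> K (opr es (c * v)) = 0) \<and>
    poly D v = opr \<alpha>s (\<Sum>(l, c)\<leftarrow>ps. l * opr es (c * v)))"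
proof -
  have \<Psi>_R: "\<Psi> K \<in> R"
    unfolding \<Psi>_def case_prod_unfold using K by (intro R_sum R_mono) auto
  have "\<exists>e\<in>R. \<exists>\<alpha>\<in>R. \<exists>ps d. set ps \<subseteq> Fq \<times> Fq \<and> d \<noteq> 0 \<and>
    (\<forall>v\<in>V. \<Psi> K (e v) = 0 \<and> act d v = \<alpha> (comb ps e v))"
  proof (cases "K = {}")
    \<comment> \<open>An empty \<open>K\<close> means \<open>\<Psi> = 0\<close>: there is no
      relation to start from, but every point lies in the kernel and \<open>e\<close> can be the
      identity.\<close>
    case True
    then show ?thesis using R_id
      by (intro bexI[of _ "\<lambda>v. v"] exI[of _ "[(1, 1)]"] exI[of _ 1]) (auto simp: \<Psi>_def)
  next
    case False
    have "\<exists>\<delta> a. (\<forall>i. a i \<in> S) \<and> a \<delta> \<noteq> 0 \<and> (\<forall>v\<in>V. (\<Sum>i\<le>\<delta>. act (a i) ((\<sigma> ^^ (M * i)) v)) = 0)"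
      by (rule algebraic_relation[OF K(1) False K(2) \<psi>[unfolded \<Psi>_def] T])
    then obtain \<delta> a where "(\<forall>i. a i \<in> S) \<and> a \<delta> \<noteq> 0 \<and>
        (\<forall>v\<in>V. (\<Sum>i\<le>\<delta>. act (a i) ((\<sigma> ^^ (M * i)) v)) = 0)"
      by (elim exE)
    then interpret algebraic_difference_frobenius \<sigma> m M \<delta> a
      by unfold_locales auto
    show ?thesis by (rule combination_to_polynomial[OF \<Psi>_R \<psi> T])
  qed
  then obtain e \<alpha> ps d where e: "e \<in> R" and \<alpha>: "\<alpha> \<in> R" and ps: "set ps \<subseteq> Fq \<times> Fq" and d: "d \<noteq> 0"
    and eq: "\<And>v. v \<in> V \<Longrightarrow> \<Psi> K (e v) = 0 \<and> act d v = \<alpha> (comb ps e v)"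
    by blast
  obtain es \<alpha>s where es: "e = opr es" "\<alpha> = opr \<alpha>s" using e \<alpha> by (auto simp: R_def)
  \<comment> \<open>The additive polynomial with values \<open>act d\<close>. It has no constant
    term, which later excludes that \<open>D\<close> is constant.\<close>
  let ?D = "\<Sum>j\<le>degree d. monom (coeff d j) (q ^ j)"
  have D: "poly ?D v = act d v" for v by (simp add: poly_sum poly_monom act_def)
  have "?D \<noteq> 0"
  proof
    assume "?D = 0"
    then have "act d v = 0" for v unfolding D[symmetric] by simp
    then have "V \<subseteq> {v. act d v = 0}" by blast
    then show False using finite_act_kernel[OF d] infinite_V finite_subset by blast
  qed
  moreover have "\<Psi> K (opr es (c * v)) = 0" if "v \<in> V" "(l, c) \<in> set ps" for v l c
    using eq[of "c * v"] that ps Fq_subset_V by (auto simp: es intro!: V_mult)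
  ultimately show ?thesis
    using eq D D[of 0] by (intro exI[of _ es] exI[of _ \<alpha>s] exI[of _ ps] exI[of _ ?D]) (auto simp: es comb_def)
qed

end

section \<open>Difference-algebraic closure and lines\<close>

text \<open>The carrier-based notions behind \<open>acl\<close> are translated into type-class
  polynomials, in which all equations below are written.\<close>

definition algebraic_over :: "'u::field set \<Rightarrow> 'u \<Rightarrow> bool" where
  "algebraic_over K x \<longleftrightarrow> (\<exists>p. p \<noteq> 0 \<and> (\<forall>i. coeff p i \<in> K) \<and> poly p x = 0)"

definition closed_subfield :: "'u::field set \<Rightarrow> bool" where
  "closed_subfield K \<longleftrightarrow> 1 \<in> K \<and> (\<forall>x\<in>K. - x \<in> K) \<and> (\<forall>x\<in>K. \<forall>y\<in>K. x * y \<in> K) \<and>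
     (\<forall>x\<in>K. \<forall>y\<in>K. x + y \<in> K) \<and> (\<forall>x\<in>K. inverse x \<in> K)"

lemma ring_of_type_algebra_simps [simp]:
  "carrier (ring_of_type_algebra :: 'u::field ring) = UNIV"
  "monoid.mult (ring_of_type_algebra :: 'u ring) x y = x * y"
  "ring.add (ring_of_type_algebra :: 'u ring) x y = x + y"
  "monoid.one (ring_of_type_algebra :: 'u ring) = 1"
  "ring.zero (ring_of_type_algebra :: 'u ring) = 0"
  by (simp_all add: ring_of_type_algebra_def)

lemma nat_pow_ring_of_type_algebra [simp]: "x [^]\<^bsub>ring_of_type_algebra\<^esub> n = (x :: 'u::field) ^ (n :: nat)"
  by (induction n) (auto simp: nat_pow_def)

lemma a_inv_ring_of_type_algebra [simp]: "a_inv (ring_of_type_algebra :: 'u::field ring) x = - x"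
proof -
  interpret Ring.field "ring_of_type_algebra :: 'u ring" by rule
  show ?thesis by (rule minus_equality) auto
qed

lemma m_inv_ring_of_type_algebra: "x \<noteq> 0 \<Longrightarrow> m_inv (ring_of_type_algebra :: 'u::field ring) x = inverse x"
proof -
  assume x: "x \<noteq> 0"
  interpret Ring.field "ring_of_type_algebra :: 'u ring" by rule
  show ?thesis by (rule comm_inv_char) (use x in auto)
qed

lemma subfield_ring_of_type_algebra: "subfield K (ring_of_type_algebra :: 'u::field ring) \<longleftrightarrow> closed_subfield K"
proof
  interpret Ring.field "ring_of_type_algebra :: 'u ring" by rule
  show "subfield K (ring_of_type_algebra :: 'u ring)" if K: "closed_subfield K"
    by (rule subfieldI'[OF subringI]) (use K in \<open>auto simp: closed_subfield_def m_inv_ring_of_type_algebra\<close>)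
  show "closed_subfield K" if K: "subfield K (ring_of_type_algebra :: 'u ring)"
  proof -
    note sub = subringE[OF subfieldE(1)[OF K]]
    have "inverse x \<in> K" if "x \<in> K" for x
      using subfield_m_inv(1)[OF K, of x] that sub(2) by (cases "x = 0") (auto simp: m_inv_ring_of_type_algebra)
    then show ?thesis using sub by (auto simp: closed_subfield_def)
  qed
qed

lemma closed_subfieldD:
  assumes "closed_subfield K"
  shows "1 \<in> K" "0 \<in> K" "x \<in> K \<Longrightarrow> - x \<in> K" "x \<in> K \<Longrightarrow> y \<in> K \<Longrightarrow> x * y \<in> K"
    "x \<in> K \<Longrightarrow> y \<in> K \<Longrightarrow> x + y \<in> K" "x \<in> K \<Longrightarrow> y \<in> K \<Longrightarrow> x - y \<in> K"
    "x \<in> K \<Longrightarrow> inverse x \<in> K" "x \<in> K \<Longrightarrow> y \<in> K \<Longrightarrow> x / y \<in> K" "x \<in> K \<Longrightarrow> x ^ n \<in> K"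
proof -
  note K = assms[unfolded closed_subfield_def]
  have k_uminus: "x \<in> K \<Longrightarrow> - x \<in> K"
    and k_mult: "x \<in> K \<Longrightarrow> y \<in> K \<Longrightarrow> x * y \<in> K"
    and k_add: "x \<in> K \<Longrightarrow> y \<in> K \<Longrightarrow> x + y \<in> K"
    and k_inv: "x \<in> K \<Longrightarrow> inverse x \<in> K" for x y using K by auto
  show "1 \<in> K" using K by blast
  show "x \<in> K \<Longrightarrow> - x \<in> K" by (rule k_uminus)
  show "x \<in> K \<Longrightarrow> y \<in> K \<Longrightarrow> x * y \<in> K" by (rule k_mult)
  show "x \<in> K \<Longrightarrow> y \<in> K \<Longrightarrow> x + y \<in> K" by (rule k_add)
  show "x \<in> K \<Longrightarrow> inverse x \<in> K" by (rule k_inv)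
  have "1 + (- 1) \<in> K" using K by blast
  then show "0 \<in> K" by simp
  show "x \<in> K \<Longrightarrow> y \<in> K \<Longrightarrow> x - y \<in> K" using k_add[of x "- y"] k_uminus[of y] by simp
  show "x \<in> K \<Longrightarrow> y \<in> K \<Longrightarrow> x / y \<in> K" using k_mult[of x "inverse y"] k_inv[of y] by (simp add: divide_inverse)
  show "x \<in> K \<Longrightarrow> x ^ n \<in> K" using K by (induction n) auto
qed

lemma closed_subfield_sum:
  "closed_subfield K \<Longrightarrow> (\<And>i. i \<in> A \<Longrightarrow> f i \<in> K) \<Longrightarrow> sum f A \<in> K"
  by (induction A rule: infinite_finite_induct) (auto intro: closed_subfieldD)

text \<open>List polynomials with a carrier start with the leading coefficient, \<open>Poly\<close>
  with the constant one; hence the reversal.\<close>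

lemma eval_ring_of_type_algebra: "ring.eval (ring_of_type_algebra :: 'u::field ring) p x = poly (Poly (rev p)) x"
proof -
  interpret Ring.field "ring_of_type_algebra :: 'u ring" by rule
  show ?thesis
    by (induction p) (auto simp: Poly_append poly_monom)
qed

lemma algebraic_ring_of_type_algebra:
  assumes "closed_subfield K"
  shows "ring.algebraic ring_of_type_algebra K (x::'u::field) \<longleftrightarrow> algebraic_over K x"
proof
  interpret Ring.field "ring_of_type_algebra :: 'u ring" by rule
  have K: "subring K (ring_of_type_algebra :: 'u ring)"
    using assms subfieldE(1) by (simp flip: subfield_ring_of_type_algebra)
  show "algebraic_over K x" if "algebraic K x"
  proof -
    have "(algebraic over K) x" using that by (simp add: over_def)
    then obtain p where p: "p \<in> carrier (univ_poly ring_of_type_algebra K)" "p \<noteq> []" "eval p x = 0"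
      using algebraicE[OF K, of x] by auto
    then have pol: "set p \<subseteq> K" "hd p \<noteq> 0" by (auto simp: univ_poly_def polynomial_def)
    have "Polynomial.coeff (Poly (rev p)) (length p - 1) = hd p"
      using p(2) by (simp add: nth_default_def rev_nth hd_conv_nth)
    then have "Polynomial.coeff (Poly (rev p)) (length p - 1) \<noteq> 0" using pol by (simp only: not_False_eq_True)
    then have "Poly (rev p) \<noteq> 0" by (metis coeff_0)
    moreover have "Polynomial.coeff (Poly (rev p)) i \<in> K" for i
      using pol(1) closed_subfieldD(2)[OF assms] nth_mem[of i "rev p"]
      by (auto simp: nth_default_def)
    ultimately show ?thesis using p(3) unfolding algebraic_over_def eval_ring_of_type_algebra by blast
  qed
  show "algebraic K x" if alg: "algebraic_over K x"
  proof -
    obtain p where p: "p \<noteq> 0" "\<And>i. Polynomial.coeff p i \<in> K" "poly p x = 0"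
      using alg by (auto simp: algebraic_over_def)
    have "(algebraic over K) x"
    proof (rule algebraicI[of "rev (coeffs p)"])
      have "set (coeffs p) \<subseteq> K" using p(2) by (auto simp: coeffs_def)
      then show "rev (coeffs p) \<in> carrier (univ_poly ring_of_type_algebra K)"
        using p(1) by (auto simp: univ_poly_def polynomial_def hd_rev last_coeffs_eq_coeff_degree)
    qed (use p in \<open>auto simp: eval_ring_of_type_algebra\<close>)
    then show ?thesis by (simp add: over_def)
  qed
qed

lemma algebraic_closed_subfield:
  assumes "closed_subfield K"
  shows "closed_subfield {x. algebraic_over K x}"
proof -
  interpret Ring.field "ring_of_type_algebra :: 'a ring" by rule
  have "subfield {x. algebraic K x} ring_of_type_algebra"
    using subfield_of_algebraics[of K] assms by (simp add: subfield_ring_of_type_algebra over_def)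
  then show ?thesis by (simp add: subfield_ring_of_type_algebra algebraic_ring_of_type_algebra[OF assms])
qed

text \<open>The coefficients of an equation for \<open>x\<close> generate a finite extension
  \<open>F\<close> of \<open>K\<close>, and adjoining \<open>x\<close> to \<open>F\<close> keeps the
  degree over \<open>K\<close> finite.\<close>

lemma algebraic_over_trans:
  assumes K: "closed_subfield K" and x: "algebraic_over {y. algebraic_over K y} x"
  shows "algebraic_over K x"
proof -
  interpret Ring.field "ring_of_type_algebra :: 'a ring" by rule
  have sK: "subfield K ring_of_type_algebra" using K by (simp add: subfield_ring_of_type_algebra)
  obtain p where p: "p \<noteq> 0" "\<And>i. algebraic_over K (Polynomial.coeff p i)" "poly p x = 0"
    using x by (auto simp: algebraic_over_def[of "Collect _"])
  define xs where "xs = coeffs p"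
  have alg: "(algebraic over K) y" if "y \<in> set xs" for y
    using that p(1,2) by (auto simp: xs_def coeffs_def over_def algebraic_ring_of_type_algebra[OF K])
  define F where "F = finite_extension K xs"
  have F: "subfield F ring_of_type_algebra"
    unfolding F_def by (rule finite_extension_is_subfield[OF sK]) (use alg in auto)
  then have F': "closed_subfield F" by (simp add: subfield_ring_of_type_algebra)
  have "set xs \<subseteq> F"
    unfolding F_def by (rule finite_extension_mem[OF subfieldE(1)[OF sK]]) simp
  then have "Polynomial.coeff p i \<in> F" for i
    using closed_subfieldD(2)[OF F'] coeff_in_coeffs[OF p(1), of i]
    by (cases "i \<le> Polynomial.degree p") (auto simp: xs_def coeff_eq_0)
  then have "algebraic_over F x" using p by (auto simp: algebraic_over_def)
  then have "(algebraic over F) x" by (simp add: over_def algebraic_ring_of_type_algebra[OF F'])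
  then have "finite_dimension F (simple_extension F x)"
    using finite_dimension_simple_extension[OF F] by simp
  moreover have "finite_dimension K F"
    unfolding F_def by (rule finite_extension_finite_dimension(1)[OF sK]) (use alg in auto)
  ultimately have "finite_dimension K (simple_extension F x)"
    using telescopic_base_dim(1)[OF sK F] by blast
  then have "(algebraic over K) x"
    using finite_dimension_imp_algebraic[OF sK simple_extension_is_subring[OF subfieldE(1)[OF F]]]
      simple_extension_mem[OF subfieldE(1)[OF F]] by auto
  then show ?thesis by (simp add: over_def algebraic_ring_of_type_algebra[OF K])
qed

lemma algebraic_over_mono: "algebraic_over K x \<Longrightarrow> K \<subseteq> L \<Longrightarrow> algebraic_over L x"
  unfolding algebraic_over_def by blast

lemma algebraic_over_self: "closed_subfield K \<Longrightarrow> x \<in> K \<Longrightarrow> algebraic_over K x"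
  unfolding algebraic_over_def
  by (rule exI[of _ "[:- x, 1:]"]) (auto simp: coeff_pCons closed_subfieldD split: nat.split)

definition sgen :: "('u::field \<Rightarrow> 'u) \<Rightarrow> 'u set \<Rightarrow> 'u set" where
  "sgen \<tau> B = \<Inter>{F. subfield F ring_of_type_algebra \<and> B \<subseteq> F \<and> \<tau> ` F \<subseteq> F \<and> inv_into UNIV \<tau> ` F \<subseteq> F}"

lemma sgen_closed_subfield: "closed_subfield (sgen \<tau> B)"
  unfolding sgen_def subfield_ring_of_type_algebra closed_subfield_def[of "\<Inter> _"]
  by (auto intro: closed_subfieldD(1,3,4,5,7))

lemma sgen_incl: "B \<subseteq> sgen \<tau> B"
  and sgen_\<tau>: "x \<in> sgen \<tau> B \<Longrightarrow> \<tau> x \<in> sgen \<tau> B"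
  and sgen_inv_\<tau>: "x \<in> sgen \<tau> B \<Longrightarrow> inv_into UNIV \<tau> x \<in> sgen \<tau> B"
  unfolding sgen_def by blast+

lemma sgen_least:
  "closed_subfield F \<Longrightarrow> B \<subseteq> F \<Longrightarrow> (\<And>x. x \<in> F \<Longrightarrow> \<tau> x \<in> F) \<Longrightarrow>
    (\<And>x. x \<in> F \<Longrightarrow> inv_into UNIV \<tau> x \<in> F) \<Longrightarrow> sgen \<tau> B \<subseteq> F"
  unfolding sgen_def subfield_ring_of_type_algebra by blast

lemma sgen_subset: "B \<subseteq> sgen \<tau> B' \<Longrightarrow> sgen \<tau> B \<subseteq> sgen \<tau> B'"
  by (rule sgen_least) (auto simp: sgen_closed_subfield sgen_\<tau> sgen_inv_\<tau>)

lemma acl_iff: "x \<in> acl \<tau> B \<longleftrightarrow> algebraic_over (sgen \<tau> B) x"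
  unfolding acl_def sgen_def[symmetric] using algebraic_ring_of_type_algebra[OF sgen_closed_subfield] by blast

lemma acl_eq: "acl \<tau> B = {x. algebraic_over (sgen \<tau> B) x}"
  by (auto simp: acl_iff)

lemma acl_closed_subfield: "closed_subfield (acl \<tau> B)"
  unfolding acl_eq by (rule algebraic_closed_subfield[OF sgen_closed_subfield])

lemma sgen_subset_acl: "sgen \<tau> B \<subseteq> acl \<tau> B"
  by (auto simp: acl_iff intro!: algebraic_over_self[OF sgen_closed_subfield])

lemma acl_incl: "B \<subseteq> acl \<tau> B"
  using sgen_incl sgen_subset_acl by blast

lemma acl_algebraic: "algebraic_over (acl \<tau> B) x \<Longrightarrow> x \<in> acl \<tau> B"
  unfolding acl_iff unfolding acl_eq by (rule algebraic_over_trans[OF sgen_closed_subfield])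

lemma acl_mono: "B \<subseteq> sgen \<tau> B' \<Longrightarrow> acl \<tau> B \<subseteq> acl \<tau> B'"
  unfolding acl_eq by (intro Collect_mono impI) (rule algebraic_over_mono, assumption, rule sgen_subset)

section \<open>Dependent points on a line\<close>

lemma coeff_linear_power_top:
  fixes c \<mu> :: "'u::field"
  shows "coeff ([:c, \<mu>:] ^ b) b = \<mu> ^ b" "b < n \<Longrightarrow> coeff ([:c, \<mu>:] ^ b) n = 0"
proof (induction b arbitrary: n)
  case (Suc b)
  {
    case 1
    show ?case by (simp add: Suc)
  next
    case 2
    then show ?case by (cases n) (simp_all add: Suc)
  }
qed (auto simp: coeff_1)

lemma mpoly_value_superset:
  assumes "finite A" "Poly_Mapping.keys P \<subseteq> A"
  shows "mpoly_value P = (\<Sum>m\<in>A. Poly_Mapping.lookup P m *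
    (\<Prod>s\<in>Poly_Mapping.keys m. s ^ Poly_Mapping.lookup m s))"
  unfolding mpoly_value_def
  by (rule sum.mono_neutral_left) (use assms in \<open>auto simp: in_keys_iff\<close>)

text \<open>
  An equation \<open>h(x, \<mu> x + c) = 0\<close> with \<open>x\<close> transcendental over a field containing \<open>\<mu>\<close> and \<open>c\<close>
  holds identically in \<open>x\<close>; its top homogeneous part is an equation for \<open>\<mu>\<close> over the
  coefficient field of \<open>h\<close>.
\<close>
lemma slope_algebraic:
  fixes x y \<mu> c :: "'u::field" and h :: "('u \<Rightarrow>\<^sub>0 nat) \<Rightarrow>\<^sub>0 'u"
  assumes C: "closed_subfield C" and B: "closed_subfield B" and "C \<subseteq> B"
    and \<mu>: "\<mu> \<in> B" "c \<in> B" and x: "\<not> algebraic_over B x" and xy: "y = \<mu> * x + c" "x \<noteq> y"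
    and h: "\<And>m. Poly_Mapping.lookup h m \<in> C" "\<And>m. m \<in> Poly_Mapping.keys h \<Longrightarrow> Poly_Mapping.keys m \<subseteq> {x, y}"
      "mpoly_value h = 0" "h \<noteq> 0"
  shows "algebraic_over C \<mu>"
proof -
  define ex where "ex m = Poly_Mapping.lookup m x" for m :: "'u \<Rightarrow>\<^sub>0 nat"
  define ey where "ey m = Poly_Mapping.lookup m y" for m :: "'u \<Rightarrow>\<^sub>0 nat"
  define co where "co = Poly_Mapping.lookup h"
  let ?K = "Poly_Mapping.keys h"
  \<comment> \<open>\<open>H\<close> is \<open>h(X, \<mu> X + c)\<close> as a polynomial in
    \<open>X\<close> over \<open>B\<close>. It vanishes at \<open>x\<close>, which is transcendental
    over \<open>B\<close>, and so is zero.\<close>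
  define H where "H = (\<Sum>m\<in>?K. smult (co m) (monom 1 (ex m) * [:c, \<mu>:] ^ ey m))"
  have "poly H x = mpoly_value h"
    unfolding H_def mpoly_value_def poly_sum
  proof (rule sum.cong[OF refl])
    fix m assume m: "m \<in> ?K"
    have "(\<Prod>s\<in>Poly_Mapping.keys m. s ^ Poly_Mapping.lookup m s) = (\<Prod>s\<in>{x, y}. s ^ Poly_Mapping.lookup m s)"
      by (rule prod.mono_neutral_left) (use h(2)[OF m] in \<open>auto simp: in_keys_iff\<close>)
    also have "\<dots> = x ^ ex m * y ^ ey m" using xy(2) by (simp add: ex_def ey_def)
    finally show "poly (smult (co m) (monom 1 (ex m) * [:c, \<mu>:] ^ ey m)) x =
        Poly_Mapping.lookup h m * (\<Prod>s\<in>Poly_Mapping.keys m. s ^ Poly_Mapping.lookup m s)"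
      by (simp add: poly_monom co_def xy(1) algebra_simps)
  qed
  then have "poly H x = 0" using h(3) by simp
  moreover have "coeff H i \<in> B" for i
  proof -
    have "coeff ([:c, \<mu>:] ^ b) n \<in> B" for b n
    proof (induction b arbitrary: n)
      case 0
      then show ?case by (auto simp: coeff_1 closed_subfieldD[OF B])
    next
      case (Suc b)
      show ?case by (cases n) (auto simp: Suc \<mu> intro!: closed_subfieldD[OF B])
    qed
    then have *: "coeff (monom 1 a * [:c, \<mu>:] ^ b) n \<in> B" for a b n
      by (auto simp: coeff_monom_mult closed_subfieldD[OF B])
    then show ?thesis
      unfolding H_def coeff_sum coeff_smult
      using h(1) \<open>C \<subseteq> B\<close> by (intro closed_subfield_sum B closed_subfieldD(4)[OF B]) (auto simp: co_def)
  qed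
  ultimately have "H = 0" using x unfolding algebraic_over_def by blast
  define dg where "dg m = ex m + ey m" for m
  define D where "D = Max (dg ` ?K)"
  have K_ne: "?K \<noteq> {}" using h(4) by simp
  have dg_le: "dg m \<le> D" if "m \<in> ?K" for m unfolding D_def using that by simp
  have "D \<in> dg ` ?K" unfolding D_def using K_ne by (intro Max_in) auto
  then obtain m0 where m0: "m0 \<in> ?K" "dg m0 = D" by blast
  \<comment> \<open>\<open>G(T)\<close> is the part of \<open>h\<close> of top total degree at
    \<open>(1, T)\<close>. The constant \<open>c\<close> only contributes to lower powers of
    \<open>X\<close>, so the coefficient of \<open>X^D\<close> in \<open>H\<close> is
    \<open>G(\<mu>)\<close>.\<close>
  define G where "G = (\<Sum>m\<in>{m \<in> ?K. dg m = D}. monom (co m) (ey m))"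
  have "coeff H D = (\<Sum>m\<in>?K. if dg m = D then co m * \<mu> ^ ey m else 0)"
    unfolding H_def coeff_sum
  proof (rule sum.cong[OF refl])
    fix m assume "m \<in> ?K"
    then have "ex m + ey m \<le> D" using dg_le by (simp add: dg_def)
    then consider "dg m = D" "D = ex m + ey m" | "dg m \<noteq> D" "ey m < D - ex m" "ex m \<le> D"
      by (cases "dg m = D") (auto simp: dg_def)
    then show "coeff (smult (co m) (monom 1 (ex m) * [:c, \<mu>:] ^ ey m)) D =
        (if dg m = D then co m * \<mu> ^ ey m else 0)"
    proof cases
      case 1
      then show ?thesis by (simp add: coeff_monom_mult coeff_linear_power_top(1))
    next
      case 2
      then show ?thesis by (simp add: coeff_monom_mult coeff_linear_power_top(2))
    qed
  qed
  also have "\<dots> = poly G \<mu>"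
    unfolding G_def poly_sum poly_monom by (rule sum.inter_filter[symmetric]) simp
  finally have "poly G \<mu> = 0" using \<open>H = 0\<close> by simp
  moreover have "coeff G i \<in> C" for i
    unfolding G_def coeff_sum by (intro closed_subfield_sum[OF C]) (auto simp: co_def h(1) closed_subfieldD[OF C])
  moreover have "G \<noteq> 0"
  proof -
    have "coeff G (ey m0) = (\<Sum>m\<in>{m \<in> ?K. dg m = D}. if m = m0 then co m0 else 0)"
      unfolding G_def coeff_sum
    proof (rule sum.cong[OF refl])
      fix m assume m: "m \<in> {m \<in> ?K. dg m = D}"
      \<comment> \<open>Among monomials of the same total degree in \<open>x\<close> and
        \<open>y\<close> the exponent of \<open>y\<close> determines the monomial, so no two
        coefficients of \<open>h\<close> merge in \<open>G\<close>.\<close>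
      have "m = m0" if "ey m = ey m0"
      proof (rule poly_mapping_eqI)
        fix s
        have "Poly_Mapping.keys m \<subseteq> {x, y}" "Poly_Mapping.keys m0 \<subseteq> {x, y}" using h(2) m m0 by auto
        moreover have "ex m = ex m0" using that m m0 by (auto simp: dg_def)
        moreover have "Poly_Mapping.lookup m' s = 0" if "Poly_Mapping.keys m' \<subseteq> {x, y}" "s \<noteq> x" "s \<noteq> y"
          for m' :: "'u \<Rightarrow>\<^sub>0 nat"
          using that by (metis in_keys_iff insertE singletonD subsetD)
        ultimately show "Poly_Mapping.lookup m s = Poly_Mapping.lookup m0 s"
          using that by (cases "s = x"; cases "s = y") (auto simp: ex_def ey_def)
      qed
      then show "coeff (monom (co m) (ey m)) (ey m0) = (if m = m0 then co m0 else 0)" by auto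
    qed
    also have "\<dots> = co m0" using m0 by simp
    finally have "coeff G (ey m0) \<noteq> 0" using m0(1) by (simp add: co_def in_keys_iff)
    then show ?thesis by auto
  qed
  ultimately show ?thesis unfolding algebraic_over_def by blast
qed

text \<open>\<open>Y - \<mu> X - c\<close> is a nontrivial relation. As \<open>mpoly_value\<close>
  uses field elements as the names of the variables, \<open>x \<noteq> y\<close> is what makes
  \<open>X\<close> and \<open>Y\<close> two variables.\<close>

lemma line_not_alg_indep:
  fixes x y \<mu> c :: "'u::field"
  assumes B: "closed_subfield B" and \<mu>: "\<mu> \<in> B" "c \<in> B" and xy: "y = \<mu> * x + c" "x \<noteq> y"
  shows "\<not> alg_indep B {x, y}"
proof -
  let ?mx = "Poly_Mapping.single x (1::nat)" and ?my = "Poly_Mapping.single y (1::nat)"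
  define P where "P = Poly_Mapping.single ?my 1 + Poly_Mapping.single ?mx (- \<mu>) + Poly_Mapping.single 0 (- c)"
  have neq: "?mx \<noteq> ?my" "?mx \<noteq> 0" "?my \<noteq> 0"
    using xy(2) by (metis lookup_single_eq lookup_single_not_eq zero_neq_one)
      (metis lookup_single_eq lookup_zero zero_neq_one)+
  have look: "Poly_Mapping.lookup P m = (if m = ?my then 1 else if m = ?mx then - \<mu> else if m = 0 then - c else 0)" for m
    using neq by (auto simp: P_def lookup_add lookup_single when_def)
  have keys: "Poly_Mapping.keys P \<subseteq> {?mx, ?my, 0}"
    by (auto simp: in_keys_iff look split: if_splits)
  have "mpoly_value P = - \<mu> * x + y - c"
    using neq by (subst mpoly_value_superset[OF _ keys]) (auto simp: look)
  then have "mpoly_value P = 0" using xy by simp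
  moreover have "P \<noteq> 0" using look[of ?my] by auto
  moreover have "Poly_Mapping.lookup P m \<in> B" for m
    using \<mu> by (auto simp: look closed_subfieldD[OF B])
  moreover have "Poly_Mapping.keys m \<subseteq> {x, y}" if "m \<in> Poly_Mapping.keys P" for m
    using keys that by auto
  ultimately show ?thesis unfolding alg_indep_def by blast
qed

text \<open>
  The failure of modularity: the line through a generic point \<open>(x, y)\<close> is not determined by what
  it shares with the point.
\<close>
lemma line_not_free:
  assumes A: "closed_subfield A" and "x \<in> A" "y \<in> A" "\<mu> \<notin> A"
    and acl: "\<And>z. algebraic_over A z \<Longrightarrow> z \<in> A" "\<And>z. algebraic_over B z \<Longrightarrow> z \<in> B"
    and B: "closed_subfield B" "\<mu> \<in> B" "c \<in> B" "x \<notin> B" and y: "y = \<mu> * x + c"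
  shows "\<not> free_over (A \<inter> B) A B"
proof
  assume free: "free_over (A \<inter> B) A B"
  have "1 - \<mu> \<noteq> 0" using assms closed_subfieldD(1)[OF A] by auto
  \<comment> \<open>If they were equal, \<open>x\<close> would be \<open>c / (1 - \<mu>)\<close>, a
    point of \<open>B\<close>; here \<open>\<mu> \<noteq> 1\<close> because \<open>1\<close> lies in
    \<open>A\<close>.\<close>
  have "x \<noteq> y"
  proof
    assume "x = y"
    then have "x * (1 - \<mu>) = c" using y by (simp add: algebra_simps)
    then have "x = c / (1 - \<mu>)" using \<open>1 - \<mu> \<noteq> 0\<close> by (simp add: nonzero_eq_divide_eq)
    then show False using B closed_subfieldD[OF B(1)] by auto
  qed
  then have "\<not> alg_indep B {x, y}" using line_not_alg_indep[OF B(1-3) y] by simp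
  then have "\<not> alg_indep (A \<inter> B) {x, y}"
    using free \<open>x \<in> A\<close> \<open>y \<in> A\<close> unfolding free_over_def by (metis empty_subsetI finite.emptyI finite.insertI insert_subset)
  then obtain h where h: "\<And>m. Poly_Mapping.lookup h m \<in> A \<inter> B"
      "\<And>m. m \<in> Poly_Mapping.keys h \<Longrightarrow> Poly_Mapping.keys m \<subseteq> {x, y}"
      "mpoly_value h = 0" "h \<noteq> 0"
    unfolding alg_indep_def by blast
  have C: "closed_subfield (A \<inter> B)" using A B(1) unfolding closed_subfield_def by blast
  have "algebraic_over (A \<inter> B) \<mu>"
    by (rule slope_algebraic[OF C B(1) _ B(2,3) _ y \<open>x \<noteq> y\<close> h]) (use acl B in auto)
  then have "\<mu> \<in> A" using acl(1) algebraic_over_mono by blast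
  then show False using \<open>\<mu> \<notin> A\<close> by simp
qed

section \<open>Formulas and saturation\<close>

abbreviation ev :: "('u::field \<Rightarrow> 'u) \<Rightarrow> ('p \<Rightarrow> 'u) \<Rightarrow> (nat \<Rightarrow> 'u) \<Rightarrow> 'p dterm \<Rightarrow> 'u" where
  "ev \<equiv> eval_tm ring_of_type_algebra"

abbreviation sats :: "('u::field \<Rightarrow> 'u) \<Rightarrow> ('p \<Rightarrow> 'u) \<Rightarrow> 'p dform \<Rightarrow> (nat \<Rightarrow> 'u) \<Rightarrow> bool" where
  "sats \<equiv> sat ring_of_type_algebra"

primrec tsubst :: "(nat \<Rightarrow> 'p dterm) \<Rightarrow> 'p dterm \<Rightarrow> 'p dterm" where
  "tsubst s (TVar n) = s n"
| "tsubst s (TParam c) = TParam c"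
| "tsubst s TZero = TZero"
| "tsubst s TOne = TOne"
| "tsubst s (TPlus t u) = TPlus (tsubst s t) (tsubst s u)"
| "tsubst s (TTimes t u) = TTimes (tsubst s t) (tsubst s u)"
| "tsubst s (TNeg t) = TNeg (tsubst s t)"
| "tsubst s (TSig t) = TSig (tsubst s t)"

text \<open>Only used for quantifier-free formulas: bound variables are not renamed.\<close>
primrec fsubst :: "(nat \<Rightarrow> 'p dterm) \<Rightarrow> 'p dform \<Rightarrow> 'p dform" where
  "fsubst s (FEqual t u) = FEqual (tsubst s t) (tsubst s u)"
| "fsubst s (FNot \<phi>) = FNot (fsubst s \<phi>)"
| "fsubst s (FAnd \<phi> \<psi>) = FAnd (fsubst s \<phi>) (fsubst s \<psi>)"
| "fsubst s (FEx n \<phi>) = FEx n \<phi>"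

primrec tpow :: "'p dterm \<Rightarrow> nat \<Rightarrow> 'p dterm" where
  "tpow t 0 = TOne"
| "tpow t (Suc n) = TTimes t (tpow t n)"

definition tsum :: "'p dterm list \<Rightarrow> 'p dterm" where
  "tsum ts = foldr TPlus ts TZero"

definition topf :: "('a::field \<times> nat \<times> nat) list \<Rightarrow> 'a dterm \<Rightarrow> 'a dterm" where
  "topf xs t = tsum (map (\<lambda>(c, i, j). TTimes (TParam c) ((TSig ^^ i) (tpow t (CHAR('a) ^ j)))) xs)"

definition tpoly :: "nat \<Rightarrow> (nat \<Rightarrow> 'p dterm) \<Rightarrow> 'p dterm \<Rightarrow> 'p dterm" where
  "tpoly n ts t = tsum (map (\<lambda>i. TTimes (ts i) (tpow t i)) [0..<Suc n])"

lemma ev_tsubst: "ev \<tau> j v (tsubst s t) = ev \<tau> j (\<lambda>n. ev \<tau> j v (s n)) t"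
  by (induction t) auto

lemma sat_fsubst: "qfree \<phi> \<Longrightarrow> sats \<tau> j (fsubst s \<phi>) v = sats \<tau> j \<phi> (\<lambda>n. ev \<tau> j v (s n))"
  by (induction \<phi>) (auto simp: ev_tsubst)

lemma fv_tsubst: "fv_tm (tsubst s t) = (\<Union>n\<in>fv_tm t. fv_tm (s n))"
  by (induction t) auto

lemma fv_fsubst: "qfree \<phi> \<Longrightarrow> fv (fsubst s \<phi>) = (\<Union>n\<in>fv \<phi>. fv_tm (s n))"
  by (induction \<phi>) (auto simp: fv_tsubst)

lemma qfree_fsubst: "qfree \<phi> \<Longrightarrow> qfree (fsubst s \<phi>)"
  by (induction \<phi>) auto

lemma params_tsubst: "params_tm (tsubst s t) \<subseteq> params_tm t \<union> (\<Union>n. params_tm (s n))"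
  by (induction t) auto

lemma params_fsubst: "params (fsubst s \<phi>) \<subseteq> params \<phi> \<union> (\<Union>n. params_tm (s n))"
proof (induction \<phi>)
  case (FEqual t u)
  then show ?case using params_tsubst[of s t] params_tsubst[of s u] by auto
qed auto

lemma ev_coincidence: "(\<And>n. n \<in> fv_tm t \<Longrightarrow> v n = w n) \<Longrightarrow> ev \<tau> j v t = ev \<tau> j w t"
  by (induction t) auto

lemma sat_coincidence: "(\<And>n. n \<in> fv \<phi> \<Longrightarrow> v n = w n) \<Longrightarrow> sats \<tau> j \<phi> v = sats \<tau> j \<phi> w"
proof (induction \<phi> arbitrary: v w)
  case (FEqual t u)
  then show ?case using ev_coincidence[of t v w] ev_coincidence[of u v w] by simp
next
  case (FNot \<phi>)
  from FNot.IH[of v w] FNot.prems show ?case by simp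
next
  case (FAnd \<phi> \<psi>)
  from FAnd.IH(1)[of v w] FAnd.IH(2)[of v w] FAnd.prems show ?case by simp
next
  case (FEx n \<phi>)
  have "sats \<tau> j \<phi> (v(n := x)) = sats \<tau> j \<phi> (w(n := x))" for x
    by (rule FEx.IH) (use FEx.prems in auto)
  then show ?case by simp
qed

lemma ev_map: "ev \<tau> j v (map_dterm f t) = ev \<tau> (\<lambda>p. j (f p)) v t"
  by (induction t) auto

lemma sat_map: "sats \<tau> j (map_dform f \<phi>) v = sats \<tau> (\<lambda>p. j (f p)) \<phi> v"
  by (induction \<phi> arbitrary: v) (auto simp: ev_map)

lemma fv_map: "fv_tm (map_dterm f t) = fv_tm t"
  by (induction t) auto

lemma fv_map_form: "fv (map_dform f \<phi>) = fv \<phi>"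
  by (induction \<phi>) (auto simp: fv_map)

lemma qfree_map: "qfree (map_dform f \<phi>) = qfree \<phi>"
  by (induction \<phi>) auto

lemma ring_hom_ring_of_type_algebraD:
  fixes f :: "'a::field \<Rightarrow> 'u::field"
  assumes "f \<in> ring_hom ring_of_type_algebra ring_of_type_algebra"
  shows "f (x + y) = f x + f y" "f (x * y) = f x * f y" "f 1 = 1" "f 0 = 0" "f (- x) = - f x"
    "f (inverse x) = inverse (f x)" "f (x ^ n) = f x ^ n" "inj f"
proof -
  have add: "f (x + y) = f x + f y" and mult: "f (x * y) = f x * f y" for x y
    using assms by (auto simp: ring_hom_def)
  show "f (x + y) = f x + f y" by (rule add)
  show "f (x * y) = f x * f y" by (rule mult)
  show one: "f 1 = 1" using assms by (auto simp: ring_hom_def)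
  show zero: "f 0 = 0" using add[of 0 0] by (metis add_cancel_left_left add.right_neutral)
  have uminus: "f (- x) = - f x" for x
    using add[of x "- x"] zero by (simp add: eq_neg_iff_add_eq_0 add.commute)
  show "f (- x) = - f x" by (rule uminus)
  have inve: "f x * f (inverse x) = 1" if "x \<noteq> 0" for x
    using that one by (simp flip: mult)
  then show "f (inverse x) = inverse (f x)"
    using zero inverse_unique[of "f x" "f (inverse x)"] by (cases "x = 0") auto
  show "f (x ^ n) = f x ^ n" by (induction n) (auto simp: one mult)
  show "inj f"
  proof (rule injI)
    fix x y assume "f x = f y"
    then have "f (x - y) = 0" using add[of x "- y"] uminus by simp
    then show "x = y" using inve[of "x - y"] by force
  qed
qed

lemma difference_embeddingD:
  fixes \<sigma> :: "'a::field \<Rightarrow> 'a" and \<tau> :: "'u::field \<Rightarrow> 'u"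
  assumes "difference_embedding ring_of_type_algebra \<sigma> ring_of_type_algebra \<tau> \<iota>"
  shows "\<sigma> \<in> ring_hom ring_of_type_algebra ring_of_type_algebra"
    and "\<tau> \<in> ring_hom ring_of_type_algebra ring_of_type_algebra"
    and "\<iota> \<in> ring_hom ring_of_type_algebra ring_of_type_algebra"
    and "\<iota> (\<sigma> x) = \<tau> (\<iota> x)"
  using assms by (auto simp: difference_embedding_def difference_field_def)

lemma ev_embedding:
  fixes \<sigma> :: "'a::field \<Rightarrow> 'a" and \<tau> :: "'u::field \<Rightarrow> 'u"
  assumes "difference_embedding ring_of_type_algebra \<sigma> ring_of_type_algebra \<tau> \<iota>"
  shows "ev \<tau> \<iota> (\<lambda>n. \<iota> (v n)) t = \<iota> (ev \<sigma> id v t)"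
  by (induction t)
    (auto simp: difference_embeddingD(4)[OF assms] ring_hom_ring_of_type_algebraD[OF difference_embeddingD(3)[OF assms]])

lemma sat_embedding:
  fixes \<sigma> :: "'a::field \<Rightarrow> 'a" and \<tau> :: "'u::field \<Rightarrow> 'u"
  assumes "difference_embedding ring_of_type_algebra \<sigma> ring_of_type_algebra \<tau> \<iota>" "qfree \<phi>"
  shows "sats \<tau> \<iota> \<phi> (\<lambda>n. \<iota> (v n)) = sats \<sigma> id \<phi> v"
  using assms(2)
  by (induction \<phi>) (auto simp: ev_embedding[OF assms(1)] inj_eq[OF ring_hom_ring_of_type_algebraD(8)[OF difference_embeddingD(3)[OF assms(1)]]])

lemma ev_tpow [simp]: "ev \<tau> j v (tpow t n) = ev \<tau> j v t ^ n"
  by (induction n) auto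

lemma ev_tsum [simp]: "ev \<tau> j v (tsum ts) = (\<Sum>t\<leftarrow>ts. ev \<tau> j v t)"
  by (induction ts) (auto simp: tsum_def)

lemma ev_TSig_funpow [simp]: "ev \<tau> j v ((TSig ^^ i) t) = (\<tau> ^^ i) (ev \<tau> j v t)"
  by (induction i) auto

lemma ev_topf [simp]: "ev \<tau> j v (topf xs t) = opf j \<tau> xs (ev \<tau> j v t)"
  by (simp add: topf_def opf_def comp_def case_prod_unfold)

lemma ev_tpoly [simp]: "ev \<tau> j v (tpoly n ts t) = (\<Sum>i\<le>n. ev \<tau> j v (ts i) * ev \<tau> j v t ^ i)"
  unfolding tpoly_def ev_tsum
  by (simp add: comp_def interv_sum_list_conv_sum_set_nat atLeast0LessThan lessThan_Suc_atMost del: upt_Suc)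

lemma fv_tpow: "fv_tm (tpow t n) \<subseteq> fv_tm t"
  by (induction n) auto

lemma fv_tsum: "fv_tm (tsum ts) = (\<Union>t\<in>set ts. fv_tm t)"
  by (induction ts) (auto simp: tsum_def)

lemma fv_TSig_funpow: "fv_tm ((TSig ^^ i) t) = fv_tm t"
  by (induction i) auto

lemma fv_topf: "fv_tm (topf xs t) \<subseteq> fv_tm t"
  using fv_tpow[of t] by (force simp: topf_def fv_tsum fv_TSig_funpow)

lemma fv_tpoly: "fv_tm (tpoly n ts t) \<subseteq> (\<Union>i. fv_tm (ts i)) \<union> fv_tm t"
  using fv_tpow[of t] by (force simp: tpoly_def fv_tsum)

section \<open>Realising types in several variables\<close>

definition fconj :: "'p dform list \<Rightarrow> 'p dform" where
  "fconj \<phi>s = foldr FAnd \<phi>s (FEqual TZero TZero)"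

definition exs :: "nat list \<Rightarrow> 'p dform \<Rightarrow> 'p dform" where
  "exs ks \<phi> = foldr FEx ks \<phi>"

lemma sat_fconj: "sats \<tau> j (fconj \<phi>s) v \<longleftrightarrow> (\<forall>\<phi>\<in>set \<phi>s. sats \<tau> j \<phi> v)"
  and fv_fconj: "fv (fconj \<phi>s) = (\<Union>\<phi>\<in>set \<phi>s. fv \<phi>)"
  and params_fconj: "params (fconj \<phi>s) = (\<Union>\<phi>\<in>set \<phi>s. params \<phi>)"
  by (induction \<phi>s) (auto simp: fconj_def)

lemma sat_exs: "sats \<tau> j (exs ks \<phi>) v \<longleftrightarrow> (\<exists>w. (\<forall>k. k \<notin> set ks \<longrightarrow> w k = v k) \<and> sats \<tau> j \<phi> w)"
proof (induction ks arbitrary: v)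
  case Nil
  have "(\<forall>k. w k = v k) \<longleftrightarrow> w = v" for w by auto
  then show ?case by (simp add: exs_def)
next
  case (Cons k ks)
  have "sats \<tau> j (exs (k # ks) \<phi>) v \<longleftrightarrow> (\<exists>x. sats \<tau> j (exs ks \<phi>) (v(k := x)))"
    by (simp add: exs_def)
  also have "\<dots> \<longleftrightarrow> (\<exists>x w. (\<forall>k'. k' \<notin> set ks \<longrightarrow> w k' = (v(k := x)) k') \<and> sats \<tau> j \<phi> w)"
    using Cons by simp
  also have "\<dots> \<longleftrightarrow> (\<exists>w. (\<forall>k'. k' \<notin> set (k # ks) \<longrightarrow> w k' = v k') \<and> sats \<tau> j \<phi> w)" (is "?l \<longleftrightarrow> ?r")
  proof
    assume ?l
    then obtain x w where "\<forall>k'. k' \<notin> set ks \<longrightarrow> w k' = (v(k := x)) k'" "sats \<tau> j \<phi> w" by blast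
    then show ?r by (intro exI[of _ w]) auto
  next
    assume ?r
    then obtain w where "\<forall>k'. k' \<notin> set (k # ks) \<longrightarrow> w k' = v k'" "sats \<tau> j \<phi> w" by blast
    then show ?l by (intro exI[of _ "w k"] exI[of _ w]) auto
  qed
  finally show ?case .
qed

lemma fv_exs: "fv (exs ks \<phi>) = fv \<phi> - set ks"
  and params_exs: "params (exs ks \<phi>) = params \<phi>"
  by (induction ks) (auto simp: exs_def)

text \<open>Induction on the number of variables: the first coordinate realises the one-variable
  type of all existentially quantified finite conjunctions and is then substituted as a parameter.
  The parameter set stays small, since an infinite set does not grow in cardinality by one element.
  Substitution meets no binders, as the formulas of \<open>T\<close> are quantifier-free.\<close>

lemma saturated_tuple:
  fixes \<tau> :: "'u::field \<Rightarrow> 'u"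
  assumes sat: "saturated \<kappa> \<tau>"
    and "|A| <o \<kappa>" "infinite A"
    and "\<And>\<phi>. \<phi> \<in> T \<Longrightarrow> qfree \<phi> \<and> params \<phi> \<subseteq> A \<and> fv \<phi> \<subseteq> {..<n}"
    and "\<And>T0. T0 \<subseteq> T \<Longrightarrow> finite T0 \<Longrightarrow> \<exists>v. \<forall>\<phi>\<in>T0. sats \<tau> id \<phi> v"
  shows "\<exists>v. \<forall>\<phi>\<in>T. sats \<tau> id \<phi> v"
  using assms(2-)
proof (induction n arbitrary: A T)
  case 0
  have "sats \<tau> id \<phi> v" if "\<phi> \<in> T" for \<phi> v
  proof -
    obtain w where "sats \<tau> id \<phi> w" using 0(4)[of "{\<phi>}"] \<open>\<phi> \<in> T\<close> by blast
    moreover have "fv \<phi> = {}" using 0(3)[OF \<open>\<phi> \<in> T\<close>] by auto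
    ultimately show ?thesis using sat_coincidence[of \<phi> v w] by auto
  qed
  then show ?case by blast
next
  case (Suc n)
  define T1 where "T1 = {exs [1..<Suc n] (fconj \<phi>s) |\<phi>s. set \<phi>s \<subseteq> T}"
  have "\<exists>x. \<forall>\<phi>\<in>T1. sats \<tau> id \<phi> (\<lambda>_. x)"
  proof (rule sat[unfolded saturated_def, rule_format], intro conjI ballI allI impI)
    show "|A| <o \<kappa>" by (rule Suc.prems)
    show "params \<phi> \<subseteq> A" if "\<phi> \<in> T1" for \<phi>
      using that Suc.prems(3) by (force simp: T1_def params_exs params_fconj)
    show "fv \<phi> \<subseteq> {0}" if "\<phi> \<in> T1" for \<phi>
    proof -
      obtain \<phi>s where \<phi>s: "\<phi> = exs [1..<Suc n] (fconj \<phi>s)" "set \<phi>s \<subseteq> T" using \<open>\<phi> \<in> T1\<close> by (auto simp: T1_def)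
      then have "fv (fconj \<phi>s) \<subseteq> {..<Suc n}" using Suc.prems(3) by (force simp: fv_fconj)
      then show ?thesis by (auto simp: \<phi>s(1) fv_exs simp del: upt_Suc)
    qed
    fix T0 assume T0: "T0 \<subseteq> T1" "finite T0"
    have "\<forall>\<phi>\<in>T0. \<exists>\<phi>s. \<phi> = exs [1..<Suc n] (fconj \<phi>s) \<and> set \<phi>s \<subseteq> T"
      using T0 by (auto simp: T1_def)
    then obtain g where g: "\<And>\<phi>. \<phi> \<in> T0 \<Longrightarrow> \<phi> = exs [1..<Suc n] (fconj (g \<phi>)) \<and> set (g \<phi>) \<subseteq> T"
      by metis
    obtain v where v: "\<forall>\<phi>\<in>(\<Union>\<phi>\<in>T0. set (g \<phi>)). sats \<tau> id \<phi> v"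
      using Suc.prems(4)[of "\<Union>\<phi>\<in>T0. set (g \<phi>)"] g T0(2) by blast
    show "\<exists>x. \<forall>\<phi>\<in>T0. sats \<tau> id \<phi> (\<lambda>_. x)"
    proof (intro exI[of _ "v 0"] ballI)
      fix \<phi> assume \<phi>: "\<phi> \<in> T0"
      \<comment> \<open>The quantified formula is evaluated at a constant assignment, so
        \<open>w\<close> must equal \<open>v 0\<close> outside the quantified variables; the only
        variable there that can be free in \<open>\<psi>\<close> is \<open>0\<close>.\<close>
      define w where "w k = (if k \<in> {1..<Suc n} then v k else v 0)" for k
      have "sats \<tau> id \<psi> w" if "\<psi> \<in> set (g \<phi>)" for \<psi>
      proof -
        have "fv \<psi> \<subseteq> {..<Suc n}" using g[OF \<phi>] Suc.prems(3)[of \<psi>] \<open>\<psi> \<in> set (g \<phi>)\<close> by blast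
        then have "w k = v k" if "k \<in> fv \<psi>" for k using that by (cases k) (auto simp: w_def)
        then have "sats \<tau> id \<psi> w = sats \<tau> id \<psi> v" by (rule sat_coincidence)
        then show ?thesis using v \<phi> \<open>\<psi> \<in> set (g \<phi>)\<close> by blast
      qed
      then have "sats \<tau> id (exs [1..<Suc n] (fconj (g \<phi>))) (\<lambda>_. v 0)"
        unfolding sat_exs sat_fconj by (intro exI[of _ w]) (auto simp: w_def)
      then show "sats \<tau> id \<phi> (\<lambda>_. v 0)" using g[OF \<phi>] by simp
    qed
  qed
  then obtain a0 where a0: "\<And>\<phi>. \<phi> \<in> T1 \<Longrightarrow> sats \<tau> id \<phi> (\<lambda>_. a0)" by blast
  define s where "s k = (case k of 0 \<Rightarrow> TParam a0 | Suc k' \<Rightarrow> TVar k')" for k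
  have "\<exists>v. \<forall>\<phi>\<in>fsubst s ` T. sats \<tau> id \<phi> v"
  proof (rule Suc.IH[of "insert a0 A"])
    show "|insert a0 A| <o \<kappa>"
    proof (rule ordIso_ordLess_trans[OF _ Suc.prems(1)])
      have "\<exists>h. bij_betw h A (A \<union> {a0})" using Suc.prems(2) by (rule infinite_imp_bij_betw2)
      then have "|A| =o |A \<union> {a0}|" unfolding card_of_ordIso .
      then show "|insert a0 A| =o |A|" using ordIso_symmetric by simp
    qed
    show "infinite (insert a0 A)" using Suc.prems(2) by simp
    have params_s: "params_tm (s k) \<subseteq> {a0}" for k by (auto simp: s_def split: nat.splits)
    show "qfree \<psi> \<and> params \<psi> \<subseteq> insert a0 A \<and> fv \<psi> \<subseteq> {..<n}" if "\<psi> \<in> fsubst s ` T" for \<psi>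
    proof -
      obtain \<phi> where \<phi>: "\<psi> = fsubst s \<phi>" "\<phi> \<in> T" using \<open>\<psi> \<in> fsubst s ` T\<close> by blast
      note p = Suc.prems(3)[OF \<phi>(2)]
      have "fv_tm (s k) \<subseteq> {..<n}" if "k < Suc n" for k using that by (auto simp: s_def split: nat.splits)
      then have "fv \<psi> \<subseteq> {..<n}" using p unfolding \<phi>(1) by (subst fv_fsubst) auto
      moreover have "params \<psi> \<subseteq> insert a0 A"
        using p params_fsubst[of s \<phi>] params_s unfolding \<phi>(1) by blast
      ultimately show ?thesis using p qfree_fsubst[of \<phi> s] by (simp add: \<phi>(1))
    qed
    fix T0 assume "T0 \<subseteq> fsubst s ` T" "finite T0"
    then obtain T0' where T0': "T0' \<subseteq> T" "finite T0'" "T0 = fsubst s ` T0'"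
      using finite_subset_image by metis
    obtain \<phi>s where \<phi>s: "set \<phi>s = T0'" using finite_list[OF T0'(2)] by blast
    have "exs [1..<Suc n] (fconj \<phi>s) \<in> T1" using \<phi>s T0' by (auto simp: T1_def)
    from a0[OF this] obtain w where w': "\<forall>k. k \<notin> set [1..<Suc n] \<longrightarrow> w k = a0" "\<forall>\<phi>\<in>T0'. sats \<tau> id \<phi> w"
      unfolding sat_exs sat_fconj \<phi>s by blast
    then have w: "w 0 = a0" "\<forall>\<phi>\<in>T0'. sats \<tau> id \<phi> w" by auto
    have "(\<lambda>k. ev \<tau> id (\<lambda>k. w (Suc k)) (s k)) = w"
      using w(1) by (auto simp: s_def fun_eq_iff split: nat.splits)
    then have "sats \<tau> id (fsubst s \<phi>) (\<lambda>k. w (Suc k))" if "\<phi> \<in> T0'" for \<phi>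
      using w(2) that Suc.prems(3)[of \<phi>] T0'(1) by (subst sat_fsubst) auto
    then show "\<exists>v. \<forall>\<phi>\<in>T0. sats \<tau> id \<phi> v"
      unfolding T0'(3) by (intro exI[of _ "\<lambda>k. w (Suc k)"]) auto
  qed
  then obtain v where v: "\<And>\<phi>. \<phi> \<in> T \<Longrightarrow> sats \<tau> id (fsubst s \<phi>) v" by auto
  have "sats \<tau> id \<phi> (\<lambda>k. ev \<tau> id v (s k))" if "\<phi> \<in> T" for \<phi>
    using v[OF that] Suc.prems(3)[OF that] by (simp add: sat_fsubst)
  then show ?case by blast
qed

text \<open>Finite parts are satisfied in the base difference field itself and, being
  quantifier-free, remain true in \<open>'u\<close> under \<open>\<iota>\<close>. All parameters lie
  in \<open>range \<iota>\<close>, whose size is below \<open>\<kappa>\<close>.\<close>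

lemma saturated_realises:
  fixes \<tau> :: "'u::field \<Rightarrow> 'u" and \<iota> :: "'a::field \<Rightarrow> 'u"
  assumes U: "universal_domain \<kappa> \<sigma> \<tau> \<iota>" and inf: "infinite (UNIV :: 'a set)"
    and T: "\<And>\<phi>. \<phi> \<in> T \<Longrightarrow> qfree \<phi> \<and> fv \<phi> \<subseteq> {..<n}"
    and fin: "\<And>T0. T0 \<subseteq> T \<Longrightarrow> finite T0 \<Longrightarrow> \<exists>v. \<forall>\<phi>\<in>T0. sats \<sigma> id \<phi> v"
  shows "\<exists>v. \<forall>\<phi>\<in>T. sats \<tau> \<iota> \<phi> v"
proof -
  have sat: "saturated \<kappa> \<tau>" and emb: "difference_embedding ring_of_type_algebra \<sigma> ring_of_type_algebra \<tau> \<iota>"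
    and card: "|UNIV :: 'a set| <o \<kappa>"
    using U by (auto simp: universal_domain_def)
  have "\<exists>v. \<forall>\<phi>\<in>map_dform \<iota> ` T. sats \<tau> id \<phi> v"
  proof (rule saturated_tuple[OF sat, of "range \<iota>"])
    show "|range \<iota>| <o \<kappa>" by (rule ordLeq_ordLess_trans[OF card_of_image card])
    show "infinite (range \<iota>)"
      using inf ring_hom_ring_of_type_algebraD(8)[OF difference_embeddingD(3)[OF emb]] finite_imageD by blast
    show "qfree \<psi> \<and> params \<psi> \<subseteq> range \<iota> \<and> fv \<psi> \<subseteq> {..<n}" if "\<psi> \<in> map_dform \<iota> ` T" for \<psi>
    proof -
      obtain \<phi> where \<phi>: "\<psi> = map_dform \<iota> \<phi>" "\<phi> \<in> T" using \<open>\<psi> \<in> map_dform \<iota> ` T\<close> by blast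
      from T[OF \<phi>(2)] show ?thesis unfolding \<phi>(1) qfree_map fv_map_form dform.set_map by blast
    qed
    fix T0 assume "T0 \<subseteq> map_dform \<iota> ` T" "finite T0"
    then obtain T0' where T0': "T0' \<subseteq> T" "finite T0'" "T0 = map_dform \<iota> ` T0'"
      using finite_subset_image by metis
    obtain v where v: "\<forall>\<phi>\<in>T0'. sats \<sigma> id \<phi> v" using fin[OF T0'(1,2)] by blast
    have "sats \<tau> \<iota> \<phi> (\<lambda>k. \<iota> (v k))" if "\<phi> \<in> T0'" for \<phi>
      using v that T[of \<phi>] T0'(1) by (subst sat_embedding[OF emb]) auto
    then show "\<exists>v. \<forall>\<phi>\<in>T0. sats \<tau> id \<phi> v"
      unfolding T0'(3) by (intro exI[of _ "\<lambda>k. \<iota> (v k)"]) (auto simp: sat_map)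
  qed
  then show ?thesis by (simp add: sat_map)
qed

section \<open>Generic lines\<close>

definition env :: "'u \<Rightarrow> 'u \<Rightarrow> nat \<Rightarrow> 'u" where
  "env w1 w2 k = (if k = 0 then w1 else w2)"

text \<open>The shape of an algebraic equation for \<open>u\<close> over the difference field
  generated by \<open>w1\<close>, \<open>w2\<close> and the parameters. Replacing \<open>u\<close>
  by \<open>(\<tau> ^^ N) u\<close> removes the inverses of \<open>\<tau>\<close> from the
  coefficients; these become terms, so a formula can deny the equation.\<close>

definition alg_witness ::
    "('u::field \<Rightarrow> 'u) \<Rightarrow> ('p \<Rightarrow> 'u) \<Rightarrow> nat \<times> nat \<times> (nat \<Rightarrow> 'p dterm) \<Rightarrow> 'u \<Rightarrow> 'u \<Rightarrow> 'u \<Rightarrow> bool" where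
  "alg_witness \<tau> \<iota> = (\<lambda>(N, n, ts) u w1 w2. ev \<tau> \<iota> (env w1 w2) (ts n) \<noteq> 0 \<and>
     (\<Sum>i\<le>n. ev \<tau> \<iota> (env w1 w2) (ts i) * (\<tau> ^^ N) u ^ i) = 0)"

lemma funpow_ring_hom:
  fixes \<tau> :: "'u::field \<Rightarrow> 'u"
  assumes "\<tau> \<in> ring_hom ring_of_type_algebra ring_of_type_algebra"
  shows "\<tau> ^^ n \<in> ring_hom ring_of_type_algebra ring_of_type_algebra"
  by (induction n) (auto simp: ring_hom_def ring_hom_ring_of_type_algebraD(1-3)[OF assms])

text \<open>
  Applying a power of \<open>\<tau>\<close> and clearing denominators turns an algebraic equation over the
  generated difference field into one whose coefficients are difference polynomials.
\<close>
lemma acl_alg_witness: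
  fixes \<tau> :: "'u::field \<Rightarrow> 'u" and \<iota> :: "'p \<Rightarrow> 'u"
  assumes \<tau>: "\<tau> \<in> ring_hom ring_of_type_algebra ring_of_type_algebra" and surj: "surj \<tau>"
    and u: "u \<in> acl \<tau> (range \<iota> \<union> {w1, w2})"
  shows "\<exists>i. alg_witness \<tau> \<iota> i u w1 w2"
proof -
  note hom = ring_hom_ring_of_type_algebraD[OF funpow_ring_hom[OF \<tau>]]
  define D where "D = range (ev \<tau> \<iota> (env w1 w2))"
  have D_closed: "0 \<in> D" "1 \<in> D" "w1 \<in> D" "w2 \<in> D" "\<iota> c \<in> D" for c
    unfolding D_def
    by (rule range_eqI[of _ _ TZero] range_eqI[of _ _ TOne] range_eqI[of _ _ "TVar 0"]
        range_eqI[of _ _ "TVar 1"] range_eqI[of _ _ "TParam c"], simp add: env_def)+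
  have D_add: "x + y \<in> D" and D_mult: "x * y \<in> D" if xy: "x \<in> D" "y \<in> D" for x y
  proof -
    obtain t s where "x = ev \<tau> \<iota> (env w1 w2) t" "y = ev \<tau> \<iota> (env w1 w2) s"
      using xy by (auto simp: D_def)
    then show "x + y \<in> D" "x * y \<in> D"
      unfolding D_def by (auto intro: range_eqI[of _ _ "TPlus t s"] range_eqI[of _ _ "TTimes t s"])
  qed
  have D_uminus: "- x \<in> D" and D_\<tau>: "\<tau> x \<in> D" if x: "x \<in> D" for x
  proof -
    obtain t where "x = ev \<tau> \<iota> (env w1 w2) t" using x by (auto simp: D_def)
    then show "- x \<in> D" "\<tau> x \<in> D"
      unfolding D_def by (auto intro: range_eqI[of _ _ "TNeg t"] range_eqI[of _ _ "TSig t"])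
  qed
  have D_\<tau>n: "(\<tau> ^^ n) x \<in> D" if "x \<in> D" for x n
    using that by (induction n) (auto intro: D_\<tau>)
  have \<tau>_nz: "(\<tau> ^^ n) x \<noteq> 0" if "x \<noteq> 0" for x n
    using that inj_eq[OF hom(8)[of n], of x 0] hom(4)[of n] by auto
  \<comment> \<open>\<open>Fr\<close> collects the elements that enter the ring \<open>D\<close> of
    term values after applying a power of \<open>\<tau>\<close> and multiplying by a nonzero
    denominator. It is a field closed under \<open>\<tau>\<close> and its inverse, hence contains
    the generated difference field.\<close>
  define Fr where "Fr = {z. \<exists>N b. b \<in> D \<and> b \<noteq> 0 \<and> b * (\<tau> ^^ N) z \<in> D}"
  have raise: "(\<tau> ^^ k) b * (\<tau> ^^ (k + N)) z \<in> D" if "b * (\<tau> ^^ N) z \<in> D" for k b N z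
    using D_\<tau>n[OF that, of k] by (simp add: hom(2) funpow_add)
  have common: "\<exists>N b. b \<in> D \<and> b \<noteq> 0 \<and> (\<forall>z\<in>Z. b * (\<tau> ^^ N) z \<in> D)" if "finite Z" "Z \<subseteq> Fr" for Z
    using that
  proof (induction Z rule: finite_induct)
    case empty
    then show ?case using D_closed by auto
  next
    case (insert x Z)
    obtain N b where b: "b \<in> D" "b \<noteq> 0" "\<forall>z\<in>Z. b * (\<tau> ^^ N) z \<in> D" using insert by auto
    obtain N' b' where b': "b' \<in> D" "b' \<noteq> 0" "b' * (\<tau> ^^ N') x \<in> D" using insert by (auto simp: Fr_def)
    let ?b = "(\<tau> ^^ N') b * (\<tau> ^^ N) b'"
    have "?b \<in> D" "?b \<noteq> 0" using b b' by (auto intro: D_mult D_\<tau>n simp: \<tau>_nz)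
    moreover have "?b * (\<tau> ^^ (N' + N)) z \<in> D" if "z \<in> Z" for z
      using D_mult[OF D_\<tau>n[OF b'(1), of N] raise[of b N z N']] b that by (simp add: ac_simps)
    moreover have "?b * (\<tau> ^^ (N' + N)) x \<in> D"
      using D_mult[OF D_\<tau>n[OF b(1), of N'] raise[OF b'(3), of N]] by (simp add: ac_simps)
    ultimately show ?case by (intro exI[of _ "N' + N"] exI[of _ ?b]) auto
  qed
  have FrI: "b \<in> D \<Longrightarrow> b \<noteq> 0 \<Longrightarrow> b * (\<tau> ^^ N) z \<in> D \<Longrightarrow> z \<in> Fr" for b N z
    unfolding Fr_def by blast
  have D_Fr: "D \<subseteq> Fr" using FrI[of 1 0] D_closed by auto
  have Fr: "closed_subfield Fr"
    unfolding closed_subfield_def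
  proof (intro conjI ballI)
    show "1 \<in> Fr" using D_Fr D_closed by blast
    fix x assume x: "x \<in> Fr"
    then obtain N b where b: "b \<in> D" "b \<noteq> 0" "b * (\<tau> ^^ N) x \<in> D" by (auto simp: Fr_def)
    show "- x \<in> Fr" using D_uminus[OF b(3)] by (intro FrI[OF b(1,2), of N]) (simp add: hom(5))
    show "inverse x \<in> Fr"
    proof (cases "x = 0")
      case True
      then show ?thesis using x by simp
    next
      case False
      then have "(b * (\<tau> ^^ N) x) * (\<tau> ^^ N) (inverse x) = b"
        using \<tau>_nz[of x N] by (simp add: hom(6))
      then have "(b * (\<tau> ^^ N) x) * (\<tau> ^^ N) (inverse x) \<in> D" using b(1) by (simp only:)
      then show ?thesis using b(2) \<tau>_nz[OF False, of N] by (intro FrI[OF b(3), of N]) auto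
    qed
    fix y assume "y \<in> Fr"
    then obtain N b where b: "b \<in> D" "b \<noteq> 0" "b * (\<tau> ^^ N) x \<in> D" "b * (\<tau> ^^ N) y \<in> D"
      using common[of "{x, y}"] x by auto
    show "x + y \<in> Fr"
      using D_add[OF b(3,4)] by (intro FrI[OF b(1,2), of N]) (simp add: hom(1) ring_distribs)
    show "x * y \<in> Fr"
    proof (rule FrI[of "b * b" N])
      show "b * b * (\<tau> ^^ N) (x * y) \<in> D"
        using D_mult[OF b(3,4)] by (simp add: hom(2) ac_simps)
    qed (use b D_mult in auto)
  qed
  have "sgen \<tau> (range \<iota> \<union> {w1, w2}) \<subseteq> Fr"
  proof (rule sgen_least[OF Fr])
    show "range \<iota> \<union> {w1, w2} \<subseteq> Fr" using D_Fr D_closed by auto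
    fix x assume "x \<in> Fr"
    then obtain N b where b: "b \<in> D" "b \<noteq> 0" "b * (\<tau> ^^ N) x \<in> D" by (auto simp: Fr_def)
    have "\<tau> b * (\<tau> ^^ N) (\<tau> x) \<in> D"
      using D_\<tau>[OF b(3)] ring_hom_ring_of_type_algebraD(2)[OF \<tau>] by (simp add: funpow_swap1)
    then show "\<tau> x \<in> Fr" using D_\<tau>[OF b(1)] \<tau>_nz[OF b(2), of 1] by (intro FrI[of "\<tau> b" N]) auto
    have "(\<tau> ^^ Suc N) (inv_into UNIV \<tau> x) = (\<tau> ^^ N) x"
      using surj_f_inv_f[OF surj, of x] by (simp add: funpow_swap1)
    then show "inv_into UNIV \<tau> x \<in> Fr" using b by (intro FrI[OF b(1,2), of "Suc N"]) simp
  qed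
  then have "algebraic_over Fr u" using u algebraic_over_mono by (auto simp: acl_iff)
  then obtain p where p: "p \<noteq> 0" "\<And>i. coeff p i \<in> Fr" "poly p u = 0" by (auto simp: algebraic_over_def)
  have "\<exists>N b. b \<in> D \<and> b \<noteq> 0 \<and> (\<forall>z\<in>coeff p ` {..degree p}. b * (\<tau> ^^ N) z \<in> D)"
    by (rule common) (use p(2) in auto)
  then obtain N b where b: "b \<in> D" "b \<noteq> 0" "\<And>i. i \<le> degree p \<Longrightarrow> b * (\<tau> ^^ N) (coeff p i) \<in> D"
    by auto
  then have "\<forall>i\<in>{..degree p}. \<exists>t. ev \<tau> \<iota> (env w1 w2) t = b * (\<tau> ^^ N) (coeff p i)"
    by (auto simp: D_def image_iff) metis
  then obtain ts where ts: "\<And>i. i \<le> degree p \<Longrightarrow> ev \<tau> \<iota> (env w1 w2) (ts i) = b * (\<tau> ^^ N) (coeff p i)"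
    by (metis atMost_iff)
  have sum: "(\<tau> ^^ N) (sum f A) = (\<Sum>i\<in>A. (\<tau> ^^ N) (f i))" for f :: "nat \<Rightarrow> 'u" and A
    by (induction A rule: infinite_finite_induct) (auto simp: hom(1,4))
  have "(\<Sum>i\<le>degree p. ev \<tau> \<iota> (env w1 w2) (ts i) * (\<tau> ^^ N) u ^ i) = b * (\<tau> ^^ N) (poly p u)"
    by (simp add: ts poly_altdef sum sum_distrib_left hom(2,7) mult.assoc)
  then have "alg_witness \<tau> \<iota> (N, degree p, ts) u w1 w2"
    using p b ts[of "degree p"] \<tau>_nz[of "lead_coeff p" N] by (simp add: alg_witness_def hom(4))
  then show ?thesis by blast
qed

text \<open>For fixed \<open>w1\<close>, \<open>w2\<close> the injective map
  \<open>\<sigma> ^^ N\<close> sends the admissible \<open>u\<close> to roots of one nonzero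
  polynomial of degree at most \<open>n\<close>.\<close>

lemma card_alg_witness:
  fixes \<sigma> :: "'a::field \<Rightarrow> 'a"
  assumes \<sigma>: "inj \<sigma>" and F: "finite F"
  shows "card {(w1, w2, u) \<in> F \<times> F \<times> F. alg_witness \<sigma> \<iota> (N, n, ts) u w1 w2} \<le> n * (card F)^2"
proof -
  define Bd where "Bd w1 w2 = {u \<in> F. alg_witness \<sigma> \<iota> (N, n, ts) u w1 w2}" for w1 w2
  have Bd: "card (Bd w1 w2) \<le> n" for w1 w2
  proof (cases "ev \<sigma> \<iota> (env w1 w2) (ts n) = 0")
    case True
    then show ?thesis by (simp add: Bd_def alg_witness_def)
  next
    case False
    define p where "p = (\<Sum>i\<le>n. monom (ev \<sigma> \<iota> (env w1 w2) (ts i)) i)"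
    have "coeff p n = ev \<sigma> \<iota> (env w1 w2) (ts n)" by (simp add: p_def coeff_sum)
    then have p: "p \<noteq> 0" using False by auto
    have "degree p \<le> n"
      unfolding p_def by (intro degree_sum_le) (auto intro: order.trans[OF degree_monom_le])
    have "(\<sigma> ^^ N) ` Bd w1 w2 \<subseteq> {x. poly p x = 0}"
      by (auto simp: Bd_def alg_witness_def p_def poly_sum poly_monom)
    then have "card ((\<sigma> ^^ N) ` Bd w1 w2) \<le> card {x. poly p x = 0}"
      by (intro card_mono poly_roots_finite[OF p])
    also have "\<dots> \<le> n" using card_poly_roots_bound[OF p] \<open>degree p \<le> n\<close> by simp
    finally show ?thesis using card_image[OF inj_on_subset[OF inj_fn[OF \<sigma>] subset_UNIV]] by metis
  qed
  have "{(w1, w2, u) \<in> F \<times> F \<times> F. alg_witness \<sigma> \<iota> (N, n, ts) u w1 w2} = (SIGMA w1:F. SIGMA w2:F. Bd w1 w2)"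
    by (auto simp: Bd_def)
  then have "card {(w1, w2, u) \<in> F \<times> F \<times> F. alg_witness \<sigma> \<iota> (N, n, ts) u w1 w2} = (\<Sum>w1\<in>F. \<Sum>w2\<in>F. card (Bd w1 w2))"
    using F by (simp add: card_SigmaI finite_SigmaI Bd_def)
  also have "\<dots> \<le> (\<Sum>w1\<in>F. \<Sum>w2\<in>F. n)" by (intro sum_mono Bd)
  also have "\<dots> = n * (card F)^2" by (simp add: power2_eq_square)
  finally show ?thesis .
qed

text \<open>Each forbidden equation excludes at most \<open>n * (card F)^2\<close> of the
  \<open>(card F)^3\<close> triples, so a large \<open>F\<close> leaves one over.\<close>

lemma generic_triple:
  fixes \<sigma> :: "'a::field \<Rightarrow> 'a"
  assumes \<sigma>: "inj \<sigma>" and F: "finite F" "\<And>x y. x \<in> F \<Longrightarrow> y \<in> F \<Longrightarrow> x + y \<in> F"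
      "\<And>x y. x \<in> F \<Longrightarrow> y \<in> F \<Longrightarrow> x * y \<in> F"
    and I: "finite I1" "finite I2" "(\<Sum>(N, n, ts)\<in>I1. n) + (\<Sum>(N, n, ts)\<in>I2. n) < card F"
  shows "\<exists>x\<in>F. \<exists>\<mu>\<in>F. \<exists>c\<in>F. (\<forall>i\<in>I1. \<not> alg_witness \<sigma> \<iota> i x \<mu> c) \<and>
    (\<forall>i\<in>I2. \<not> alg_witness \<sigma> \<iota> i \<mu> x (\<mu> * x + c))"
proof (rule ccontr)
  assume none: "\<not> ?thesis"
  define B1 where "B1 i = {(x, \<mu>, c) \<in> F \<times> F \<times> F. alg_witness \<sigma> \<iota> i x \<mu> c}" for i
  define B2 where "B2 i = {(x, \<mu>, c) \<in> F \<times> F \<times> F. alg_witness \<sigma> \<iota> i \<mu> x (\<mu> * x + c)}" for i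
  let ?W = "\<lambda>i. {(w1, w2, u) \<in> F \<times> F \<times> F. alg_witness \<sigma> \<iota> i u w1 w2}"
  have fin: "finite (?W i)" for i by (rule finite_subset[of _ "F \<times> F \<times> F"]) (use F in auto)
  have B1: "card (B1 (N, n, ts)) \<le> n * (card F)^2" for N n ts
  proof -
    have "card (B1 (N, n, ts)) \<le> card (?W (N, n, ts))"
      by (rule card_inj_on_le[of "\<lambda>(x, \<mu>, c). (\<mu>, c, x)", OF _ _ fin]) (auto simp: B1_def inj_on_def)
    then show ?thesis using card_alg_witness[OF \<sigma> F(1)] order.trans by blast
  qed
  have B2: "card (B2 (N, n, ts)) \<le> n * (card F)^2" for N n ts
  proof -
    \<comment> \<open>\<open>c\<close> can be recovered from \<open>x\<close>, \<open>\<mu>\<close>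
      and \<open>\<mu> * x + c\<close>, so the triples \<open>(x, \<mu>, c)\<close> are counted
      faithfully by \<open>(x, y, \<mu>)\<close>.\<close>
    have "card (B2 (N, n, ts)) \<le> card (?W (N, n, ts))"
      by (rule card_inj_on_le[of "\<lambda>(x, \<mu>, c). (x, \<mu> * x + c, \<mu>)", OF _ _ fin])
        (auto simp: B2_def inj_on_def F)
    then show ?thesis using card_alg_witness[OF \<sigma> F(1)] order.trans by blast
  qed
  have "F \<times> F \<times> F \<subseteq> (\<Union>i\<in>I1. B1 i) \<union> (\<Union>i\<in>I2. B2 i)"
    using none by (force simp: B1_def B2_def)
  moreover have finB: "finite (B1 i)" "finite (B2 i)" for i
    by (rule finite_subset[of _ "F \<times> F \<times> F"]; use F in \<open>auto simp: B1_def B2_def\<close>)+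
  ultimately have "card (F \<times> F \<times> F) \<le> card ((\<Union>i\<in>I1. B1 i) \<union> (\<Union>i\<in>I2. B2 i))"
    using I by (intro card_mono) auto
  also have "\<dots> \<le> card (\<Union>i\<in>I1. B1 i) + card (\<Union>i\<in>I2. B2 i)" by (rule card_Un_le)
  also have "\<dots> \<le> (\<Sum>i\<in>I1. card (B1 i)) + (\<Sum>i\<in>I2. card (B2 i))"
    by (intro add_mono card_UN_le I)
  also have "\<dots> \<le> (\<Sum>(N, n, ts)\<in>I1. n * (card F)^2) + (\<Sum>(N, n, ts)\<in>I2. n * (card F)^2)"
    using B1 B2 by (intro add_mono sum_mono) auto
  also have "\<dots> = ((\<Sum>(N, n, ts)\<in>I1. n) + (\<Sum>(N, n, ts)\<in>I2. n)) * (card F)^2"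
    by (simp add: sum_distrib_right case_prod_unfold ring_distribs)
  also have "\<dots> < card F * (card F)^2" using I(3) by (intro mult_strict_right_mono) auto
  finally show False by (simp add: card_cartesian_product power2_eq_square)
qed

definition nonalg_form ::
    "(nat \<Rightarrow> 'p dterm) \<Rightarrow> 'p dterm \<Rightarrow> nat \<times> nat \<times> (nat \<Rightarrow> 'p dterm) \<Rightarrow> 'p dform" where
  "nonalg_form s u = (\<lambda>(N, n, ts). FNot (FAnd (FNot (FEqual (tsubst s (ts n)) TZero))
     (FEqual (tpoly n (\<lambda>i. tsubst s (ts i)) ((TSig ^^ N) u)) TZero)))"

lemma sat_nonalg_form:
  fixes \<tau> :: "'u::field \<Rightarrow> 'u"
  assumes "(\<lambda>k. ev \<tau> \<iota> v (s k)) = env w1 w2"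
  shows "sats \<tau> \<iota> (nonalg_form s u i) v \<longleftrightarrow> \<not> alg_witness \<tau> \<iota> i (ev \<tau> \<iota> v u) w1 w2"
  by (cases i) (simp add: nonalg_form_def alg_witness_def ev_tsubst assms)

lemma qfree_nonalg_form: "qfree (nonalg_form s u i)"
  by (cases i) (simp add: nonalg_form_def)

lemma fv_nonalg_form: "fv (nonalg_form s u i) \<subseteq> (\<Union>k. fv_tm (s k)) \<union> fv_tm u"
proof -
  obtain N n ts where i: "i = (N, n, ts)" by (cases i)
  have "fv_tm (tsubst s t) \<subseteq> (\<Union>k. fv_tm (s k))" for t by (auto simp: fv_tsubst)
  then show ?thesis
    using fv_tpoly[of n "\<lambda>i. tsubst s (ts i)" "(TSig ^^ N) u"]
    by (fastforce simp: i nonalg_form_def fv_TSig_funpow)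
qed

text \<open>The type to be realised demands \<open>Q\<close> of both points and denies every
  algebraic equation in either direction. A finite part of it denies finitely many equations and is
  satisfied in a large enough \<open>F r\<close>, whose closure under sums and products puts
  \<open>\<mu> * x + c\<close> back into \<open>F r\<close>.\<close>

lemma generic_line:
  fixes \<tau> :: "'u::field \<Rightarrow> 'u" and \<iota> :: "'a::field \<Rightarrow> 'u" and F :: "nat \<Rightarrow> 'a set"
  assumes U: "universal_domain \<kappa> \<sigma> \<tau> \<iota>" and surj: "surj \<tau>" and inf: "infinite (UNIV :: 'a set)"
    and F: "\<And>r. finite (F r)" "\<And>r x y. x \<in> F r \<Longrightarrow> y \<in> F r \<Longrightarrow> x + y \<in> F r"
      "\<And>r x y. x \<in> F r \<Longrightarrow> y \<in> F r \<Longrightarrow> x * y \<in> F r" "\<And>n. \<exists>r. n < card (F r)"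
    and Q: "\<And>\<phi>. \<phi> \<in> Q \<Longrightarrow> qfree \<phi> \<and> fv \<phi> \<subseteq> {0}"
      "\<And>\<phi> r v. \<phi> \<in> Q \<Longrightarrow> v \<in> F r \<Longrightarrow> sats \<sigma> id \<phi> (\<lambda>_. v)"
  shows "\<exists>x \<mu> c. (\<forall>\<phi>\<in>Q. sats \<tau> \<iota> \<phi> (\<lambda>_. x) \<and> sats \<tau> \<iota> \<phi> (\<lambda>_. \<mu> * x + c)) \<and>
    x \<notin> acl \<tau> (range \<iota> \<union> {\<mu>, c}) \<and> \<mu> \<notin> acl \<tau> (range \<iota> \<union> {x, \<mu> * x + c})"
proof -
  have emb: "difference_embedding ring_of_type_algebra \<sigma> ring_of_type_algebra \<tau> \<iota>"
    using U by (simp add: universal_domain_def)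
  note \<sigma> = difference_embeddingD(1)[OF emb] and \<tau> = difference_embeddingD(2)[OF emb]
  \<comment> \<open>Variables \<open>0\<close>, \<open>1\<close>, \<open>2\<close> stand for
    \<open>x\<close>, \<open>\<mu>\<close>, \<open>c\<close>; \<open>s1\<close> and
    \<open>s2\<close> insert the pairs \<open>(\<mu>, c)\<close> and \<open>(x, y)\<close> into an
    equation.\<close>
  define y :: "'a dterm" where "y = TPlus (TTimes (TVar 1) (TVar 0)) (TVar 2)"
  define s1 s2 :: "nat \<Rightarrow> 'a dterm" where "s1 k = (if k = 0 then TVar 1 else TVar 2)"
    and "s2 k = (if k = 0 then TVar 0 else y)" for k
  define T where "T = Q \<union> fsubst (\<lambda>_. y) ` Q \<union> range (nonalg_form s1 (TVar 0)) \<union> range (nonalg_form s2 (TVar 1))"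
  have Q_sat: "sats \<sigma> id \<phi> v = sats \<sigma> id \<phi> (\<lambda>_. v 0)" "sats \<tau> \<iota> \<phi> v' = sats \<tau> \<iota> \<phi> (\<lambda>_. v' 0)"
    if "\<phi> \<in> Q" for \<phi> v v'
    using Q(1)[OF that] by (auto intro!: sat_coincidence)
  have y_sat: "sats \<sigma> id (fsubst (\<lambda>_. y) \<phi>) v = sats \<sigma> id \<phi> (\<lambda>_. v 1 * v 0 + v 2)"
    "sats \<tau> \<iota> (fsubst (\<lambda>_. y) \<phi>) v' = sats \<tau> \<iota> \<phi> (\<lambda>_. v' 1 * v' 0 + v' 2)"
    if "\<phi> \<in> Q" for \<phi> v v'
    using Q(1)[OF that] by (simp_all add: sat_fsubst y_def)
  have s_env: "(\<lambda>k. ev \<sigma> id v (s1 k)) = env (v 1) (v 2)" "(\<lambda>k. ev \<sigma> id v (s2 k)) = env (v 0) (v 1 * v 0 + v 2)"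
    "(\<lambda>k. ev \<tau> \<iota> v' (s1 k)) = env (v' 1) (v' 2)" "(\<lambda>k. ev \<tau> \<iota> v' (s2 k)) = env (v' 0) (v' 1 * v' 0 + v' 2)"
    for v v'
    by (auto simp: s1_def s2_def env_def y_def)
  have "\<exists>v. \<forall>\<phi>\<in>T. sats \<tau> \<iota> \<phi> v"
  proof (rule saturated_realises[OF U inf])
    show "qfree \<phi> \<and> fv \<phi> \<subseteq> {..<3}" if \<phi>: "\<phi> \<in> T" for \<phi>
    proof -
      have y: "fv_tm y \<subseteq> {..<3}" by (auto simp: y_def)
      then have "fv_tm (s1 k) \<subseteq> {..<3}" "fv_tm (s2 k) \<subseteq> {..<3}" for k by (auto simp: s1_def s2_def)
      then have fv_n: "fv (nonalg_form s1 (TVar 0) i) \<subseteq> {..<3}" "fv (nonalg_form s2 (TVar 1) i) \<subseteq> {..<3}" for i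
        using fv_nonalg_form[of s1 "TVar 0" i] fv_nonalg_form[of s2 "TVar 1" i] by force+
      have fv_y: "fv (fsubst (\<lambda>_. y) \<psi>) \<subseteq> {..<3}" if "\<psi> \<in> Q" for \<psi>
        using Q(1)[OF that] y by (auto simp: fv_fsubst)
      from \<phi> consider "\<phi> \<in> Q" | \<psi> where "\<psi> \<in> Q" "\<phi> = fsubst (\<lambda>_. y) \<psi>"
        | i where "\<phi> = nonalg_form s1 (TVar 0) i" | i where "\<phi> = nonalg_form s2 (TVar 1) i"
        unfolding T_def by blast
      then show ?thesis
      proof cases
        case 1
        then show ?thesis using Q(1)[of \<phi>] by auto
      next
        case (2 \<psi>)
        then show ?thesis using Q(1)[of \<psi>] fv_y[of \<psi>] qfree_fsubst[of \<psi> "\<lambda>_. y"] by simp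
      qed (use fv_n qfree_nonalg_form in simp_all)
    qed
    fix T0 assume T0: "T0 \<subseteq> T" "finite T0"
    obtain I1 where I1: "finite I1" "T0 \<inter> range (nonalg_form s1 (TVar 0)) = nonalg_form s1 (TVar 0) ` I1"
      using finite_subset_image[of "T0 \<inter> range (nonalg_form s1 (TVar 0))" _ UNIV] T0 by (metis finite_Int inf_le2)
    obtain I2 where I2: "finite I2" "T0 \<inter> range (nonalg_form s2 (TVar 1)) = nonalg_form s2 (TVar 1) ` I2"
      using finite_subset_image[of "T0 \<inter> range (nonalg_form s2 (TVar 1))" _ UNIV] T0 by (metis finite_Int inf_le2)
    obtain r where r: "(\<Sum>(N, n, ts)\<in>I1. n) + (\<Sum>(N, n, ts)\<in>I2. n) < card (F r)" using F(4) by blast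
    obtain x \<mu> c where xmc: "x \<in> F r" "\<mu> \<in> F r" "c \<in> F r" "\<forall>i\<in>I1. \<not> alg_witness \<sigma> id i x \<mu> c"
      "\<forall>i\<in>I2. \<not> alg_witness \<sigma> id i \<mu> x (\<mu> * x + c)"
      using generic_triple[OF ring_hom_ring_of_type_algebraD(8)[OF \<sigma>] F(1)[of r] F(2)[of _ r] F(3)[of _ r] I1(1) I2(1) r] by blast
    define v where "v k = (if k = 0 then x else if k = 1 then \<mu> else c)" for k :: nat
    have v: "v 0 = x" "v 1 = \<mu>" "v 2 = c" by (auto simp: v_def)
    have "sats \<sigma> id \<phi> v" if \<phi>: "\<phi> \<in> T0" for \<phi>
    proof -
      consider "\<phi> \<in> Q" | \<psi> where "\<psi> \<in> Q" "\<phi> = fsubst (\<lambda>_. y) \<psi>"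
        | i where "i \<in> I1" "\<phi> = nonalg_form s1 (TVar 0) i" | i where "i \<in> I2" "\<phi> = nonalg_form s2 (TVar 1) i"
      proof -
        have "\<phi> \<in> T" using \<phi> T0(1) by (rule subsetD[rotated])
        then consider "\<phi> \<in> Q" | "\<phi> \<in> fsubst (\<lambda>_. y) ` Q"
          | "\<phi> \<in> T0 \<inter> range (nonalg_form s1 (TVar 0))" | "\<phi> \<in> T0 \<inter> range (nonalg_form s2 (TVar 1))"
          using \<phi> by (auto simp only: T_def Un_iff Int_iff)
        then show ?thesis
          unfolding I1(2) I2(2) by cases (erule that(1) | (erule imageE, rule that(2-4), assumption+))+
      qed
      then show ?thesis
      proof cases
        case 1
        then show ?thesis using Q(2) xmc by (subst Q_sat(1)) (auto simp: v)
      next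
        case 2
        show ?thesis unfolding 2(2) y_sat(1)[OF 2(1)] v using Q(2)[OF 2(1), of "\<mu> * x + c" r] xmc F(2,3) by simp
      next
        case 3
        then show ?thesis using xmc(4) 3(1) unfolding 3(2) sat_nonalg_form[OF s_env(1)] eval_tm.simps v by blast
      next
        case 4
        then show ?thesis using xmc(5) 4(1) unfolding 4(2) sat_nonalg_form[OF s_env(2)] eval_tm.simps v by blast
      qed
    qed
    then show "\<exists>v. \<forall>\<phi>\<in>T0. sats \<sigma> id \<phi> v" by blast
  qed
  then obtain v where v: "\<And>\<phi>. \<phi> \<in> T \<Longrightarrow> sats \<tau> \<iota> \<phi> v" by blast
  have "sats \<tau> \<iota> \<phi> (\<lambda>_. v 0)" "sats \<tau> \<iota> \<phi> (\<lambda>_. v 1 * v 0 + v 2)" if "\<phi> \<in> Q" for \<phi>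
    using v[of \<phi>] v[of "fsubst (\<lambda>_. y) \<phi>"] Q_sat(2)[OF that, of v] y_sat(2)[OF that, of v] that
    by (auto simp: T_def)
  moreover have "\<not> alg_witness \<tau> \<iota> i (v 0) (v 1) (v 2)" for i
    using v[of "nonalg_form s1 (TVar 0) i"] unfolding sat_nonalg_form[OF s_env(3)] by (simp add: T_def)
  then have "v 0 \<notin> acl \<tau> (range \<iota> \<union> {v 1, v 2})" using acl_alg_witness[OF \<tau> surj] by blast
  moreover have "\<not> alg_witness \<tau> \<iota> i (v 1) (v 0) (v 1 * v 0 + v 2)" for i
    using v[of "nonalg_form s2 (TVar 1) i"] unfolding sat_nonalg_form[OF s_env(4)] by (simp add: T_def)
  then have "v 1 \<notin> acl \<tau> (range \<iota> \<union> {v 0, v 1 * v 0 + v 2})" using acl_alg_witness[OF \<tau> surj] by blast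
  ultimately show ?thesis
    by (intro exI[of _ "v 0"] exI[of _ "v 1"] exI[of _ "v 2"] conjI ballI)
qed

section \<open>Torsion\<close>

text \<open>The field extends itself along the embedding \<open>\<tau>\<close>. There the parameter
  \<open>y\<close> is read as \<open>\<tau> y\<close>, so the equation \<open>\<tau> x = y\<close>
  is solved by \<open>y\<close> itself; existential closedness brings a solution back.\<close>

lemma existentially_closed_surj:
  fixes \<tau> :: "'u::field \<Rightarrow> 'u"
  assumes "existentially_closed \<tau>"
  shows "surj \<tau>"
  unfolding surj_def
proof
  fix y :: 'u
  have df: "difference_field (ring_of_type_algebra :: 'u ring) \<tau>"
    using assms by (simp add: existentially_closed_def)
  then have hom: "\<tau> \<in> ring_hom ring_of_type_algebra ring_of_type_algebra"
    by (simp add: difference_field_def)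
  let ?\<phi> = "FEqual (TSig (TVar 0)) (TParam y)"
  have "difference_embedding (ring_of_type_algebra :: 'u ring) \<tau> ring_of_type_algebra \<tau> \<tau>"
    using df hom by (simp add: difference_embedding_def)
  moreover have "sats \<tau> \<tau> ?\<phi> (\<lambda>_. y)" by simp
  ultimately have "\<exists>v. sats \<tau> id ?\<phi> v"
    using assms unfolding existentially_closed_def by (metis qfree.simps(1) UNIV_I ring_of_type_algebra_simps(1))
  then show "\<exists>x. y = \<tau> x" by auto
qed

text \<open>The equation is pulled back to the algebraically closed field \<open>'a\<close>, where
  linear factors are split off until the image of one of them vanishes at \<open>x\<close>.\<close>

lemma algebraic_over_range:
  fixes \<iota> :: "'a::alg_closed_field \<Rightarrow> 'u::field"
  assumes \<iota>: "\<iota> \<in> ring_hom ring_of_type_algebra ring_of_type_algebra"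
    and x: "algebraic_over (range \<iota>) x"
  shows "x \<in> range \<iota>"
proof -
  note h = ring_hom_ring_of_type_algebraD[OF \<iota>]
  have diff: "\<iota> (a - b) = \<iota> a - \<iota> b" for a b using h(1)[of a "- b"] h(5)[of b] by simp
  have root: "x \<in> range \<iota>" if "p \<noteq> 0" "(\<Sum>i\<le>degree p. \<iota> (coeff p i) * x ^ i) = 0" for p
    using that
  proof (induction "degree p" arbitrary: p)
    case 0
    then have "\<iota> (lead_coeff p) = 0" by simp
    then have "lead_coeff p = 0" using inj_eq[OF h(8), of _ 0] h(4) by simp
    then show ?case using 0 by (metis leading_coeff_0_iff)
  next
    case (Suc n)
    obtain r where "poly p r = 0" using alg_closed_imp_poly_has_root[of p] Suc.hyps(2) by auto
    then obtain s where s: "p = [:- r, 1:] * s" by (meson dvdE poly_eq_0_iff_dvd)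
    have s0: "s \<noteq> 0" using s Suc.prems by auto
    have deg: "degree p = Suc (degree s)"
      using s0 unfolding s by (subst degree_mult_eq) auto
    let ?v = "\<lambda>p. \<Sum>i\<le>degree p. \<iota> (coeff p i) * x ^ i"
    have mp: "?v p = poly (map_poly \<iota> p) x" for p
    proof -
      have "degree (map_poly \<iota> p) = degree p"
        by (rule degree_map_poly) (use h(4) inj_eq[OF h(8), of _ 0] in simp)
      then show ?thesis by (simp add: poly_altdef coeff_map_poly h(4))
    qed
    have "map_poly \<iota> p = [:- \<iota> r, 1:] * map_poly \<iota> s"
    proof (rule poly_eqI)
      fix i
      show "coeff (map_poly \<iota> p) i = coeff ([:- \<iota> r, 1:] * map_poly \<iota> s) i"
        by (cases i) (simp_all add: s coeff_map_poly h diff)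
    qed
    then have "poly (map_poly \<iota> p) x = (x - \<iota> r) * poly (map_poly \<iota> s) x" by (simp only: poly_mult) simp
    then have "(x - \<iota> r) * ?v s = 0" using Suc.prems(2) unfolding mp by simp
    then consider "x = \<iota> r" | "?v s = 0" by auto
    then show ?case
    proof cases
      case 2
      have "n = degree s" using deg Suc.hyps(2) by simp
      then show ?thesis using Suc.hyps(1)[OF _ s0 2] by simp
    qed simp
  qed
  obtain p where p: "p \<noteq> 0" "\<And>i. coeff p i \<in> range \<iota>" "poly p x = 0"
    using x by (auto simp: algebraic_over_def)
  define p' where "p' = map_poly (inv_into UNIV \<iota>) p"
  have i0: "inv_into UNIV \<iota> 0 = 0" using inv_f_f[OF h(8), of 0] by (simp add: h(4))
  have c: "\<iota> (coeff p' i) = coeff p i" for i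
    using p(2)[of i] by (simp add: p'_def coeff_map_poly i0 f_inv_into_f)
  have nz: "coeff p' i = 0 \<longleftrightarrow> coeff p i = 0" for i
    using c[of i] inj_eq[OF h(8), of "coeff p' i" 0] h(4) by auto
  have "p' \<noteq> 0" using p(1) nz[of "degree p"] by auto
  moreover have "degree p' = degree p" by (simp add: Polynomial.degree_def nz)
  ultimately show ?thesis
    using root[of p'] p(3) by (simp add: c poly_altdef)
qed

text \<open>Makes \<open>range \<iota>\<close> admissible as the base \<open>E\<close> in
  \<open>modular_in\<close>. Surjectivity of \<open>\<sigma>\<close> gives closure under the inverse
  of \<open>\<tau>\<close>.\<close>

lemma acl_range:
  fixes \<sigma> :: "'a::alg_closed_field \<Rightarrow> 'a" and \<tau> :: "'u::field \<Rightarrow> 'u"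
  assumes emb: "difference_embedding ring_of_type_algebra \<sigma> ring_of_type_algebra \<tau> \<iota>" and surj: "surj \<sigma>"
  shows "acl \<tau> (range \<iota>) = range \<iota>"
proof -
  note \<iota> = ring_hom_ring_of_type_algebraD[OF difference_embeddingD(3)[OF emb]]
  have "closed_subfield (range \<iota>)"
    unfolding closed_subfield_def
  proof (intro conjI ballI)
    show "1 \<in> range \<iota>" by (rule range_eqI[of _ _ 1]) (simp add: \<iota>(3))
    fix x assume "x \<in> range \<iota>"
    then obtain a where a: "x = \<iota> a" by blast
    show "- x \<in> range \<iota>" by (rule range_eqI[of _ _ "- a"]) (simp add: a \<iota>(5))
    show "inverse x \<in> range \<iota>" by (rule range_eqI[of _ _ "inverse a"]) (simp add: a \<iota>(6))
    fix y assume "y \<in> range \<iota>"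
    then obtain b where b: "y = \<iota> b" by blast
    show "x * y \<in> range \<iota>" by (rule range_eqI[of _ _ "a * b"]) (simp add: a b \<iota>(2))
    show "x + y \<in> range \<iota>" by (rule range_eqI[of _ _ "a + b"]) (simp add: a b \<iota>(1))
  qed
  then have "sgen \<tau> (range \<iota>) \<subseteq> range \<iota>"
  proof (rule sgen_least)
    fix x assume "x \<in> range \<iota>"
    then obtain z where z: "x = \<iota> z" by blast
    show "\<tau> x \<in> range \<iota>" using difference_embeddingD(4)[OF emb, of z] by (auto simp: z intro: range_eqI[OF sym])
    obtain w where "z = \<sigma> w" using surj by (metis surjD)
    then have "x = \<tau> (\<iota> w)" using difference_embeddingD(4)[OF emb] z by simp
    then show "inv_into UNIV \<tau> x \<in> range \<iota>"
      using inv_f_f[OF ring_hom_ring_of_type_algebraD(8)[OF difference_embeddingD(2)[OF emb]]] by simp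
  qed simp
  then have "x \<in> range \<iota>" if "x \<in> acl \<tau> (range \<iota>)" for x
    using that algebraic_over_range[OF difference_embeddingD(3)[OF emb], of x]
      algebraic_over_mono[of "sgen \<tau> (range \<iota>)" x "range \<iota>"] by (simp add: acl_iff)
  then show ?thesis using acl_incl[of "range \<iota>" \<tau>] by blast
qed

section \<open>Finite orbits and the choice of the finite field\<close>

lemma funpow_periodic:
  assumes "inj f" "finite O'" "\<And>i. (f ^^ i) x \<in> O'"
  shows "\<exists>n>0. (f ^^ n) x = x"
proof -
  have "\<not> inj (\<lambda>i. (f ^^ i) x)"
    using assms finite_imageD[of "\<lambda>i. (f ^^ i) x" UNIV] finite_subset[of "range (\<lambda>i. (f ^^ i) x)" O'] by auto
  then obtain i j where ij: "i < j" "(f ^^ i) x = (f ^^ j) x" by (metis linorder_injI)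
  then have "(f ^^ i) ((f ^^ (j - i)) x) = (f ^^ i) x" by (simp flip: funpow_add comp_apply[of "f ^^ i"])
  then have "(f ^^ (j - i)) x = x" using inj_fn[OF assms(1)] by (auto dest: injD)
  then show ?thesis using ij by (intro exI[of _ "j - i"]) auto
qed

lemma funpow_mult_fixed: "(f ^^ n) x = x \<Longrightarrow> (f ^^ (n * k)) x = x"
  by (induction k) (auto simp: funpow_add)

lemma funpow_common_period:
  assumes "finite A" "\<And>x. x \<in> A \<Longrightarrow> \<exists>n>0. (f ^^ n) x = x"
  shows "\<exists>n>0. \<forall>x\<in>A. (f ^^ n) x = x"
  using assms
proof (induction A rule: finite_induct)
  case (insert a A)
  then obtain n where "n > 0" "\<forall>x\<in>A. (f ^^ n) x = x" by auto
  moreover obtain n' where "n' > 0" "(f ^^ n') a = a" using insert.prems[of a] by auto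
  ultimately show ?case
    using funpow_mult_fixed[of n f _ n'] funpow_mult_fixed[of n' f a n]
    by (intro exI[of _ "n * n'"]) (auto simp: mult.commute)
qed auto

lemma frobenius_funpow: "((\<lambda>x::'a::field. x ^ Q) ^^ n) x = x ^ (Q ^ n)"
  by (induction n) (simp_all add: power_mult[symmetric] mult.commute)

lemma inj_frobenius:
  assumes "prime CHAR('a::field)"
  shows "inj (\<lambda>x::'a. x ^ (CHAR('a) ^ n))"
proof (rule injI)
  fix x y :: 'a assume eq: "x ^ (CHAR('a) ^ n) = y ^ (CHAR('a) ^ n)"
  have "((x - y) + y) ^ (CHAR('a) ^ n) = (x - y) ^ (CHAR('a) ^ n) + y ^ (CHAR('a) ^ n)"
    by (rule freshmans_dream'[OF assms refl])
  then have "(x - y) ^ (CHAR('a) ^ n) = 0" using eq by simp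
  then show "x = y" by simp
qed

lemma prime_CHAR_finite_field: "prime CHAR('k::finite_field)"
  by (rule prime_CHAR_semidom) (simp add: finite_imp_CHAR_pos)

text \<open>A power of the Frobenius fixes the finite field \<open>'k\<close> pointwise, hence
  permutes the roots of a polynomial over it, and a further power fixes the given root
  \<open>x\<close>.\<close>

lemma frobenius_periodic:
  fixes x :: "'k::finite_field alg_closure"
  shows "\<exists>n>0. x ^ (CHAR('k) ^ n) = x"
proof -
  let ?p = "CHAR('k)"
  have p: "prime CHAR('k alg_closure)" using prime_CHAR_finite_field[where ?'k = 'k] by simp
  have "\<exists>n>0. \<forall>c\<in>UNIV. ((\<lambda>c::'k. c ^ ?p) ^^ n) c = c"
    using inj_frobenius[OF prime_CHAR_finite_field, of 1]
    by (intro funpow_common_period funpow_periodic[of _ UNIV]) auto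
  then obtain n where n: "n > 0" "\<And>c::'k. c ^ (?p ^ n) = c" by (auto simp: frobenius_funpow)
  obtain f :: "'k poly" where f: "f \<noteq> 0" "poly (map_poly to_ac f) x = 0" by (rule alg_closure_algebraic)
  let ?f = "map_poly to_ac f"
  have "coeff ?f (degree f) = to_ac (lead_coeff f)" by (simp add: coeff_map_poly)
  then have "?f \<noteq> 0" using f(1) by (metis coeff_0 leading_coeff_0_iff to_ac_eq_0_iff)
  have root: "poly ?f (z ^ (?p ^ n)) = (poly ?f z) ^ (?p ^ n)" for z
  proof -
    have "poly ?f z ^ (?p ^ n) = (\<Sum>i\<le>degree ?f. (to_ac (coeff f i) * z ^ i) ^ (?p ^ n))"
      unfolding poly_altdef by (subst freshmans_dream_sum'[OF p, of _ n]) (simp_all add: coeff_map_poly)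
    also have "\<dots> = (\<Sum>i\<le>degree ?f. to_ac (coeff f i) * (z ^ (?p ^ n)) ^ i)"
      by (intro sum.cong refl)
        (simp add: power_mult_distrib n(2) mult.commute flip: to_ac_power power_mult)
    finally show ?thesis by (simp add: poly_altdef coeff_map_poly)
  qed
  have "\<exists>k>0. ((\<lambda>z. z ^ (?p ^ n)) ^^ k) x = x"
  proof (rule funpow_periodic)
    show "inj (\<lambda>z::'k alg_closure. z ^ (?p ^ n))" using inj_frobenius[OF p, of n] by simp
    show "finite {z. poly ?f z = 0}" by (rule poly_roots_finite[OF \<open>?f \<noteq> 0\<close>])
    have "?p ^ n > 0" using prime_gt_0_nat[OF prime_CHAR_finite_field] by simp
    then show "((\<lambda>z. z ^ (?p ^ n)) ^^ k) x \<in> {z. poly ?f z = 0}" for k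
      using f(2) by (induction k) (auto simp: root)
  qed
  then obtain k where "k > 0" "x ^ (?p ^ (n * k)) = x" by (auto simp: frobenius_funpow power_mult)
  then show ?thesis using n(1) by (intro exI[of _ "n * k"]) auto
qed

lemma infinite_torsion:
  assumes "surj f" "f 0 = 0" "f x = 0" "x \<noteq> 0"
  shows "infinite (torsion f)"
proof -
  obtain u where u: "inj u" "\<And>n k. n < k \<Longrightarrow> (f ^^ k) (u n) = 0"
    using iterated_preimages[OF assms] by blast
  have "u n \<in> torsion f" for n
    using u(2)[of n "Suc n"] unfolding torsion_def by (intro CollectI exI[of _ "Suc n"]) auto
  then have "range u \<subseteq> torsion f" by blast
  then show ?thesis using range_inj_infinite[OF u(1)] finite_subset by blast
qed

text \<open>With lists, sums of operators are concatenations, proofs go by induction on the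
  monomials, and the same list becomes a term by \<open>topf\<close>, with coefficients read in
  \<open>'u\<close> through \<open>\<iota>\<close>.\<close>

definition diff_op_list :: "'a::zero diff_op \<Rightarrow> ('a \<times> nat \<times> nat) list" where
  "diff_op_list P = map (\<lambda>(i, j). (Poly_Mapping.lookup P (i, j), i, j))
     (SOME ks. distinct ks \<and> set ks = Poly_Mapping.keys P)"

lemma diff_op_apply_eq_opf: "diff_op_apply \<iota> \<tau> P x = opf \<iota> \<tau> (diff_op_list P) x"
proof -
  define ks where "ks = (SOME ks. distinct ks \<and> set ks = Poly_Mapping.keys P)"
  have "\<exists>ks. distinct ks \<and> set ks = Poly_Mapping.keys P"
    using finite_distinct_list[OF finite_keys[of P]] by blast
  from someI_ex[OF this] have ks: "distinct ks" "set ks = Poly_Mapping.keys P" by (simp_all add: ks_def)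
  have "diff_op_list P = map (\<lambda>(i, j). (Poly_Mapping.lookup P (i, j), i, j)) ks"
    by (simp add: diff_op_list_def ks_def)
  then show ?thesis
    unfolding diff_op_apply_def opf_def ks(2)[symmetric]
    by (simp add: sum.distinct_set_conv_list[OF ks(1)] comp_def case_prod_unfold)
qed

lemma torsion_coordinates:
  fixes \<Lambda> :: "'k::finite_field alg_closure \<Rightarrow> 'k alg_closure"
  assumes \<Lambda>: "\<Lambda> \<in> Ga_End (range to_ac)" "{x. \<Lambda> x = 0} \<noteq> {0}"
    and \<sigma>: "\<sigma> \<in> Gal" and P: "torsion \<Lambda> \<subseteq> diff_op_ker id \<sigma> P"
  shows "\<exists>F es \<alpha>s ps D. (\<forall>r. finite (F r) \<and> (\<forall>x\<in>F r. \<forall>y\<in>F r. x + y \<in> F r \<and> x * y \<in> F r)) \<and>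
    (\<forall>n. \<exists>r::nat. n < card (F r)) \<and> D \<noteq> 0 \<and> poly D 0 = 0 \<and>
    (\<forall>r. \<forall>v\<in>F r. (\<forall>(l, c)\<in>set ps. diff_op_apply id \<sigma> P (opf id \<sigma> es (c * v)) = 0) \<and>
      poly D v = opf id \<sigma> \<alpha>s (\<Sum>(l, c)\<leftarrow>ps. l * opf id \<sigma> es (c * v)))"
proof -
  let ?p = "CHAR('k alg_closure)"
  have p: "prime ?p" using prime_CHAR_finite_field[where ?'k = 'k] by simp
  obtain a n where \<Lambda>_eq: "\<Lambda> = (\<lambda>x. \<Sum>i\<le>n. a i * x ^ (?p ^ i))" and a: "\<And>i. i \<le> n \<Longrightarrow> a i \<in> range to_ac"
    using \<Lambda>(1) by (auto simp: Ga_End_def)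
  have \<Lambda>_add: "\<Lambda> (x + y) = \<Lambda> x + \<Lambda> y" for x y
    by (simp only: \<Lambda>_eq freshmans_dream'[OF p refl] ring_distribs sum.distrib)
  have \<Lambda>_0: "\<Lambda> 0 = 0" using \<Lambda>_add[of 0 0] by (metis add_cancel_left_left add.right_neutral)
  \<comment> \<open>The elements that \<open>Fq\<close> has to contain. The kernel of
    \<open>\<Lambda>\<close> is infinite if \<open>\<Lambda> = 0\<close> and is then left out; in
    that case every point is torsion.\<close>
  define A where "A = range to_ac \<union> (if finite {x. \<Lambda> x = 0} then {x. \<Lambda> x = 0} else {}) \<union>
    Poly_Mapping.lookup P ` Poly_Mapping.keys P"
  have "finite A" by (simp add: A_def)
  have "\<exists>m>0. \<forall>x\<in>A. ((\<lambda>x. x ^ ?p) ^^ m) x = x"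
    by (rule funpow_common_period[OF \<open>finite A\<close>]) (use frobenius_periodic in \<open>simp add: frobenius_funpow\<close>)
  then obtain m where m: "m > 0" "\<And>x. x \<in> A \<Longrightarrow> x ^ (?p ^ m) = x" by (auto simp: frobenius_funpow)
  have hom: "\<sigma> \<in> ring_hom ring_of_type_algebra ring_of_type_algebra"
    using \<sigma> by (simp add: Gal_def ring_iso_def)
  note h = ring_hom_ring_of_type_algebraD[OF hom]
  let ?Fq = "{x :: 'k alg_closure. x ^ (?p ^ m) = x}"
  have fin_Fq: "finite ?Fq"
    using m(1) prime_gt_1_nat[OF p] by (intro finite_power_eq_self one_less_power)
  have "\<exists>M>0. \<forall>x\<in>?Fq. (\<sigma> ^^ M) x = x"
  proof (rule funpow_common_period[OF fin_Fq], rule funpow_periodic[OF h(8) fin_Fq])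
    fix x i assume "x \<in> ?Fq"
    then show "(\<sigma> ^^ i) x \<in> ?Fq" by (induction i) (auto simp flip: h(7))
  qed
  then obtain M where M: "M > 0" "\<And>x. x \<in> ?Fq \<Longrightarrow> (\<sigma> ^^ M) x = x" by blast
  interpret difference_frobenius \<sigma> m M
    by unfold_locales (use p h m M in auto)
  have A_Fq: "A \<subseteq> Fq" using m(2) by (auto simp: Fq_def q_def)
  have \<Lambda>_t: "\<Lambda> (t x) = t (\<Lambda> x)" for x
  proof -
    have "a i \<in> Fq" if "i \<le> n" for i using a[OF that] A_Fq by (auto simp: A_def)
    then have "\<Lambda> (x ^ q) = (\<Lambda> x) ^ q"
      unfolding \<Lambda>_eq q_def freshmans_dream_sum'[OF p refl]
      by (intro sum.cong refl) (auto simp: power_mult_distrib Fq_def q_def mult.commute simp flip: power_mult)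
    moreover have "\<Lambda> (x ^ q) = \<Lambda> (t x) + \<Lambda> x" using \<Lambda>_add[of "t x" x] by (simp add: t_def)
    ultimately show ?thesis by (metis add_diff_cancel_right' t_def)
  qed
  have inf: "infinite (torsion \<Lambda> \<inter> V)"
  proof (cases "\<forall>i\<le>n. a i = 0")
    case True
    then have "\<Lambda> x = 0" for x by (simp add: \<Lambda>_eq)
    then have "torsion \<Lambda> = UNIV" by (auto simp: torsion_def intro!: exI[of _ 1])
    then show ?thesis using infinite_V by simp
  next
    case False
    then obtain i where i: "i \<le> n" "a i \<noteq> 0" by blast
    define f where "f = (\<Sum>i\<le>n. monom (a i) (?p ^ i))"
    have poly_f: "poly f x = \<Lambda> x" for x by (simp add: f_def poly_sum poly_monom \<Lambda>_eq)
    have coeff_f: "coeff f (?p ^ i) = a i"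
    proof -
      have "coeff f (?p ^ i) = (\<Sum>j\<le>n. if j = i then a j else 0)"
        unfolding f_def coeff_sum coeff_monom using prime_gt_1_nat[OF p] by (intro sum.cong) auto
      then show ?thesis using i by simp
    qed
    have p_pos: "?p ^ i > 0" using prime_gt_1_nat[OF p] by simp
    have "surj \<Lambda>"
      unfolding surj_def
    proof
      fix y :: "'k alg_closure"
      have "coeff [:y:] (?p ^ i) = 0" using p_pos by (intro coeff_eq_0) simp
      then have "coeff (f - [:y:]) (?p ^ i) \<noteq> 0" using coeff_f i(2) by simp
      then have "degree (f - [:y:]) > 0" using le_degree p_pos by (metis gr0I leD)
      then obtain x where "poly (f - [:y:]) x = 0" using alg_closed_imp_poly_has_root by blast
      then show "\<exists>x. y = \<Lambda> x" by (auto simp: poly_f)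
    qed
    moreover obtain x where "\<Lambda> x = 0" "x \<noteq> 0" using \<Lambda>(2) \<Lambda>_0 by blast
    ultimately have "infinite (torsion \<Lambda>)" using infinite_torsion \<Lambda>_0 by metis
    moreover have "torsion \<Lambda> \<subseteq> V"
    proof
      have "f \<noteq> 0" using coeff_f i(2) by auto
      then have "finite {x. \<Lambda> x = 0}" using poly_roots_finite[of f] by (simp add: poly_f)
      then have "{x. \<Lambda> x = 0} \<subseteq> Fq" using A_Fq by (auto simp: A_def)
      then have ker: "t x = 0" if "\<Lambda> x = 0" for x using that by (auto simp: Fq_def t_def)
      \<comment> \<open>\<open>t\<close> kills the kernel of \<open>\<Lambda>\<close> and commutes
        with \<open>\<Lambda>\<close>, so the applications of \<open>\<Lambda>\<close> can be traded
        one by one for applications of \<open>t\<close>.\<close>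
      have "(\<Lambda> ^^ N) x = 0 \<Longrightarrow> (t ^^ N) x = 0" for N x
      proof (induction N arbitrary: x)
        case (Suc N)
        have "(t ^^ N) (\<Lambda> x) = 0" using Suc by (simp add: funpow_swap1)
        moreover have "(t ^^ N) (\<Lambda> x) = \<Lambda> ((t ^^ N) x)" by (induction N) (auto simp: \<Lambda>_t)
        ultimately show ?case using ker by simp
      qed simp
      then show "x \<in> torsion \<Lambda> \<Longrightarrow> x \<in> V" for x by (auto simp: torsion_def V_def)
    qed
    ultimately show ?thesis by (simp add: Int_absorb2)
  qed
  have \<Psi>: "diff_op_apply id \<sigma> P v = (\<Sum>(i, j)\<in>Poly_Mapping.keys P.
      Poly_Mapping.lookup P (i, j) * (\<sigma> ^^ i) (v ^ (?p ^ j)))" for v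
    by (simp add: diff_op_apply_def)
  have "\<exists>es \<alpha>s ps D. D \<noteq> 0 \<and> poly D 0 = 0 \<and> (\<forall>v\<in>V. (\<forall>(l, c)\<in>set ps. diff_op_apply id \<sigma> P (opr es (c * v)) = 0) \<and>
    poly D v = opr \<alpha>s (\<Sum>(l, c)\<leftarrow>ps. l * opr es (c * v)))"
    unfolding \<Psi>
  proof (rule kernel_coordinates[OF _ _ _ inf])
    show "Poly_Mapping.lookup P u \<in> Fq \<and> Poly_Mapping.lookup P u \<noteq> 0" if "u \<in> Poly_Mapping.keys P" for u
      using that A_Fq by (auto simp: A_def in_keys_iff)
    show "(\<Sum>(i, j)\<in>Poly_Mapping.keys P. Poly_Mapping.lookup P (i, j) * (\<sigma> ^^ i) (v ^ (?p ^ j))) = 0"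
      if "v \<in> torsion \<Lambda> \<inter> V" for v
      using that P \<Psi>[of v] by (auto simp: diff_op_ker_def)
  qed auto
  then obtain es \<alpha>s ps D where esD: "D \<noteq> 0" "poly D 0 = 0"
    "\<forall>v\<in>V. (\<forall>(l, c)\<in>set ps. diff_op_apply id \<sigma> P (opr es (c * v)) = 0) \<and>
      poly D v = opr \<alpha>s (\<Sum>(l, c)\<leftarrow>ps. l * opr es (c * v))" by blast
  have "\<exists>r. N < card (lev r)" for N
  proof -
    have "N < ?p ^ N" using prime_gt_1_nat[OF p] by (intro power_gt_expt) simp
    then show ?thesis using card_lev[of N] by (intro exI[of _ N]) simp
  qed
  moreover have "v \<in> V" if "v \<in> lev r" for v r using that V_lev by blast
  ultimately show ?thesis
    using esD finite_lev lev_add lev_mult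
    by (intro exI[of _ lev] exI[of _ es] exI[of _ \<alpha>s] exI[of _ ps] exI[of _ D]) (auto simp: opr_def)
qed

section \<open>The contradiction with modularity\<close>

lemma opf_sgen:
  assumes "range \<iota> \<subseteq> sgen \<tau> B" "x \<in> sgen \<tau> B"
  shows "opf \<iota> \<tau> xs x \<in> sgen \<tau> B"
proof (induction xs)
  case Nil
  then show ?case using closed_subfieldD(2)[OF sgen_closed_subfield] by simp
next
  case (Cons y xs)
  obtain c i j where y: "y = (c, i, j)" by (cases y)
  have "(\<tau> ^^ i) z \<in> sgen \<tau> B" if "z \<in> sgen \<tau> B" for z
    using that by (induction i) (auto intro: sgen_\<tau>)
  then show ?case
    using Cons assms by (auto simp: y intro!: closed_subfieldD[OF sgen_closed_subfield])
qed

theorem theorem3: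
  fixes \<Lambda> :: "'k::finite_field alg_closure \<Rightarrow> 'k alg_closure"
  assumes "\<Lambda> \<in> Ga_End (range to_ac)"
    and "{x. \<Lambda> x = 0} \<noteq> {0}"
  shows "\<not> (\<exists>\<sigma>\<in>Gal. \<exists>\<Psi>\<in>End_sigma \<sigma>. \<exists>(P :: 'k alg_closure diff_op)
              (\<kappa> :: 'c rel) (\<tau> :: 'u::field \<Rightarrow> 'u) \<iota>.
            \<Psi> = diff_op_apply id \<sigma> P \<and>
            universal_domain \<kappa> \<sigma> \<tau> \<iota> \<and>
            modular_in \<kappa> \<tau> \<iota> (diff_op_ker \<iota> \<tau> P) \<and>
            torsion \<Lambda> \<subseteq> diff_op_ker id \<sigma> P)"
proof
  assume "\<exists>\<sigma>\<in>Gal. \<exists>\<Psi>\<in>End_sigma \<sigma>. \<exists>(P :: 'k alg_closure diff_op)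
              (\<kappa> :: 'c rel) (\<tau> :: 'u::field \<Rightarrow> 'u) \<iota>.
            \<Psi> = diff_op_apply id \<sigma> P \<and>
            universal_domain \<kappa> \<sigma> \<tau> \<iota> \<and>
            modular_in \<kappa> \<tau> \<iota> (diff_op_ker \<iota> \<tau> P) \<and>
            torsion \<Lambda> \<subseteq> diff_op_ker id \<sigma> P"
  then obtain \<sigma> and P :: "'k alg_closure diff_op" and \<kappa> :: "'c rel" and \<tau> :: "'u::field \<Rightarrow> 'u" and \<iota>
    where \<sigma>: "\<sigma> \<in> Gal" and U: "universal_domain \<kappa> \<sigma> \<tau> \<iota>"
      and modular: "modular_in \<kappa> \<tau> \<iota> (diff_op_ker \<iota> \<tau> P)"
      and tors: "torsion \<Lambda> \<subseteq> diff_op_ker id \<sigma> P"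
    by blast
  have emb: "difference_embedding ring_of_type_algebra \<sigma> ring_of_type_algebra \<tau> \<iota>"
    and card: "|UNIV :: 'k alg_closure set| <o \<kappa>" and ec: "existentially_closed \<tau>"
    using U by (auto simp: universal_domain_def)
  have surj: "surj \<tau>" by (rule existentially_closed_surj[OF ec])
  have surj_\<sigma>: "surj \<sigma>" using \<sigma> by (simp add: Gal_def ring_iso_def bij_betw_def)
  note \<iota> = ring_hom_ring_of_type_algebraD[OF difference_embeddingD(3)[OF emb]]
  obtain F :: "nat \<Rightarrow> 'k alg_closure set" and es \<alpha>s ps D where
    coord: "(\<forall>r. finite (F r) \<and> (\<forall>x\<in>F r. \<forall>y\<in>F r. x + y \<in> F r \<and> x * y \<in> F r)) \<and>
    (\<forall>n. \<exists>r::nat. n < card (F r)) \<and> D \<noteq> 0 \<and> poly D 0 = 0 \<and>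
    (\<forall>r. \<forall>v\<in>F r. (\<forall>(l, c)\<in>set ps. diff_op_apply id \<sigma> P (opf id \<sigma> es (c * v)) = 0) \<and>
      poly D v = opf id \<sigma> \<alpha>s (\<Sum>(l, c)\<leftarrow>ps. l * opf id \<sigma> es (c * v)))"
    using torsion_coordinates[OF assms \<sigma> tors] by (elim exE)
  have F: "finite (F r)" "x \<in> F r \<Longrightarrow> y \<in> F r \<Longrightarrow> x + y \<in> F r"
      "x \<in> F r \<Longrightarrow> y \<in> F r \<Longrightarrow> x * y \<in> F r" "\<exists>r. n < card (F r)" for r x y n
    using coord by simp_all
  have D: "D \<noteq> 0" "poly D 0 = 0" using coord by simp_all
  have ker: "diff_op_apply id \<sigma> P (opf id \<sigma> es (c * v)) = 0" if "v \<in> F r" "(l, c) \<in> set ps" for r v l c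
    using coord that by blast
  have eq: "poly D v = opf id \<sigma> \<alpha>s (\<Sum>(l, c)\<leftarrow>ps. l * opf id \<sigma> es (c * v))" if "v \<in> F r" for r v
    using coord that by blast
  have inf: "infinite (UNIV :: 'k alg_closure set)"
  proof
    assume "finite (UNIV :: 'k alg_closure set)"
    then have "card (F r) \<le> card (UNIV :: 'k alg_closure set)" for r by (simp add: card_mono)
    then show False using F(4) leD by blast
  qed
  define e :: "'k alg_closure \<Rightarrow> 'k alg_closure dterm" where "e c = topf es (TTimes (TParam c) (TVar 0))" for c
  \<comment> \<open>All that is carried over from \<open>V\<close> to \<open>U\<close>: the points
    given by \<open>es\<close> lie in the kernel of \<open>P\<close>, and the value of
    \<open>D\<close> equals \<open>\<alpha>s\<close> applied to their combination.\<close>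
  define Q where "Q = {FEqual (topf (diff_op_list P) (e c)) TZero |l c. (l, c) \<in> set ps} \<union>
    {FEqual (tpoly (degree D) (\<lambda>i. TParam (coeff D i)) (TVar 0))
      (topf \<alpha>s (tsum (map (\<lambda>(l, c). TTimes (TParam l) (e c)) ps)))}"
  have fv_e: "fv_tm (e c) \<subseteq> {0}" for c
    using fv_topf[of es "TTimes (TParam c) (TVar 0)"] by (simp add: e_def)
  have "\<exists>x \<mu> c. (\<forall>\<phi>\<in>Q. sats \<tau> \<iota> \<phi> (\<lambda>_. x) \<and> sats \<tau> \<iota> \<phi> (\<lambda>_. \<mu> * x + c)) \<and>
    x \<notin> acl \<tau> (range \<iota> \<union> {\<mu>, c}) \<and> \<mu> \<notin> acl \<tau> (range \<iota> \<union> {x, \<mu> * x + c})"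
  proof (rule generic_line[OF U surj inf F])
    show "qfree \<phi> \<and> fv \<phi> \<subseteq> {0}" if "\<phi> \<in> Q" for \<phi>
    proof -
      have fv_te: "fv_tm (topf xs (e c)) \<subseteq> {0}" for xs c using fv_topf[of xs "e c"] fv_e by blast
      have "fv_tm (tsum (map (\<lambda>(l, c). TTimes (TParam l) (e c)) ps)) \<subseteq> {0}"
        by (auto simp: fv_tsum dest!: subsetD[OF fv_e])
      then have "fv_tm (topf \<alpha>s (tsum (map (\<lambda>(l, c). TTimes (TParam l) (e c)) ps))) \<subseteq> {0}"
        using fv_topf by (rule subset_trans[rotated])
      moreover have "fv_tm (tpoly (degree D) (\<lambda>i. TParam (coeff D i)) (TVar 0)) \<subseteq> {0}"
        using fv_tpoly[of "degree D" "\<lambda>i. TParam (coeff D i)" "TVar 0"] by simp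
      ultimately show ?thesis using that by (auto simp: Q_def dest: subsetD[OF fv_te])
    qed
    show "sats \<sigma> id \<phi> (\<lambda>_. v)" if "\<phi> \<in> Q" "v \<in> F r" for \<phi> r v
      using that ker[of v r] eq[of v r]
      by (auto simp: Q_def e_def diff_op_apply_eq_opf poly_altdef comp_def case_prod_unfold)
  qed
  then obtain x \<mu> c where Q: "\<And>\<phi>. \<phi> \<in> Q \<Longrightarrow> sats \<tau> \<iota> \<phi> (\<lambda>_. x) \<and> sats \<tau> \<iota> \<phi> (\<lambda>_. \<mu> * x + c)"
    and x: "x \<notin> acl \<tau> (range \<iota> \<union> {\<mu>, c})" and \<mu>: "\<mu> \<notin> acl \<tau> (range \<iota> \<union> {x, \<mu> * x + c})"
    by blast
  define y where "y = \<mu> * x + c"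
  define pt where "pt z = map (\<lambda>(l, c). opf \<iota> \<tau> es (\<iota> c * z)) ps" for z
  have pt_ker: "set (pt z) \<subseteq> diff_op_ker \<iota> \<tau> P"
    and pt_eq: "(\<Sum>i\<le>degree D. \<iota> (coeff D i) * z ^ i) =
      opf \<iota> \<tau> \<alpha>s (\<Sum>(l, c)\<leftarrow>ps. \<iota> l * opf \<iota> \<tau> es (\<iota> c * z))" if "z \<in> {x, y}" for z
  proof -
    have z: "sats \<tau> \<iota> \<phi> (\<lambda>_. z)" if "\<phi> \<in> Q" for \<phi> using Q[OF that] \<open>z \<in> {x, y}\<close> by (auto simp: y_def)
    show "set (pt z) \<subseteq> diff_op_ker \<iota> \<tau> P"
    proof
      fix w assume "w \<in> set (pt z)"
      then obtain l c where lc: "(l, c) \<in> set ps" "w = opf \<iota> \<tau> es (\<iota> c * z)" by (auto simp: pt_def)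
      then have "FEqual (topf (diff_op_list P) (e c)) TZero \<in> Q" by (auto simp: Q_def)
      from z[OF this] show "w \<in> diff_op_ker \<iota> \<tau> P"
        by (simp add: diff_op_ker_def diff_op_apply_eq_opf lc e_def)
    qed
    have "FEqual (tpoly (degree D) (\<lambda>i. TParam (coeff D i)) (TVar 0))
      (topf \<alpha>s (tsum (map (\<lambda>(l, c). TTimes (TParam l) (e c)) ps))) \<in> Q" by (simp add: Q_def)
    from z[OF this] show "(\<Sum>i\<le>degree D. \<iota> (coeff D i) * z ^ i) =
      opf \<iota> \<tau> \<alpha>s (\<Sum>(l, c)\<leftarrow>ps. \<iota> l * opf \<iota> \<tau> es (\<iota> c * z))"
      by (simp add: e_def comp_def case_prod_unfold)
  qed
  \<comment> \<open>Modularity applies to tuples in the kernel, so \<open>A\<close> is generated by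
    the kernel points belonging to \<open>x\<close> and \<open>y\<close>. They determine
    \<open>x\<close> and \<open>y\<close> up to algebraicity, and are themselves computed from
    \<open>x\<close> and \<open>y\<close>.\<close>
  define A where "A = acl \<tau> (range \<iota> \<union> set (pt x @ pt y))"
  define B where "B = acl \<tau> (range \<iota> \<union> set [\<mu>, c])"
  have "|range \<iota>| <o \<kappa>" by (rule ordLeq_ordLess_trans[OF card_of_image card])
  moreover have "range \<iota> = acl \<tau> (range \<iota>)" using acl_range[OF emb surj_\<sigma>] by simp
  moreover have "set (pt x @ pt y) \<subseteq> diff_op_ker \<iota> \<tau> P" using pt_ker[of x] pt_ker[of y] by simp
  ultimately have free: "free_over (A \<inter> B) A B"
    using modular unfolding modular_in_def A_def B_def by blast
  have in_A: "z \<in> A" if z: "z \<in> {x, y}" for z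
  proof -
    define G where "G = range \<iota> \<union> set (pt x @ pt y)"
    note cl = closed_subfieldD[OF sgen_closed_subfield[of \<tau> G]]
    have \<iota>_sgen: "range \<iota> \<subseteq> sgen \<tau> G" and pt_sgen: "set (pt z) \<subseteq> sgen \<tau> G"
      using sgen_incl[of G \<tau>] z by (auto simp: G_def)
    define w where "w = opf \<iota> \<tau> \<alpha>s (\<Sum>(l, c)\<leftarrow>ps. \<iota> l * opf \<iota> \<tau> es (\<iota> c * z))"
    have "(\<Sum>(l, c)\<leftarrow>qs. \<iota> l * opf \<iota> \<tau> es (\<iota> c * z)) \<in> sgen \<tau> G" if "set qs \<subseteq> set ps" for qs
      using that
    proof (induction qs)
      case Nil
      then show ?case using cl(2) by simp
    next
      case (Cons lc qs)
      obtain l c where lc: "lc = (l, c)" by (cases lc)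
      have "opf \<iota> \<tau> es (\<iota> c * z) \<in> set (pt z)" using Cons.prems lc by (force simp: pt_def)
      then show ?case using Cons \<iota>_sgen pt_sgen by (auto simp: lc intro!: cl(4,5))
    qed
    then have w: "w \<in> sgen \<tau> G" unfolding w_def by (intro opf_sgen[OF \<iota>_sgen]) simp
    \<comment> \<open>\<open>D\<close> minus a value \<open>w\<close> of the generated difference
      field. Since \<open>poly D 0 = 0\<close> and \<open>D \<noteq> 0\<close>, the degree of
      \<open>D\<close> is positive and \<open>w\<close> does not touch the leading coefficient, so
      \<open>p\<close> is nonzero.\<close>
    define p where "p = (\<Sum>i\<le>degree D. monom (\<iota> (coeff D i)) i) - [:w:]"
    have "poly p z = 0" using pt_eq[OF z] by (simp add: p_def poly_sum poly_monom w_def)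
    moreover have p_coeff: "coeff p i = \<iota> (coeff D i) - coeff [:w:] i" for i
      by (cases "i \<le> degree D") (auto simp: p_def coeff_sum coeff_eq_0 \<iota>(4))
    have "coeff p i \<in> sgen \<tau> G" for i
      unfolding p_coeff using \<iota>_sgen w by (intro cl(6)) (auto simp: coeff_pCons cl(2) split: nat.split)
    moreover have "p \<noteq> 0"
    proof -
      have "degree D \<noteq> 0"
        using D by (metis degree_0_id poly_0_coeff_0 leading_coeff_0_iff)
      then have "coeff [:w:] (degree D) = 0" by (intro coeff_eq_0) simp
      moreover have "\<iota> (lead_coeff D) \<noteq> 0" using D(1) inj_eq[OF \<iota>(8), of _ 0] \<iota>(4) by simp
      ultimately have "coeff p (degree D) \<noteq> 0" by (simp add: p_coeff)
      then show ?thesis by auto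
    qed
    ultimately show ?thesis unfolding A_def G_def[symmetric] acl_iff algebraic_over_def by blast
  qed
  have "\<mu> \<notin> A"
  proof -
    let ?B = "range \<iota> \<union> {x, y}"
    have \<iota>_sgen: "range \<iota> \<subseteq> sgen \<tau> ?B" and xy: "{x, y} \<subseteq> sgen \<tau> ?B" using sgen_incl[of ?B \<tau>] by auto
    have "set (pt z) \<subseteq> sgen \<tau> ?B" if "z \<in> {x, y}" for z
      using that xy \<iota>_sgen
      by (auto simp: pt_def intro!: opf_sgen closed_subfieldD(4)[OF sgen_closed_subfield])
    then have "A \<subseteq> acl \<tau> ?B" unfolding A_def using \<iota>_sgen by (intro acl_mono) auto
    then show ?thesis using \<mu> by (auto simp: y_def)
  qed
  moreover have "\<mu> \<in> B" "c \<in> B" using acl_incl[of "range \<iota> \<union> set [\<mu>, c]" \<tau>] by (auto simp: B_def)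
  moreover have "x \<notin> B" using x by (simp add: B_def)
  ultimately have "\<not> free_over (A \<inter> B) A B"
    using in_A acl_algebraic acl_closed_subfield
    by (intro line_not_free[of A x y \<mu> B c]) (auto simp: A_def B_def y_def)
  then show False using free by simp
qed

end
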